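(* Let $\mathbb{D}$ be a division ring with finite dimension $d$ over a central subfield $\mathbb{F}$. Let $V$ be a right $\mathbb{D}$-vector space with finite dimension $n>0$, assume that $|\mathbb{F}|\geq nd$, and let $b:V\times V\to\mathbb{F}$ be a nonisotropic $\mathbb{F}$-bilinear form. For $\mathcal{A}_{b,\mathbb{D}}$ to be an irreducible optimal trivial spectrum subspace of $\operatorname{End}_{\mathbb{D}}(V)$, it is necessary and sufficient that both of the following conditions hold: (i) $\mathbb{D}$ is of quadratic type over $\mathbb{F}$; (ii) given an associated pair $(\sigma,e)$ for $\mathbb{D}$ over $\mathbb{F}$, there is a $\sigma$-sesquilinear form $B$ on $V$ such that $$\forall (x,y)\in V^2,\quad b(x,y)=e(B(x,y)).$$ In that case, $B$ is uniquely determined by $b$ (for the given pair $(\sigma,e)$).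
   Context: A central subfield of $\mathbb{D}$ is a subfield contained in the center of $\mathbb{D}$. $\operatorname{End}_{\mathbb{D}}(V)$ is the $\mathbb{F}$-algebra of $\mathbb{D}$-linear endomorphisms of $V$. An $\mathbb{F}$-linear subspace $S$ of $\operatorname{End}_{\mathbb{D}}(V)$ has trivial spectrum if $\operatorname{id}_V-u$ is invertible for all $u\in S$; it is optimal if it has the greatest possible dimension over $\mathbb{F}$ among all trivial spectrum $\mathbb{F}$-linear subspaces of $\operatorname{End}_{\mathbb{D}}(V)$. A subset $\mathcal{X}$ of $\operatorname{End}_{\mathbb{D}}(V)$ is irreducible if $V\neq\{0\}$ and the only $\mathbb{D}$-linear subspaces of $V$ invariant under all elements of $\mathcal{X}$ are $\{0\}$ and $V$. An $\mathbb{F}$-bilinear form $b:V\times V\to\mathbb{F}$ is nonisotropic if $b(x,x)\neq 0$ for all $x\in V\setminus\{0\}$. $\mathcal{A}_{b,\mathbb{D}}$ is the set of all $u\in\operatorname{End}_{\mathbb{D}}(V)$ such that $b(x,u(x))=0$ for all $x\in V$. $\mathbb{D}$ is of quadratic type over $\mathbb{F}$ if one of the following holds: (i) $d=1$; (ii) $d=2$ and $\mathbb{D}$ is a separable field extension of $\mathbb{F}$; (iii) $d=4$ and $\mathbb{D}$ is a quaternion algebra over $\mathbb{F}$; (iv) $d=2^m$ for some $m\geq 1$, $\operatorname{char}(\mathbb{F})=2$ and $\mathbb{D}$ is a hyper-radicial extension of $\mathbb{F}$, i.e. $\mathbb{D}$ is a field and $x^2\in\mathbb{F}$ for all $x\in\mathbb{D}$.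 Cases (i)–(iii) are the separable types. The standard involution $\sigma$ of $\mathbb{D}$ is the identity of $\mathbb{D}$ in cases (i) and (iv), the non-identity $\mathbb{F}$-automorphism in case (ii), and the quaternionic conjugation in case (iii). An associated pair $(\sigma,e)$ for $\mathbb{D}$ over $\mathbb{F}$ (of quadratic type) consists of the standard involution $\sigma$ and of an $\mathbb{F}$-linear form $e:\mathbb{D}\to\mathbb{F}$ which is the Galois trace of $\mathbb{D}$ over $\mathbb{F}$ in cases (i) and (ii) (so $e=\operatorname{id}$ if $d=1$), the reduced trace $x\mapsto x+\sigma(x)$ in case (iii), and an arbitrary nonzero $\mathbb{F}$-linear form on $\mathbb{D}$ in case (iv). A $\sigma$-sesquilinear form on $V$ is a map $B:V^2\to\mathbb{D}$ such that $B(x\alpha+y,z)=\sigma(\alpha)B(x,z)+B(y,z)$ and $B(z,x\alpha+y)=B(z,x)\alpha+B(z,y)$ for all $\alpha\in\mathbb{D}$ and $x,y,z\in V$. *)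

theory Defs
  imports
    "HOL-Computational_Algebra.Polynomial_Factorial"
    "HOL-Library.Function_Algebras"
begin

text \<open>
  The central subfield \<open>F\<close> of the division ring is given as a field type together with its
  embedding \<open>\<iota>\<close>; the subfield itself is \<open>range \<iota>\<close>. A ring homomorphism from a field to a division
  ring is automatically injective.
\<close>

definition central_subfield :: "('f::field \<Rightarrow> 'd::division_ring) \<Rightarrow> bool" where
  "central_subfield \<iota> \<longleftrightarrow>
     \<iota> 1 = 1 \<and> (\<forall>a b. \<iota> (a + b) = \<iota> a + \<iota> b) \<and> (\<forall>a b. \<iota> (a * b) = \<iota> a * \<iota> b) \<and>
     (\<forall>a x. \<iota> a * x = x * \<iota> a)"

definition scaleD :: "('f::field \<Rightarrow> 'd::division_ring) \<Rightarrow> 'f \<Rightarrow> 'd \<Rightarrow> 'd" where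
  "scaleD \<iota> a x = \<iota> a * x"

definition finite_over :: "('f::field \<Rightarrow> 'd::division_ring) \<Rightarrow> bool" where
  "finite_over \<iota> \<longleftrightarrow> (\<exists>Basis. finite_dimensional_vector_space (scaleD \<iota>) Basis)"

definition degree_over :: "('f::field \<Rightarrow> 'd::division_ring) \<Rightarrow> nat" where
  "degree_over \<iota> = vector_space.dim (scaleD \<iota>) (UNIV :: 'd set)"


text \<open>
  The library's vector spaces are over fields, so right vector spaces over a division ring are
  introduced here. The whole type \<open>'v\<close> is the space \<open>V\<close>.
\<close>

locale right_vector_space =
  fixes act :: "'v::ab_group_add \<Rightarrow> 'd::division_ring \<Rightarrow> 'v"
  assumes act_add_left: "act (x + y) \<alpha> = act x \<alpha> + act y \<alpha>"
    and act_add_right: "act x (\<alpha> + \<beta>) = act x \<alpha> + act x \<beta>"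
    and act_act: "act (act x \<alpha>) \<beta> = act x (\<alpha> * \<beta>)"
    and act_one: "act x 1 = x"

definition right_basis :: "('v::ab_group_add \<Rightarrow> 'd::division_ring \<Rightarrow> 'v) \<Rightarrow> 'v set \<Rightarrow> bool" where
  "right_basis act X \<longleftrightarrow>
     finite X \<and>
     (\<forall>c. (\<Sum>x\<in>X. act x (c x)) = 0 \<longrightarrow> (\<forall>x\<in>X. c x = 0)) \<and>
     (\<forall>v. \<exists>c. v = (\<Sum>x\<in>X. act x (c x)))"

definition has_right_dim :: "('v::ab_group_add \<Rightarrow> 'd::division_ring \<Rightarrow> 'v) \<Rightarrow> nat \<Rightarrow> bool" where
  "has_right_dim act n \<longleftrightarrow> (\<exists>X. right_basis act X \<and> card X = n)"

definition right_subspace :: "('v::ab_group_add \<Rightarrow> 'd::division_ring \<Rightarrow> 'v) \<Rightarrow> 'v set \<Rightarrow> bool" where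
  "right_subspace act W \<longleftrightarrow>
     0 \<in> W \<and> (\<forall>x\<in>W. \<forall>y\<in>W. x + y \<in> W) \<and> (\<forall>x\<in>W. \<forall>\<alpha>. act x \<alpha> \<in> W)"

definition End\<^sub>D :: "('v::ab_group_add \<Rightarrow> 'd::division_ring \<Rightarrow> 'v) \<Rightarrow> ('v \<Rightarrow> 'v) set" where
  "End\<^sub>D act = {u. (\<forall>x y. u (x + y) = u x + u y) \<and> (\<forall>x \<alpha>. u (act x \<alpha>) = act (u x) \<alpha>)}"

definition scaleV ::
  "('f::field \<Rightarrow> 'd::division_ring) \<Rightarrow> ('v::ab_group_add \<Rightarrow> 'd \<Rightarrow> 'v) \<Rightarrow> 'f \<Rightarrow> 'v \<Rightarrow> 'v" where
  "scaleV \<iota> act a x = act x (\<iota> a)"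

definition scaleE ::
  "('f::field \<Rightarrow> 'd::division_ring) \<Rightarrow> ('v::ab_group_add \<Rightarrow> 'd \<Rightarrow> 'v) \<Rightarrow>
    'f \<Rightarrow> ('v \<Rightarrow> 'v) \<Rightarrow> ('v \<Rightarrow> 'v)" where
  "scaleE \<iota> act a u = (\<lambda>x. scaleV \<iota> act a (u x))"

definition End_subspace ::
  "('f::field \<Rightarrow> 'd::division_ring) \<Rightarrow> ('v::ab_group_add \<Rightarrow> 'd \<Rightarrow> 'v) \<Rightarrow> ('v \<Rightarrow> 'v) set \<Rightarrow> bool" where
  "End_subspace \<iota> act S \<longleftrightarrow> S \<subseteq> End\<^sub>D act \<and> module.subspace (scaleE \<iota> act) S"

definition invertible_in_End ::
  "('v::ab_group_add \<Rightarrow> 'd::division_ring \<Rightarrow> 'v) \<Rightarrow> ('v \<Rightarrow> 'v) \<Rightarrow> bool" where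
  "invertible_in_End act u \<longleftrightarrow> (\<exists>v\<in>End\<^sub>D act. u \<circ> v = id \<and> v \<circ> u = id)"

definition trivial_spectrum_subspace ::
  "('f::field \<Rightarrow> 'd::division_ring) \<Rightarrow> ('v::ab_group_add \<Rightarrow> 'd \<Rightarrow> 'v) \<Rightarrow> ('v \<Rightarrow> 'v) set \<Rightarrow> bool" where
  "trivial_spectrum_subspace \<iota> act S \<longleftrightarrow>
     End_subspace \<iota> act S \<and> (\<forall>u\<in>S. invertible_in_End act (\<lambda>x. x - u x))"

definition optimal_trivial_spectrum_subspace ::
  "('f::field \<Rightarrow> 'd::division_ring) \<Rightarrow> ('v::ab_group_add \<Rightarrow> 'd \<Rightarrow> 'v) \<Rightarrow> ('v \<Rightarrow> 'v) set \<Rightarrow> bool" where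
  "optimal_trivial_spectrum_subspace \<iota> act S \<longleftrightarrow>
     trivial_spectrum_subspace \<iota> act S \<and>
     (\<forall>T. trivial_spectrum_subspace \<iota> act T \<longrightarrow>
        vector_space.dim (scaleE \<iota> act) T \<le> vector_space.dim (scaleE \<iota> act) S)"

definition irreducible_in_End ::
  "('v::ab_group_add \<Rightarrow> 'd::division_ring \<Rightarrow> 'v) \<Rightarrow> ('v \<Rightarrow> 'v) set \<Rightarrow> bool" where
  "irreducible_in_End act S \<longleftrightarrow>
     (UNIV :: 'v set) \<noteq> {0} \<and>
     (\<forall>W. right_subspace act W \<and> (\<forall>u\<in>S. u ` W \<subseteq> W) \<longrightarrow> W = {0} \<or> W = UNIV)"


definition bilinear_form ::
  "('f::field \<Rightarrow> 'd::division_ring) \<Rightarrow> ('v::ab_group_add \<Rightarrow> 'd \<Rightarrow> 'v) \<Rightarrow> ('v \<Rightarrow> 'v \<Rightarrow> 'f) \<Rightarrow> bool" where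
  "bilinear_form \<iota> act b \<longleftrightarrow>
     (\<forall>x. Vector_Spaces.linear (scaleV \<iota> act) (*) (\<lambda>y. b x y)) \<and>
     (\<forall>y. Vector_Spaces.linear (scaleV \<iota> act) (*) (\<lambda>x. b x y))"

definition nonisotropic :: "('v::ab_group_add \<Rightarrow> 'v \<Rightarrow> 'f::field) \<Rightarrow> bool" where
  "nonisotropic b \<longleftrightarrow> (\<forall>x. x \<noteq> 0 \<longrightarrow> b x x \<noteq> 0)"

definition \<A> ::
  "('v::ab_group_add \<Rightarrow> 'd::division_ring \<Rightarrow> 'v) \<Rightarrow> ('v \<Rightarrow> 'v \<Rightarrow> 'f::field) \<Rightarrow> ('v \<Rightarrow> 'v) set" where
  "\<A> act b = {u \<in> End\<^sub>D act. \<forall>x. b x (u x) = 0}"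

definition sesquilinear ::
  "('v::ab_group_add \<Rightarrow> 'd::division_ring \<Rightarrow> 'v) \<Rightarrow> ('d \<Rightarrow> 'd) \<Rightarrow> ('v \<Rightarrow> 'v \<Rightarrow> 'd) \<Rightarrow> bool" where
  "sesquilinear act \<sigma> B \<longleftrightarrow>
     (\<forall>\<alpha> x y z. B (act x \<alpha> + y) z = \<sigma> \<alpha> * B x z + B y z) \<and>
     (\<forall>\<alpha> x y z. B z (act x \<alpha> + y) = B z x * \<alpha> + B z y)"


definition commutative_ring :: "'d::division_ring itself \<Rightarrow> bool" where
  "commutative_ring _ \<longleftrightarrow> (\<forall>x y :: 'd. x * y = y * x)"

text \<open>The library's \<open>poly\<close> evaluates only in commutative rings.\<close>

definition poly_at :: "('f::field \<Rightarrow> 'd::division_ring) \<Rightarrow> 'f poly \<Rightarrow> 'd \<Rightarrow> 'd" where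
  "poly_at \<iota> p x = (\<Sum>i\<le>degree p. \<iota> (coeff p i) * x ^ i)"

text \<open>
  An element is separable if its minimal polynomial is; here \<open>p\<close> is the minimal polynomial
  up to a nonzero scalar.
\<close>

definition separable_element :: "('f::field \<Rightarrow> 'd::division_ring) \<Rightarrow> 'd \<Rightarrow> bool" where
  "separable_element \<iota> x \<longleftrightarrow>
     (\<exists>p. irreducible p \<and> poly_at \<iota> p x = 0 \<and> coprime p (pderiv p))"

definition separable_field_ext :: "('f::field \<Rightarrow> 'd::division_ring) \<Rightarrow> bool" where
  "separable_field_ext \<iota> \<longleftrightarrow> commutative_ring TYPE('d) \<and> (\<forall>x. separable_element \<iota> x)"

definition center :: "'d::division_ring set" where
  "center = {z. \<forall>x. z * x = x * z}"

text \<open>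
  A quaternion algebra is a central simple algebra of dimension 4. Simplicity is automatic for
  a division ring.
\<close>

definition quaternion_algebra :: "('f::field \<Rightarrow> 'd::division_ring) \<Rightarrow> bool" where
  "quaternion_algebra \<iota> \<longleftrightarrow> degree_over \<iota> = 4 \<and> center = range \<iota>"

definition hyper_radicial :: "('f::field \<Rightarrow> 'd::division_ring) \<Rightarrow> bool" where
  "hyper_radicial \<iota> \<longleftrightarrow> commutative_ring TYPE('d) \<and> (\<forall>x. x\<^sup>2 \<in> range \<iota>)"

definition quadratic_type_i :: "('f::field \<Rightarrow> 'd::division_ring) \<Rightarrow> bool" where
  "quadratic_type_i \<iota> \<longleftrightarrow> degree_over \<iota> = 1"

definition quadratic_type_ii :: "('f::field \<Rightarrow> 'd::division_ring) \<Rightarrow> bool" where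
  "quadratic_type_ii \<iota> \<longleftrightarrow> degree_over \<iota> = 2 \<and> separable_field_ext \<iota>"

definition quadratic_type_iii :: "('f::field \<Rightarrow> 'd::division_ring) \<Rightarrow> bool" where
  "quadratic_type_iii \<iota> \<longleftrightarrow> degree_over \<iota> = 4 \<and> quaternion_algebra \<iota>"

definition quadratic_type_iv :: "('f::field \<Rightarrow> 'd::division_ring) \<Rightarrow> bool" where
  "quadratic_type_iv \<iota> \<longleftrightarrow>
     (\<exists>m\<ge>1. degree_over \<iota> = 2 ^ m) \<and> CHAR('f) = 2 \<and> hyper_radicial \<iota>"

definition quadratic_type :: "('f::field \<Rightarrow> 'd::division_ring) \<Rightarrow> bool" where
  "quadratic_type \<iota> \<longleftrightarrow>
     quadratic_type_i \<iota> \<or> quadratic_type_ii \<iota> \<or> quadratic_type_iii \<iota> \<or> quadratic_type_iv \<iota>"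

definition algebra_auts :: "('f::field \<Rightarrow> 'd::division_ring) \<Rightarrow> ('d \<Rightarrow> 'd) set" where
  "algebra_auts \<iota> =
     {\<tau>. bij \<tau> \<and> (\<forall>x y. \<tau> (x + y) = \<tau> x + \<tau> y) \<and> (\<forall>x y. \<tau> (x * y) = \<tau> x * \<tau> y) \<and>
         (\<forall>a. \<tau> (\<iota> a) = \<iota> a)}"

text \<open>
  Quaternionic conjugation: the unique \<open>F\<close>-linear anti-automorphism of order at most 2 for which
  \<open>x + \<sigma> x\<close> (reduced trace) and \<open>x * \<sigma> x\<close> (reduced norm) always lie in \<open>F\<close>. This is valid
  in every characteristic.
\<close>

definition quaternion_conjugation :: "('f::field \<Rightarrow> 'd::division_ring) \<Rightarrow> ('d \<Rightarrow> 'd) \<Rightarrow> bool" where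
  "quaternion_conjugation \<iota> \<sigma> \<longleftrightarrow>
     Vector_Spaces.linear (scaleD \<iota>) (scaleD \<iota>) \<sigma> \<and>
     (\<forall>x y. \<sigma> (x * y) = \<sigma> y * \<sigma> x) \<and> (\<forall>x. \<sigma> (\<sigma> x) = x) \<and>
     (\<forall>x. x + \<sigma> x \<in> range \<iota>) \<and> (\<forall>x. x * \<sigma> x \<in> range \<iota>)"

definition standard_involution :: "('f::field \<Rightarrow> 'd::division_ring) \<Rightarrow> ('d \<Rightarrow> 'd) \<Rightarrow> bool" where
  "standard_involution \<iota> \<sigma> \<longleftrightarrow>
     (quadratic_type_i \<iota> \<and> \<sigma> = id) \<or>
     (quadratic_type_ii \<iota> \<and> \<sigma> \<in> algebra_auts \<iota> \<and> \<sigma> \<noteq> id) \<or>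
     (quadratic_type_iii \<iota> \<and> quaternion_conjugation \<iota> \<sigma>) \<or>
     (quadratic_type_iv \<iota> \<and> \<sigma> = id)"

definition galois_trace :: "('f::field \<Rightarrow> 'd::division_ring) \<Rightarrow> ('d \<Rightarrow> 'f) \<Rightarrow> bool" where
  "galois_trace \<iota> e \<longleftrightarrow> (\<forall>x. \<iota> (e x) = (\<Sum>\<tau>\<in>algebra_auts \<iota>. \<tau> x))"

definition associated_pair ::
  "('f::field \<Rightarrow> 'd::division_ring) \<Rightarrow> ('d \<Rightarrow> 'd) \<Rightarrow> ('d \<Rightarrow> 'f) \<Rightarrow> bool" where
  "associated_pair \<iota> \<sigma> e \<longleftrightarrow>
     standard_involution \<iota> \<sigma> \<and> Vector_Spaces.linear (scaleD \<iota>) (*) e \<and>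
     (quadratic_type_i \<iota> \<or> quadratic_type_ii \<iota> \<longrightarrow> galois_trace \<iota> e) \<and>
     (quadratic_type_iii \<iota> \<longrightarrow> (\<forall>x. \<iota> (e x) = x + \<sigma> x)) \<and>
     (quadratic_type_iv \<iota> \<longrightarrow> (\<exists>x. e x \<noteq> 0))"

end

theory Submission
  imports Defs
begin

text \<open>
  Write \<open>A\<close> for \<open>\<A> act b\<close> and \<open>d\<close> for the degree of \<open>D\<close> over \<open>F\<close>. Peeling off one vector \<open>x\<close> of
  maximal orbit dimension at a time bounds the dimension of every trivial spectrum subspace by the
  sum of the numbers \<open>k d - 1\<close> over \<open>1 \<le> k \<le> n\<close>; this is where \<open>|F| \<ge> n d\<close> enters.

  Comparing \<open>A\<close> with a block triangular trivial spectrum subspace shows that, if \<open>A\<close> is optimal,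
  \<open>A x = {y. b x y = 0}\<close> for every \<open>x \<noteq> 0\<close>. This transitivity already implies irreducibility.
  Restricted to a line \<open>x D\<close> it yields \<open>b (x \<alpha>) (x \<beta>) = b x (x \<beta> \<sigma>(\<alpha>))\<close> for an \<open>F\<close>-linear map \<open>\<sigma>\<close> with
  \<open>\<sigma>(1) = 1\<close> and \<open>\<alpha> \<sigma>(\<alpha>) \<in> F\<close>. Such a map is unique, it is an involutory antiautomorphism, and its
  existence forces \<open>D\<close> to be of quadratic type. The form \<open>B\<close> is then read off from
  \<open>e (B x y l) = b x (y l)\<close>, the trace form of \<open>e\<close> being nondegenerate.

  Conversely, given \<open>B\<close>, the maps \<open>z \<mapsto> w \<sigma>(B z v) - v \<sigma>(B z w)\<close> and \<open>z \<mapsto> x c \<sigma>(B z x)\<close> with \<open>e c = 0\<close>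
  lie in \<open>A\<close> and are enough for \<open>A\<close> to attain the dimension bound.
\<close>


text \<open>Each number \<open>k d - 1\<close> has two sources. In a \<open>D\<close>-subspace
  \<open>H\<close> of dimension \<open>k d\<close> over \<open>F\<close>, the orbit
  \<open>T x\<close> misses \<open>x\<close> itself, since fixed vectors are forbidden; this
  accounts for the -1. The elements of \<open>T\<close> that kill \<open>x\<close> take values in
  the largest \<open>D\<close>-subspace of \<open>T x\<close>, which is contained in a complement of
  \<open>x D\<close> in \<open>H\<close>; so the next round starts from dimension
  \<open>(k - 1) d\<close>. Condition (ii) would hold vacuously if no associated pair existed, so
  pairs have to be constructed for every type. For quaternion algebras this means building the
  reduced trace from the centre and the dimension alone, and proving it additive takes a scalar
  other than 0 and 1; the hypothesis provides it, as |F| >= 4 n. The four types differ in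
  \<open>\<sigma>\<close> and \<open>e\<close>, but share the properties on which the rest is built:
  \<open>e\<close> is nonzero, symmetric on products and invariant under \<open>\<sigma>\<close>,
  and \<open>e c = 0\<close> implies \<open>e (q c \<sigma>(q)) = 0\<close>. The last one places the
  rank one maps in \<open>A\<close>.\<close>

section \<open>Finite-dimensional subspaces\<close>

text \<open>
  A copy of \<open>vector_space\<close>: names added to the original would clash with those inherited by its
  interpretation \<open>real_vector\<close>.
\<close>

locale vspace = vector_space scale
  for scale :: "'a::field \<Rightarrow> 'b::ab_group_add \<Rightarrow> 'b"
begin

text \<open>Relative to a set, because the space of all functions on \<open>'v\<close>, in which the
  endomorphisms live, need not be finite-dimensional.\<close>

definition fin_dim :: "'b set \<Rightarrow> bool" where
  "fin_dim S \<longleftrightarrow> (\<exists>B. finite B \<and> S \<subseteq> span B)"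

lemma fin_dim_subset: "fin_dim T \<Longrightarrow> S \<subseteq> T \<Longrightarrow> fin_dim S"
  unfolding fin_dim_def by blast

lemma fin_dim_basis:
  assumes "fin_dim S" "subspace S"
  obtains B where "finite B" "B \<subseteq> S" "\<not> dependent B" "span B = S" "card B = dim S"
proof -
  obtain B where B: "B \<subseteq> S" "\<not> dependent B" "S \<subseteq> span B" "card B = dim S"
    using basis_exists by blast
  obtain C where C: "finite C" "S \<subseteq> span C"
    using assms(1) unfolding fin_dim_def by blast
  have "finite B"
    using independent_span_bound[OF C(1) B(2)] B(1) C(2) by blast
  moreover have "span B = S"
    using B(1,3) assms(2) by (simp add: span_subspace)
  ultimately show thesis using that B by blast
qed

lemma independent_card_le_fin_dim:
  assumes "fin_dim S" "subspace S" "\<not> dependent C" "C \<subseteq> S"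
  shows "finite C \<and> card C \<le> dim S"
proof -
  obtain B where "finite B" "span B = S" "card B = dim S"
    using fin_dim_basis[OF assms(1,2)] by metis
  then show ?thesis
    using independent_span_bound[of B C] assms by auto
qed

lemma dim_mono_fin_dim:
  assumes "fin_dim T" "subspace T" "subspace S" "S \<subseteq> T"
  shows "dim S \<le> dim T"
proof -
  obtain B where "finite B" "B \<subseteq> S" "\<not> dependent B" "span B = S" "card B = dim S"
    by (rule fin_dim_basis[OF fin_dim_subset[OF assms(1,4)] assms(3)])
  then show ?thesis
    using independent_card_le_fin_dim[OF assms(1,2), of B] assms(4) by auto
qed

lemma dim_less_if_proper:
  assumes "fin_dim T" "subspace T" "subspace S" "S \<subseteq> T" "x \<in> T" "x \<notin> S"
  shows "dim S < dim T"
proof -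
  obtain B where B: "finite B" "B \<subseteq> S" "\<not> dependent B" "span B = S" "card B = dim S"
    by (rule fin_dim_basis[OF fin_dim_subset[OF assms(1,4)] assms(3)])
  have "\<not> dependent (insert x B)"
    using B assms(6) by (simp add: independent_insertI)
  then have "card (insert x B) \<le> dim T"
    using independent_card_le_fin_dim[OF assms(1,2)] B(2) assms(4,5) by blast
  moreover have "x \<notin> B"
    using assms(6) B(2) by blast
  ultimately show ?thesis using B(1,5) by simp
qed

lemma subspace_eq_if_dim_le:
  assumes "fin_dim T" "subspace T" "subspace S" "S \<subseteq> T" "dim T \<le> dim S"
  shows "S = T"
  using dim_less_if_proper[OF assms(1-4)] assms(4,5) by (meson not_less subset_antisym subsetI)

text \<open>Induction on the eigenvalues: applying \<open>f\<close> to a relation and subtracting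
  \<open>m\<close> times that relation cancels the term of \<open>m\<close>.\<close>

lemma eigenvectors_independent:
  assumes f: "Vector_Spaces.linear scale scale f" and "finite L"
    and "\<And>l. l \<in> L \<Longrightarrow> v l \<noteq> 0 \<and> f (v l) = scale l (v l)"
  shows "inj_on v L \<and> \<not> dependent (v ` L)"
proof -
  have *: "(\<forall>l\<in>L. c l = 0)" if "(\<Sum>l\<in>L. scale (c l) (v l)) = 0" for c
    using assms(2,3) that
  proof (induction L arbitrary: c rule: finite_induct)
    case (insert m L)
    interpret f: Vector_Spaces.linear scale scale f by fact
    let ?s = "\<Sum>l\<in>L. scale (c l) (v l)"
    have 1: "scale (c m) (v m) + ?s = 0" using insert by simp
    have "f (scale (c m) (v m) + ?s) = 0" using 1 f.zero by simp
    then have 2: "scale (c m * m) (v m) + (\<Sum>l\<in>L. scale (c l * l) (v l)) = 0"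
      using insert.prems by (simp add: f.add f.sum f.scale)
    have "scale m (scale (c m) (v m) + ?s) = 0" unfolding 1 by (rule scale_zero_right)
    then have 3: "scale (c m * m) (v m) + (\<Sum>l\<in>L. scale (c l * m) (v l)) = 0"
      by (simp only: scale_right_distrib scale_sum_right scale_scale mult.commute[of m])
    have "(\<Sum>l\<in>L. scale (c l * (l - m)) (v l))
        = (\<Sum>l\<in>L. scale (c l * l) (v l)) - (\<Sum>l\<in>L. scale (c l * m) (v l))"
      by (simp add: sum_subtractf scale_left_diff_distrib right_diff_distrib)
    then have "(\<Sum>l\<in>L. scale (c l * (l - m)) (v l)) = 0"
      using 2 3 by (metis (no_types) add_left_cancel right_minus_eq)
    then have "\<forall>l\<in>L. c l * (l - m) = 0"
      by (intro insert.IH) (use insert.prems in auto)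
    then have z: "\<forall>l\<in>L. c l = 0" using insert.hyps by auto
    then have "?s = 0" by simp
    then have "c m = 0" using 1 insert.prems by auto
    then show ?case using z by auto
  qed simp
  have inj: "inj_on v L"
  proof (rule inj_onI, rule ccontr)
    fix l m assume lm: "l \<in> L" "m \<in> L" "v l = v m" "l \<noteq> m"
    have "scale l (v l) = scale m (v l)" using lm assms(3) by metis
    then show False using lm assms(3)[of l] by simp
  qed
  moreover have "\<not> dependent (v ` L)"
  proof (rule independent_if_scalars_zero)
    fix c x assume c: "(\<Sum>x\<in>v ` L. scale (c x) x) = 0" and x: "x \<in> v ` L"
    have "(\<Sum>l\<in>L. scale (c (v l)) (v l)) = 0"
      using c by (simp add: sum.reindex[OF inj])
    then show "c x = 0" using *[of "c \<circ> v"] x by auto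
  qed (use assms(2) in auto)
  ultimately show ?thesis by blast
qed

end

section \<open>Rank and nullity\<close>

locale vspace_pair = vector_space_pair s1 s2 + vs1: vspace s1 + vs2: vspace s2
  for s1 :: "'a::field \<Rightarrow> 'b::ab_group_add \<Rightarrow> 'b" and s2 :: "'a \<Rightarrow> 'c::ab_group_add \<Rightarrow> 'c"
begin

text \<open>A basis of the kernel together with lifts of a basis of the image is a basis of
  \<open>S\<close>. That \<open>S\<close> is finite-dimensional is a conclusion here, so that
  evaluation maps can bound spaces of functions not yet known to be so.\<close>

lemma rank_nullity:
  assumes f: "Vector_Spaces.linear s1 s2 f" and S: "vs1.subspace S"
    and ker: "vs1.fin_dim {x\<in>S. f x = 0}" and im: "vs2.fin_dim (f ` S)"
  shows "vs1.fin_dim S" and "vs1.dim S = vs2.dim (f ` S) + vs1.dim {x\<in>S. f x = 0}"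
proof -
  interpret f: Vector_Spaces.linear s1 s2 f by fact
  have kers: "vs1.subspace {x\<in>S. f x = 0}"
    using S by (auto simp: vs1.subspace_def f.add f.scale f.zero)
  have ims: "vs2.subspace (f ` S)"
    using S by (rule f.subspace_image)
  obtain K where K: "finite K" "K \<subseteq> {x\<in>S. f x = 0}" "\<not> vs1.dependent K"
      "vs1.span K = {x\<in>S. f x = 0}" "card K = vs1.dim {x\<in>S. f x = 0}"
    by (rule vs1.fin_dim_basis[OF ker kers])
  obtain C where C: "finite C" "C \<subseteq> f ` S" "\<not> vs2.dependent C" "vs2.span C = f ` S"
      "card C = vs2.dim (f ` S)"
    by (rule vs2.fin_dim_basis[OF im ims])
  obtain g where g: "range g \<subseteq> S" "Vector_Spaces.linear s2 s1 g" "\<And>v. v \<in> f ` S \<Longrightarrow> f (g v) = v"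
    using linear_exists_right_inverse_on[OF f S] by auto
  interpret g: Vector_Spaces.linear s2 s1 g by fact
  have ind: "\<not> vs1.dependent (K \<union> g ` C') \<and> card (K \<union> g ` C') = card K + card C'"
    if "C' \<subseteq> C" for C'
    using finite_subset[OF that C(1)] that
  proof (induction C' rule: finite_induct)
    case (insert c C')
    have n: "g c \<notin> vs1.span (K \<union> g ` C')"
    proof
      assume "g c \<in> vs1.span (K \<union> g ` C')"
      then have "f (g c) \<in> vs2.span (f ` (K \<union> g ` C'))"
        using f.span_image by auto
      moreover have "f (g c) = c" using g(3) C(2) insert.prems by blast
      moreover have "f ` (K \<union> g ` C') \<subseteq> vs2.span C'"
      proof -
        have "f x = 0" if "x \<in> K" for x using K(2) that by blast
        moreover have "f (g x) = x" if "x \<in> C'" for x using g(3) C(2) insert.prems that by blast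
        ultimately show ?thesis by (auto simp: vs2.span_zero vs2.span_base)
      qed
      ultimately have "c \<in> vs2.span C'"
        by (metis vs2.span_minimal[OF _ vs2.subspace_span] subsetD)
      moreover have "C' \<subseteq> C - {c}" using insert by blast
      ultimately have "c \<in> vs2.span (C - {c})" using vs2.span_mono by blast
      then show False using C(3) insert.prems vs2.dependent_def by blast
    qed
    then have "g c \<notin> K \<union> g ` C'" using vs1.span_superset[of "K \<union> g ` C'"] by blast
    moreover have "finite (K \<union> g ` C')" using K(1) insert by simp
    ultimately show ?case using n insert by (simp add: vs1.independent_insertI)
  qed (use K in auto)
  have sub: "S \<subseteq> vs1.span (K \<union> g ` C)"
  proof
    fix x assume x: "x \<in> S"
    have "x - g (f x) \<in> vs1.span K"
      unfolding K(4) using x g S by (auto simp: f.diff intro: vs1.subspace_diff)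
    moreover have "g (f x) \<in> vs1.span (g ` C)"
      unfolding g.span_image C(4) using x by blast
    ultimately have "(x - g (f x)) + g (f x) \<in> vs1.span (K \<union> g ` C)"
      unfolding vs1.span_Un by blast
    then show "x \<in> vs1.span (K \<union> g ` C)" by simp
  qed
  then show "vs1.fin_dim S"
    unfolding vs1.fin_dim_def using K(1) C(1) by (intro exI[of _ "K \<union> g ` C"]) simp
  have "K \<union> g ` C \<subseteq> S" using K(2) g(1) by blast
  then have "card (K \<union> g ` C) = vs1.dim S"
    using vs1.basis_card_eq_dim[OF _ sub] ind[of C] by simp
  then show "vs1.dim S = vs2.dim (f ` S) + vs1.dim {x\<in>S. f x = 0}"
    using ind[of C] K(5) C(5) by simp
qed

lemma fin_dim_image:
  assumes "Vector_Spaces.linear s1 s2 f" "vs1.fin_dim S"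
  shows "vs2.fin_dim (f ` S)"
proof -
  interpret f: Vector_Spaces.linear s1 s2 f by fact
  obtain B where "finite B" "S \<subseteq> vs1.span B" using assms(2) vs1.fin_dim_def by blast
  then have "f ` S \<subseteq> vs2.span (f ` B)" by (simp add: f.spans_image)
  then show ?thesis using \<open>finite B\<close> vs2.fin_dim_def by blast
qed

lemma dim_image_plus_kernel:
  assumes f: "Vector_Spaces.linear s1 s2 f" and S: "vs1.subspace S" and "vs1.fin_dim S"
  shows "vs1.dim S = vs2.dim (f ` S) + vs1.dim {x\<in>S. f x = 0}"
proof -
  have "vs1.fin_dim {x\<in>S. f x = 0}"
    using assms(3) by (rule vs1.fin_dim_subset) blast
  then show ?thesis using rank_nullity(2)[OF f S] fin_dim_image[OF f assms(3)] by blast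
qed

lemma dim_image_inj:
  assumes f: "Vector_Spaces.linear s1 s2 f" and S: "vs1.subspace S" and "vs1.fin_dim S"
    and "\<And>x. x \<in> S \<Longrightarrow> f x = 0 \<Longrightarrow> x = 0"
  shows "vs2.dim (f ` S) = vs1.dim S"
proof -
  interpret f: Vector_Spaces.linear s1 s2 f by fact
  have "{x\<in>S. f x = 0} = {0}"
    using assms(4) vs1.subspace_0[OF S] f.zero by auto
  moreover have "vs1.dim {0} = 0"
    using vs1.dim_le_card[of "{0}" "{}"] by simp
  ultimately show ?thesis using dim_image_plus_kernel[OF assms(1-3)] by simp
qed

end

lemma vspace_field: "vspace ((*) :: 'f::field \<Rightarrow> _)"
  by unfold_locales (auto simp: algebra_simps)

lemma fin_dim_field: "vspace.fin_dim ((*) :: 'f::field \<Rightarrow> _) S"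
proof -
  interpret vspace "(*) :: 'f \<Rightarrow> _" by (rule vspace_field)
  have "S \<subseteq> span {1}" unfolding span_singleton by (auto simp: image_iff)
  then show ?thesis unfolding fin_dim_def by blast
qed

lemma dim_field: "vector_space.dim ((*) :: 'f::field \<Rightarrow> _) UNIV = 1"
proof -
  interpret vspace "(*) :: 'f \<Rightarrow> _" by (rule vspace_field)
  have "UNIV \<subseteq> span {1}" unfolding span_singleton by (auto simp: image_iff)
  then have "card {1::'f} = dim UNIV" by (intro basis_card_eq_dim) auto
  then show ?thesis by simp
qed

context vspace
begin

lemma dim_kernel_form:
  assumes f: "Vector_Spaces.linear scale (*) f" and S: "subspace S" "fin_dim S" and "x \<in> S" "f x \<noteq> 0"
  shows "dim S = dim {y\<in>S. f y = 0} + 1"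
proof -
  interpret F: vspace "(*) :: 'a \<Rightarrow> _" by (rule vspace_field)
  interpret P: vspace_pair scale "(*)" by unfold_locales
  interpret f: Vector_Spaces.linear scale "(*)" f by fact
  have "c \<in> f ` S" for c
  proof -
    have "f (scale (c / f x) x) = c" using assms(5) by (simp add: f.scale)
    then show ?thesis using subspace_scale[OF S(1) assms(4)] by (metis imageI)
  qed
  then have "f ` S = UNIV" by blast
  then show ?thesis using P.dim_image_plus_kernel[OF f S] by (simp add: dim_field)
qed

lemma pointwise: "vspace (\<lambda>a (u :: 'c \<Rightarrow> 'b) x. scale a (u x))"
  by unfold_locales (auto simp: fun_eq_iff scale_right_distrib scale_left_distrib)

text \<open>Evaluating at the points of \<open>X\<close> one after the other bounds the dimension of \<open>E\<close>.\<close>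

lemma fin_dim_functions:
  fixes E :: "('c \<Rightarrow> 'b) set"
  assumes "fin_dim (UNIV :: 'b set)" "finite X"
    and "module.subspace (\<lambda>a (u :: 'c \<Rightarrow> 'b) x. scale a (u x)) E"
    and "\<And>u. u \<in> E \<Longrightarrow> \<forall>x\<in>X. u x = 0 \<Longrightarrow> u = 0"
  shows "vspace.fin_dim (\<lambda>a (u :: 'c \<Rightarrow> 'b) x. scale a (u x)) E
    \<and> vector_space.dim (\<lambda>a (u :: 'c \<Rightarrow> 'b) x. scale a (u x)) E \<le> card X * dim UNIV"
  using assms(2-4)
proof (induction X arbitrary: E rule: finite_induct)
  case empty
  interpret E: vspace "\<lambda>a (u :: 'c \<Rightarrow> 'b) x. scale a (u x)" by (rule pointwise)
  have "E \<subseteq> E.span {}"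
  proof
    fix u assume "u \<in> E"
    then have "u = 0" by (rule empty(2)) simp
    then show "u \<in> E.span {}" by (simp add: E.span_zero)
  qed
  then show ?case using E.dim_le_card[of E "{}"] unfolding E.fin_dim_def by (metis card.empty finite.emptyI le_zero_eq mult_0)
next
  case (insert x X)
  interpret E: vspace "\<lambda>a (u :: 'c \<Rightarrow> 'b) x. scale a (u x)" by (rule pointwise)
  interpret P: vspace_pair "\<lambda>a (u :: 'c \<Rightarrow> 'b) x. scale a (u x)" scale by unfold_locales
  let ?f = "\<lambda>u :: 'c \<Rightarrow> 'b. u x"
  let ?K = "{u\<in>E. ?f u = 0}"
  have lin: "Vector_Spaces.linear (\<lambda>a (u :: 'c \<Rightarrow> 'b) x. scale a (u x)) scale ?f"
    by unfold_locales auto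
  interpret f: Vector_Spaces.linear "\<lambda>a (u :: 'c \<Rightarrow> 'b) x. scale a (u x)" scale ?f by (rule lin)
  have "E.subspace ?K"
    using insert.prems(1) by (auto simp: E.subspace_def)
  then have K: "E.fin_dim ?K" "E.dim ?K \<le> card X * dim UNIV"
    using insert.IH[of ?K] insert.prems by auto
  have im: "fin_dim (?f ` E)" "dim (?f ` E) \<le> dim UNIV"
    using assms(1) fin_dim_subset f.subspace_image[OF insert.prems(1)] dim_mono_fin_dim by auto
  show ?case
    using P.rank_nullity[OF lin insert.prems(1) K(1) im(1)] K(2) im(2) insert.hyps
    by simp
qed

end


section \<open>Right vector spaces over an extension of the base field\<close>

locale central_ext =
  fixes \<iota> :: "'f::field \<Rightarrow> 'd::division_ring"
  assumes central_subfield: "central_subfield \<iota>"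
    and finite_over: "finite_over \<iota>"
begin

lemma emb_one [simp]: "\<iota> 1 = 1"
  and emb_add: "\<iota> (a + b) = \<iota> a + \<iota> b"
  and emb_mult: "\<iota> (a * b) = \<iota> a * \<iota> b"
  and emb_commute: "\<iota> a * x = x * \<iota> a"
  using central_subfield unfolding central_subfield_def by blast+

lemma emb_zero [simp]: "\<iota> 0 = 0"
  using emb_add[of 0 0] by simp

lemma emb_minus: "\<iota> (- a) = - \<iota> a"
  using emb_add[of a "- a"] by (simp add: eq_neg_iff_add_eq_0 add.commute)

lemma emb_diff: "\<iota> (a - b) = \<iota> a - \<iota> b"
  using emb_add[of a "- b"] by (simp add: emb_minus)

lemma emb_eq_0_iff [simp]: "\<iota> a = 0 \<longleftrightarrow> a = 0"
proof
  assume "\<iota> a = 0"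
  then have "\<iota> (a * inverse a) = 0" by (simp add: emb_mult)
  then show "a = 0" by (cases "a = 0") auto
qed simp

lemma emb_eq_iff [simp]: "\<iota> a = \<iota> b \<longleftrightarrow> a = b"
  using emb_eq_0_iff[of "a - b"] by (simp add: emb_diff)

lemma emb_inverse: "\<iota> (inverse a) = inverse (\<iota> a)"
  by (cases "a = 0") (auto intro!: inverse_unique[symmetric] simp: emb_mult[symmetric])

lemma emb_left_commute: "x * (\<iota> a * y) = \<iota> a * (x * y)"
  by (metis emb_commute mult.assoc)

sublocale F: vspace "(*) :: 'f \<Rightarrow> 'f \<Rightarrow> 'f"
  by (rule vspace_field)

sublocale D: vspace "scaleD \<iota>"
  by unfold_locales (auto simp: scaleD_def emb_add emb_mult algebra_simps)

sublocale DF: vspace_pair "scaleD \<iota>" "(*) :: 'f \<Rightarrow> 'f \<Rightarrow> 'f"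
  by unfold_locales

lemma D_fin_dim: "D.fin_dim S"
proof -
  obtain Basis where "finite_dimensional_vector_space (scaleD \<iota>) Basis"
    using finite_over unfolding finite_over_def by blast
  then interpret fd: finite_dimensional_vector_space "scaleD \<iota>" Basis .
  show ?thesis unfolding D.fin_dim_def
    by (intro exI[of _ Basis]) (simp add: fd.finite_Basis fd.span_Basis)
qed

lemma degree_eq: "D.dim UNIV = degree_over \<iota>"
  unfolding degree_over_def ..

lemma degree_pos: "degree_over \<iota> > 0"
proof -
  have "D.dim {0} < D.dim (UNIV :: 'd set)"
    by (rule D.dim_less_if_proper[of _ _ 1]) (auto simp: D_fin_dim)
  then show ?thesis by (simp add: degree_eq)
qed

end

locale vec_ext = central_ext \<iota> + right_vector_space act
  for \<iota> :: "'f::field \<Rightarrow> 'd::division_ring"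
    and act :: "'v::ab_group_add \<Rightarrow> 'd \<Rightarrow> 'v" +
  assumes finite_right_basis: "\<exists>X. right_basis act X"
begin

sublocale V: vspace "scaleV \<iota> act"
  by unfold_locales
    (auto simp: scaleV_def emb_add emb_mult[symmetric] mult.commute act_add_left act_add_right
      act_act act_one)

sublocale E: vspace "scaleE \<iota> act"
  using V.pointwise unfolding scaleE_def[abs_def] .

sublocale EV: vspace_pair "scaleE \<iota> act" "scaleV \<iota> act" by unfold_locales
sublocale VV: vspace_pair "scaleV \<iota> act" "scaleV \<iota> act" by unfold_locales
sublocale DV: vspace_pair "scaleD \<iota>" "scaleV \<iota> act" by unfold_locales
sublocale VD: vspace_pair "scaleV \<iota> act" "scaleD \<iota>" by unfold_locales
sublocale VF: vspace_pair "scaleV \<iota> act" "(*) :: 'f \<Rightarrow> 'f \<Rightarrow> 'f" by unfold_locales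

lemma act_zero_left [simp]: "act 0 \<alpha> = 0"
  using act_add_left[of 0 0] by simp

lemma act_zero_right [simp]: "act x 0 = 0"
  using act_add_right[of x 0 0] by simp

lemma act_minus_left: "act (- x) \<alpha> = - act x \<alpha>"
  using act_add_left[of x "- x" \<alpha>] by (simp add: eq_neg_iff_add_eq_0 add.commute)

lemma act_minus_right: "act x (- \<alpha>) = - act x \<alpha>"
  using act_add_right[of x \<alpha> "- \<alpha>"] by (simp add: eq_neg_iff_add_eq_0 add.commute)

lemma act_diff_left: "act (x - y) \<alpha> = act x \<alpha> - act y \<alpha>"
  using act_add_left[of x "- y" \<alpha>] by (simp add: act_minus_left)

lemma act_diff_right: "act x (\<alpha> - \<beta>) = act x \<alpha> - act x \<beta>"
  using act_add_right[of x \<alpha> "- \<beta>"] by (simp add: act_minus_right)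

lemma act_eq_0_iff [simp]: "act x \<alpha> = 0 \<longleftrightarrow> x = 0 \<or> \<alpha> = 0"
  by (metis act_act act_one act_zero_left act_zero_right right_inverse)

lemma right_subspace_subspace: "right_subspace act W \<Longrightarrow> V.subspace W"
  unfolding right_subspace_def V.subspace_def scaleV_def by blast

lemma EndD:
  assumes "u \<in> End\<^sub>D act"
  shows "u (x + y) = u x + u y" "u (act x \<alpha>) = act (u x) \<alpha>" "u 0 = 0" "u (x - y) = u x - u y"
    and "u (- x) = - u x"
proof -
  show 1: "u (x + y) = u x + u y" and 2: "u (act x \<alpha>) = act (u x) \<alpha>" for x y \<alpha>
    using assms unfolding End\<^sub>D_def by auto
  show 0: "u 0 = 0" using 1[of 0 0] by simp
  show 3: "u (- x) = - u x" for x using 1[of x "- x"] 0 by (simp add: eq_neg_iff_add_eq_0 add.commute)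
  show "u (x - y) = u x - u y" using 1[of x "- y"] 3 by simp
qed

lemma End_linear: "u \<in> End\<^sub>D act \<Longrightarrow> Vector_Spaces.linear (scaleV \<iota> act) (scaleV \<iota> act) u"
  by unfold_locales (auto simp: EndD scaleV_def)

lemma End_sum: "u \<in> End\<^sub>D act \<Longrightarrow> u (sum f A) = (\<Sum>a\<in>A. u (f a))"
  by (induction A rule: infinite_finite_induct) (auto simp: EndD)

lemma eval_linear: "Vector_Spaces.linear (scaleE \<iota> act) (scaleV \<iota> act) (\<lambda>u. u x)"
  by unfold_locales (auto simp: scaleE_def)

lemma End_subspace_UNIV: "E.subspace (End\<^sub>D act)"
  unfolding E.subspace_def End\<^sub>D_def
  by (auto simp: scaleE_def scaleV_def act_add_left act_act emb_commute)

text \<open>Products of a right basis with a basis of \<open>D\<close> over \<open>F\<close> span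
  \<open>V\<close>; this gives the bound that is compared with the size of \<open>F\<close>.\<close>

lemma V_fin_dim: "V.fin_dim S"
  and V_dim_le: "right_basis act X \<Longrightarrow> V.dim UNIV \<le> card X * degree_over \<iota>"
proof -
  obtain BD where BD: "finite BD" "D.span BD = UNIV" "card BD = degree_over \<iota>"
    using D.fin_dim_basis[OF D_fin_dim D.subspace_UNIV] degree_eq by metis
  have *: "finite X \<and> v \<in> V.span ((\<lambda>(x, \<beta>). act x \<beta>) ` (X \<times> BD))" if X: "right_basis act X" for X v
  proof -
    have l: "Vector_Spaces.linear (scaleD \<iota>) (scaleV \<iota> act) (\<lambda>\<alpha>. act x \<alpha>)" for x
      by unfold_locales (auto simp: scaleD_def scaleV_def act_add_right act_act emb_commute)
    obtain c where c: "v = (\<Sum>x\<in>X. act x (c x))"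
      using X unfolding right_basis_def by blast
    have "act x \<alpha> \<in> V.span ((\<lambda>(x, \<beta>). act x \<beta>) ` (X \<times> BD))" if "x \<in> X" for x \<alpha>
    proof -
      interpret l: Vector_Spaces.linear "scaleD \<iota>" "scaleV \<iota> act" "\<lambda>\<alpha>. act x \<alpha>" by (rule l)
      have "act x \<alpha> \<in> V.span (act x ` BD)"
        unfolding l.span_image BD(2) by simp
      moreover have "act x ` BD \<subseteq> (\<lambda>(x, \<beta>). act x \<beta>) ` (X \<times> BD)" using that by force
      ultimately show ?thesis using V.span_mono by blast
    qed
    then show ?thesis using X c by (simp add: V.span_sum right_basis_def)
  qed
  show "V.fin_dim S"
  proof -
    obtain X where "right_basis act X" using finite_right_basis by blast
    then show ?thesis unfolding V.fin_dim_def using *[of X] BD(1)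
      by (intro exI[of _ "(\<lambda>(x, \<beta>). act x \<beta>) ` (X \<times> BD)"]) auto
  qed
  show "V.dim UNIV \<le> card X * degree_over \<iota>" if "right_basis act X"
  proof -
    have "V.dim UNIV \<le> card ((\<lambda>(x, \<beta>). act x \<beta>) ` (X \<times> BD))"
      using *[OF that] BD(1) by (intro V.dim_le_card) auto
    also have "\<dots> \<le> card (X \<times> BD)"
      using *[OF that] BD(1) by (intro card_image_le) auto
    finally show ?thesis by (simp add: BD(3) card_cartesian_product)
  qed
qed

lemma E_fin_dim: "T \<subseteq> End\<^sub>D act \<Longrightarrow> E.fin_dim T"
proof -
  obtain X where X: "right_basis act X" using finite_right_basis by blast
  have "u = 0" if "u \<in> End\<^sub>D act" "\<forall>x\<in>X. u x = 0" for u
  proof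
    fix v
    obtain c where "v = (\<Sum>x\<in>X. act x (c x))"
      using X unfolding right_basis_def by blast
    then show "u v = 0 v" using that by (simp add: End_sum EndD)
  qed
  moreover have "finite X" using X by (simp add: right_basis_def)
  moreover have "(\<lambda>a u x. scaleV \<iota> act a (u x)) = scaleE \<iota> act"
    by (simp add: scaleE_def fun_eq_iff)
  ultimately have "E.fin_dim (End\<^sub>D act)"
    using V.fin_dim_functions[OF V_fin_dim, of X "End\<^sub>D act"] End_subspace_UNIV by simp
  then show "T \<subseteq> End\<^sub>D act \<Longrightarrow> E.fin_dim T" by (rule E.fin_dim_subset)
qed

section \<open>Lines and their complements among the \<open>D\<close>-subspaces\<close>

lemma dim_line:
  assumes "x \<noteq> 0"
  shows "V.dim (range (act x)) = degree_over \<iota>"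
proof -
  have "Vector_Spaces.linear (scaleD \<iota>) (scaleV \<iota> act) (act x)"
    by unfold_locales (auto simp: scaleD_def scaleV_def act_add_right act_act emb_commute)
  then show ?thesis
    using DV.dim_image_inj[of "act x" UNIV] assms D_fin_dim degree_eq by auto
qed

lemma right_subspace_line: "right_subspace act (range (act x))"
  unfolding right_subspace_def
  by (auto simp: image_iff act_act act_add_right[symmetric])

lemma right_subspace_sum_line:
  assumes H: "right_subspace act H"
  shows "right_subspace act {h + act y \<alpha> |h \<alpha>. h \<in> H}" (is "right_subspace act ?S")
  unfolding right_subspace_def
proof (intro conjI ballI allI)
  have "0 = 0 + act y 0" by simp
  then show "0 \<in> ?S" using H unfolding right_subspace_def by blast
next
  fix v w assume "v \<in> ?S" "w \<in> ?S"
  then obtain h \<alpha> h' \<beta> where h: "v = h + act y \<alpha>" "h \<in> H" "w = h' + act y \<beta>" "h' \<in> H" by blast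
  then have "v + w = (h + h') + act y (\<alpha> + \<beta>)" by (simp add: act_add_right)
  moreover have "h + h' \<in> H" using H h unfolding right_subspace_def by blast
  ultimately show "v + w \<in> ?S" by blast
next
  fix v \<beta> assume "v \<in> ?S"
  then obtain h \<alpha> where h: "v = h + act y \<alpha>" "h \<in> H" by blast
  then have "act v \<beta> = act h \<beta> + act y (\<alpha> * \<beta>)" by (simp add: act_add_left act_act)
  moreover have "act h \<beta> \<in> H" using H h unfolding right_subspace_def by blast
  ultimately show "act v \<beta> \<in> ?S" by blast
qed

lemma dim_sum_line:
  assumes H': "right_subspace act H'" and "x \<notin> H'"
    and H: "H = {h + act x \<alpha> |h \<alpha>. h \<in> H'}"
  shows "V.dim H = V.dim H' + degree_over \<iota>"
proof -
  obtain BV where BV: "finite BV" "\<not> V.dependent BV" "V.span BV = UNIV"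
    using V.fin_dim_basis[OF V_fin_dim V.subspace_UNIV] by metis
  interpret fd: finite_dimensional_vector_space "scaleV \<iota> act" BV
    by unfold_locales (use BV in auto)
  have x: "x \<noteq> 0" using assms unfolding right_subspace_def by blast
  have "\<alpha> = 0" if "act x \<alpha> \<in> H'" for \<alpha>
  proof (rule ccontr)
    assume "\<alpha> \<noteq> 0"
    have "act (act x \<alpha>) (inverse \<alpha>) \<in> H'" using that H' unfolding right_subspace_def by blast
    then show False using \<open>\<alpha> \<noteq> 0\<close> assms(2) by (simp add: act_act act_one)
  qed
  then have i: "H' \<inter> range (act x) = {0}"
    using H' by (auto simp: right_subspace_def intro: rev_image_eqI[of 0])
  have "H = {h + y |h y. h \<in> H' \<and> y \<in> range (act x)}"
    unfolding H by auto
  moreover have "V.dim {0} = 0" by simp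
  ultimately show ?thesis
    using fd.dim_sums_Int[of H' "range (act x)"] H' dim_line[OF x] right_subspace_line[of x]
    by (simp add: right_subspace_subspace i)
qed

text \<open>Among the \<open>D\<close>-subspaces between \<open>W\<close> and \<open>H\<close> that
  miss \<open>x\<close>, one of greatest dimension over \<open>F\<close> is a complement of the line
  of \<open>x\<close>: adjoining any further \<open>y\<close> of \<open>H\<close> captures
  \<open>x\<close>, and the resulting relation can be solved for \<open>y\<close>.\<close>

lemma right_complement:
  assumes W: "right_subspace act W" "W \<subseteq> H" and H: "right_subspace act H" and x: "x \<in> H" "x \<notin> W"
  obtains H' where "right_subspace act H'" "W \<subseteq> H'" "H' \<subseteq> H" "x \<notin> H'"
    "H = {h + act x \<alpha> |h \<alpha>. h \<in> H'}"
proof -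
  let ?P = "\<lambda>H'. right_subspace act H' \<and> W \<subseteq> H' \<and> H' \<subseteq> H \<and> x \<notin> H'"
  have "\<forall>S. ?P S \<longrightarrow> V.dim S < V.dim UNIV + 1"
    unfolding less_Suc_eq_le Suc_eq_plus1[symmetric]
    by (intro allI impI V.dim_mono_fin_dim) (auto simp: V_fin_dim right_subspace_subspace)
  moreover have "?P W" using assms by blast
  ultimately have "\<exists>H'. ?P H' \<and> (\<forall>S. ?P S \<longrightarrow> V.dim S \<le> V.dim H')"
    by (intro ex_has_greatest_nat)
  then obtain H' where P: "?P H'" and max: "\<And>S. ?P S \<Longrightarrow> V.dim S \<le> V.dim H'"
    by blast
  have key: "x \<in> S" if "right_subspace act S" "H' \<subseteq> S" "S \<subseteq> H" "V.dim H' < V.dim S" for S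
    using max[of S] P that by fastforce
  have "\<exists>h\<in>H'. \<exists>\<alpha>. y = h + act x \<alpha>" if y: "y \<in> H" for y
  proof (cases "y \<in> H'")
    case True
    then show ?thesis by (metis act_zero_right add.right_neutral)
  next
    case False
    let ?S = "{h + act y \<alpha> |h \<alpha>. h \<in> H'}"
    have "right_subspace act ?S"
      using P right_subspace_sum_line by blast
    moreover have "H' \<subseteq> ?S" by clarify (metis act_zero_right add.right_neutral)
    moreover have "?S \<subseteq> H" using P y H unfolding right_subspace_def by blast
    moreover have "V.dim ?S > V.dim H'"
      using dim_sum_line[of H' y ?S] P False degree_pos by auto
    ultimately have "x \<in> ?S" by (rule key)
    then obtain h \<alpha> where h: "h \<in> H'" "x = h + act y \<alpha>" by blast
    then have "\<alpha> \<noteq> 0" using P by auto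
    have "y = act (x - h) (inverse \<alpha>)" using h \<open>\<alpha> \<noteq> 0\<close> by (simp add: act_act act_one)
    also have "\<dots> = - act h (inverse \<alpha>) + act x (inverse \<alpha>)" by (simp add: act_diff_left)
    finally show ?thesis using P h(1) V.subspace_neg[of H'] right_subspace_subspace
      unfolding right_subspace_def by blast
  qed
  then have "H = {h + act x \<alpha> |h \<alpha>. h \<in> H'}"
    using P x(1) H unfolding right_subspace_def by blast
  then show thesis using that P by blast
qed

end


section \<open>The dimension bound\<close>

text \<open>At \<open>m = n * d\<close> the value is the sum of the numbers \<open>k * d - 1\<close> over \<open>1 \<le> k \<le> n\<close>.\<close>

fun dim_bound :: "nat \<Rightarrow> nat \<Rightarrow> nat" where
  "dim_bound d m = (if m = 0 \<or> d = 0 then 0 else (m - 1) + dim_bound d (m - d))"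

declare dim_bound.simps [simp del]

context vec_ext
begin

text \<open>
  If \<open>u y \<notin> T x\<close>, let \<open>\<pi>\<close> be a projection onto \<open>T x\<close> that kills \<open>u y\<close>, and let \<open>g\<close> be a linear
  section of evaluation at \<open>x\<close>. As \<open>T (y - l x)\<close> has no larger dimension than \<open>T x\<close>, every scalar
  \<open>l\<close> is an eigenvalue of \<open>v \<mapsto> \<pi> (g v y)\<close> on \<open>T x\<close>, so the field has at most \<open>dim (T x)\<close> elements.
\<close>

lemma kernel_image_in_generic_orbit:
  assumes T: "E.subspace T" "T \<subseteq> End\<^sub>D act"
    and max: "\<And>z. V.dim ((\<lambda>u. u z) ` T) \<le> V.dim ((\<lambda>u. u x) ` T)"
    and big: "infinite (UNIV :: 'f set) \<or> V.dim ((\<lambda>u. u x) ` T) < card (UNIV :: 'f set)"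
    and u: "u \<in> T" "u x = 0"
  shows "u y \<in> (\<lambda>u. u x) ` T"
proof (rule ccontr)
  let ?S = "(\<lambda>u. u x) ` T"
  assume c: "u y \<notin> ?S"
  interpret ev: Vector_Spaces.linear "scaleE \<iota> act" "scaleV \<iota> act" "\<lambda>u. u z" for z
    by (rule eval_linear)
  have S: "V.subspace ?S" by (rule ev.subspace_image[OF T(1)])
  obtain g where g: "range g \<subseteq> T" "Vector_Spaces.linear (scaleV \<iota> act) (scaleE \<iota> act) g"
      "\<And>v. v \<in> ?S \<Longrightarrow> g v x = v"
    using EV.linear_exists_right_inverse_on[OF eval_linear[of x] T(1)] by auto
  interpret g: Vector_Spaces.linear "scaleV \<iota> act" "scaleE \<iota> act" g by fact
  have gE: "g v \<in> End\<^sub>D act" for v using g(1) T(2) by blast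
  have uE: "u \<in> End\<^sub>D act" using u T by blast
  obtain B where B: "finite B" "B \<subseteq> ?S" "\<not> V.dependent B" "V.span B = ?S" "card B = V.dim ?S"
    by (rule V.fin_dim_basis[OF V_fin_dim S])
  have "\<not> V.dependent (insert (u y) B)"
    using B c by (simp add: V.independent_insertI)
  then obtain p where p: "Vector_Spaces.linear (scaleV \<iota> act) (scaleV \<iota> act) p"
      "\<forall>b\<in>insert (u y) B. p b = (if b = u y then 0 else b)"
    using VV.linear_independent_extend[of "insert (u y) B" "\<lambda>b. if b = u y then 0 else b"] by blast
  interpret p: Vector_Spaces.linear "scaleV \<iota> act" "scaleV \<iota> act" p by fact
  have pu: "p (u y) = 0" using p(2) by simp
  have "p b = b" if "b \<in> B" for b using p(2) that c B(2) by auto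
  then have pS: "p v = v" if "v \<in> ?S" for v
    using VV.linear_eq_on[OF p(1) V.linear_ident, of v B] that B(4) by blast
  define h where "h v = p (g v y)" for v
  have h: "Vector_Spaces.linear (scaleV \<iota> act) (scaleV \<iota> act) h"
    unfolding h_def by unfold_locales (auto simp: g.add g.scale p.add p.scale scaleE_def)
  have ug: "u \<notin> g ` ?S"
  proof
    assume "u \<in> g ` ?S"
    then obtain v where v: "v \<in> ?S" "u = g v" by blast
    then have "v = 0" using g(3) u(2) by auto
    then have "u y = 0" using v(2) by (simp add: g.zero)
    then show False using c V.subspace_0[OF S] by simp
  qed
  have eig: "\<exists>v\<in>?S. v \<noteq> 0 \<and> h v = scaleV \<iota> act l v" for l
  proof -
    \<comment> \<open>No orbit has dimension above that of \<open>?S\<close>, but \<open>u\<close>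
      and the lifts of \<open>?S\<close> span a space \<open>?C\<close> of one dimension more. So
      some nonzero \<open>w = g v + k u\<close> in \<open>?C\<close> kills \<open>?z\<close>;
      applying \<open>p\<close> to this equation removes \<open>u y\<close> and leaves
      \<open>h v = l v\<close>.\<close>
    let ?z = "y - scaleV \<iota> act l x"
    have inj: "inj_on g ?S" by (rule inj_onI) (metis g(3))
    have gB: "\<not> E.dependent (g ` B)"
      using g.independent_injective_image[OF B(3)] inj B(4) by simp
    have spgB: "E.span (g ` B) = g ` ?S" by (simp add: g.span_image B(4))
    have ind: "\<not> E.dependent (insert u (g ` B))"
      using gB ug spgB by (simp add: E.independent_insertI)
    let ?C = "E.span (insert u (g ` B))"
    have "insert u (g ` B) \<subseteq> T" using u g(1) by blast
    then have CT: "?C \<subseteq> T" using T(1) by (rule E.span_minimal)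
    have "u \<notin> g ` B" using ug B(2) by blast
    moreover have "card (g ` B) = card B" using inj B(2) by (meson card_image inj_on_subset)
    ultimately have dimC: "E.dim ?C = Suc (V.dim ?S)"
      using E.dim_span_eq_card_independent[OF ind] B(1,5) by simp
    have "V.dim ((\<lambda>w. w ?z) ` ?C) \<le> V.dim ((\<lambda>w. w ?z) ` T)"
      using CT T by (intro V.dim_mono_fin_dim V_fin_dim ev.subspace_image) auto
    also have "\<dots> \<le> V.dim ?S" by (rule max)
    finally have "V.dim ((\<lambda>w. w ?z) ` ?C) \<noteq> E.dim ?C" using dimC by simp
    moreover have "E.fin_dim ?C" using CT T(2) by (intro E_fin_dim) blast
    ultimately obtain w where w: "w \<in> ?C" "w ?z = 0" "w \<noteq> 0"
      using EV.dim_image_inj[OF eval_linear[of ?z] E.subspace_span] by blast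
    obtain k where "w - scaleE \<iota> act k u \<in> E.span (g ` B)"
      using w(1) E.span_breakdown_eq by blast
    then obtain v where v: "v \<in> ?S" "w - scaleE \<iota> act k u = g v"
      unfolding spgB by blast
    then have wv: "w = g v + scaleE \<iota> act k u" by (metis diff_add_cancel)
    have z: "f ?z = f y - scaleV \<iota> act l (f x)" if "f \<in> End\<^sub>D act" for f
      using that by (simp add: EndD scaleV_def)
    have *: "g v y - scaleV \<iota> act l v + scaleV \<iota> act k (u y) = 0"
      using w(2) z[OF gE] z[OF uE] u(2) g(3)[OF v(1)] unfolding wv by (simp add: scaleE_def)
    have "v \<noteq> 0"
    proof
      assume "v = 0"
      then have "scaleV \<iota> act k (u y) = 0" using * by (simp add: g.zero)
      moreover have "u y \<noteq> 0" using c V.subspace_0[OF S] by metis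
      ultimately have "k = 0" by simp
      then show False using w(3) wv \<open>v = 0\<close> by (simp add: g.zero)
    qed
    moreover have "p (g v y - scaleV \<iota> act l v + scaleV \<iota> act k (u y)) = 0"
      unfolding * by (rule p.zero)
    then have "h v = scaleV \<iota> act l v"
      using pS[OF v(1)] pu by (simp add: p.add p.diff p.scale h_def)
    ultimately show ?thesis using v(1) by blast
  qed
  then obtain v where v: "\<And>l. v l \<in> ?S \<and> v l \<noteq> 0 \<and> h (v l) = scaleV \<iota> act l (v l)" by metis
  have "card L \<le> V.dim ?S" if "finite L" for L :: "'f set"
  proof -
    have "inj_on v L \<and> \<not> V.dependent (v ` L)"
      by (rule V.eigenvectors_independent[OF h that]) (use v in blast)
    moreover have "v ` L \<subseteq> ?S" using v by blast
    ultimately show ?thesis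
      using V.independent_card_le_fin_dim[OF V_fin_dim S, of "v ` L"] by (simp add: card_image)
  qed
  then show False
  proof (cases "finite (UNIV :: 'f set)")
    case False
    then obtain L :: "'f set" where "finite L" "card L = Suc (V.dim ?S)"
      using infinite_arbitrarily_large by blast
    then show False using \<open>\<And>L :: 'f set. finite L \<Longrightarrow> card L \<le> V.dim ?S\<close>[of L] by simp
  next
    case True
    then show False using \<open>\<And>L :: 'f set. finite L \<Longrightarrow> card L \<le> V.dim ?S\<close>[OF True] big by simp
  qed
qed

lemma right_subspace_V_dim_less:
  "right_subspace act H \<Longrightarrow> V.subspace S \<Longrightarrow> S \<subseteq> H \<Longrightarrow> x \<in> H \<Longrightarrow> x \<notin> S \<Longrightarrow> V.dim S < V.dim H"
  by (rule V.dim_less_if_proper) (auto simp: V_fin_dim right_subspace_subspace)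

text \<open>\<open>K\<close> and \<open>H\<close> keep the induction on the fixed type
  \<open>'v\<close>: with \<open>V = K + H\<close>, maps that kill \<open>K\<close> and take values
  in \<open>H\<close> are determined by their restriction to \<open>H\<close>. Each round moves the
  line of \<open>x\<close> from \<open>H\<close> to \<open>K\<close>.\<close>

lemma dim_le_dim_bound_aux:
  assumes "E.subspace T" "T \<subseteq> End\<^sub>D act"
    and "\<And>u y. u \<in> T \<Longrightarrow> u y = y \<Longrightarrow> y = 0"
    and "infinite (UNIV :: 'f set) \<or> V.dim UNIV \<le> card (UNIV :: 'f set)"
    and "right_subspace act K" "right_subspace act H"
    and "\<And>v. \<exists>k\<in>K. \<exists>h\<in>H. v = k + h"
    and "\<And>u k. u \<in> T \<Longrightarrow> k \<in> K \<Longrightarrow> u k = 0"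
    and "\<And>u v. u \<in> T \<Longrightarrow> u v \<in> H"
  shows "E.dim T \<le> dim_bound (degree_over \<iota>) (V.dim H)"
  using assms
proof (induction "V.dim H" arbitrary: T K H rule: less_induct)
  case less
  note T = less.prems(1,2) and triv = less.prems(3) and card = less.prems(4)
    and K = less.prems(5) and H = less.prems(6) and KH = less.prems(7)
    and TK = less.prems(8) and TH = less.prems(9)
  interpret ev: Vector_Spaces.linear "scaleE \<iota> act" "scaleV \<iota> act" "\<lambda>u. u z" for z
    by (rule eval_linear)
  show ?case
  proof (cases "H = {0}")
    case True
    have "T \<subseteq> E.span {}"
    proof
      fix u assume "u \<in> T"
      then have "u v = 0" for v using TH[of u v] True by blast
      then show "u \<in> E.span {}" by (simp add: fun_eq_iff)
    qed
    then have "E.dim T = 0" using E.dim_le_card[of T "{}"] by simp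
    then show ?thesis by simp
  next
    case False
    moreover have H0: "0 \<in> H" using H unfolding right_subspace_def by blast
    ultimately obtain x0 where x0: "x0 \<in> H" "x0 \<noteq> 0" by blast
    let ?r = "\<lambda>y. V.dim ((\<lambda>u. u y) ` T)"
    have "\<forall>y. y \<in> H \<and> y \<noteq> 0 \<longrightarrow> ?r y < V.dim UNIV + 1"
      unfolding less_Suc_eq_le Suc_eq_plus1[symmetric]
      by (intro allI impI V.dim_mono_fin_dim ev.subspace_image[OF T(1)]) (auto simp: V_fin_dim)
    moreover have "x0 \<in> H \<and> x0 \<noteq> 0" using x0 by blast
    ultimately have "\<exists>x. (x \<in> H \<and> x \<noteq> 0) \<and> (\<forall>y. y \<in> H \<and> y \<noteq> 0 \<longrightarrow> ?r y \<le> ?r x)"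
      by (intro ex_has_greatest_nat)
    then obtain x where x: "x \<in> H" "x \<noteq> 0" and xmax: "\<And>y. y \<in> H \<Longrightarrow> y \<noteq> 0 \<Longrightarrow> ?r y \<le> ?r x"
      by blast
    let ?S = "(\<lambda>u. u x) ` T"
    have S: "V.subspace ?S" by (rule ev.subspace_image[OF T(1)])
    have SH: "?S \<subseteq> H" using TH by blast
    \<comment> \<open>This one missing vector is the -1 of the bound.\<close>
    have xS: "x \<notin> ?S" using triv x(2) by force
    \<comment> \<open>\<open>x\<close> was chosen among the vectors of \<open>H\<close>; since
      \<open>T\<close> kills \<open>K\<close>, the orbit of \<open>k + h\<close> is that of
      \<open>h\<close>.\<close>
    have max: "?r z \<le> ?r x" for z
    proof -
      obtain k h where kh: "k \<in> K" "h \<in> H" "z = k + h" using KH by blast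
      have eq: "(\<lambda>u. u z) ` T = (\<lambda>u. u h) ` T"
        using TK kh T(2) by (intro image_cong) (auto simp: EndD subset_iff)
      show ?thesis
      proof (cases "h = 0")
        case True
        have "(\<lambda>u. u h) ` T \<subseteq> V.span {}" using T(2) True by (auto simp: EndD subset_iff)
        then have "V.dim ((\<lambda>u. u h) ` T) = 0" using V.dim_le_card[of _ "{}"] by fastforce
        then show ?thesis by (simp add: eq)
      qed (use xmax kh eq in auto)
    qed
    have rH: "V.dim ?S < V.dim H"
      by (rule right_subspace_V_dim_less[OF H S SH x(1) xS])
    also have HV: "V.dim H \<le> V.dim UNIV"
      using H by (intro V.dim_mono_fin_dim V_fin_dim) (auto simp: right_subspace_subspace)
    finally have big: "infinite (UNIV :: 'f set) \<or> V.dim ?S < card (UNIV :: 'f set)"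
      using card by auto
    let ?T = "{u\<in>T. u x = 0}"
    \<comment> \<open>The largest \<open>D\<close>-subspace in the orbit. If \<open>u\<close> kills
      \<open>x\<close>, every \<open>act (u v) \<alpha> = u (act v \<alpha>)\<close> lies in
      \<open>?S\<close>; hence \<open>u v\<close> lies in \<open>?W\<close>, and so in a complement
      of the line of \<open>x\<close>.\<close>
    let ?W = "{v. \<forall>\<alpha>. act v \<alpha> \<in> ?S}"
    have W: "right_subspace act ?W"
      unfolding right_subspace_def
    proof (intro conjI ballI allI)
      show "0 \<in> ?W" using V.subspace_0[OF S] by (simp del: image_iff)
      show "v + w \<in> ?W" if "v \<in> ?W" "w \<in> ?W" for v w
        using that V.subspace_add[OF S] unfolding mem_Collect_eq act_add_left by blast
      show "act v \<beta> \<in> ?W" if "v \<in> ?W" for v \<beta>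
        using that unfolding mem_Collect_eq act_act by blast
    qed
    have WS: "?W \<subseteq> ?S"
    proof
      fix v assume "v \<in> ?W"
      then have "act v 1 \<in> ?S" by blast
      then show "v \<in> ?S" by (simp only: act_one)
    qed
    have xW: "x \<notin> ?W" using WS xS by blast
    obtain H' where H': "right_subspace act H'" "?W \<subseteq> H'" "H' \<subseteq> H" "x \<notin> H'"
        "H = {h + act x \<alpha> |h \<alpha>. h \<in> H'}"
      by (rule right_complement[OF W subset_trans[OF WS SH] H x(1) xW])
    let ?K = "{k + act x \<alpha> |k \<alpha>. k \<in> K}"
    have dimH: "V.dim H = V.dim H' + degree_over \<iota>"
      by (rule dim_sum_line[OF H'(1,4,5)])
    have "E.dim ?T \<le> dim_bound (degree_over \<iota>) (V.dim H')"
    proof (rule less.hyps)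
      show "V.dim H' < V.dim H" using dimH degree_pos by simp
      show "E.subspace ?T" using T(1) by (auto simp: E.subspace_def scaleE_def)
      show "?T \<subseteq> End\<^sub>D act" using T(2) by blast
      show "right_subspace act ?K" using K by (rule right_subspace_sum_line)
      show "\<exists>k\<in>?K. \<exists>h\<in>H'. v = k + h" for v
      proof -
        obtain k h where kh: "k \<in> K" "h \<in> H" "v = k + h" using KH by blast
        then obtain h' \<alpha> where h': "h' \<in> H'" "h = h' + act x \<alpha>" using H'(5) by blast
        then have "v = (k + act x \<alpha>) + h'" using kh(3) by (simp add: ac_simps)
        then show ?thesis using kh(1) h'(1) by blast
      qed
      show "u k = 0" if "u \<in> ?T" "k \<in> ?K" for u k
        using that TK T(2) by (auto simp: EndD subset_iff)
      show "u v \<in> H'" if "u \<in> ?T" for u v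
      proof -
        have "u (act v \<alpha>) \<in> ?S" for \<alpha>
          by (rule kernel_image_in_generic_orbit[OF T max big]) (use that in auto)
        then have "u v \<in> ?W" using that T(2) by (auto simp: EndD subset_iff)
        then show ?thesis using H'(2) by blast
      qed
    qed (use triv card H' in auto)
    moreover have "E.dim T = V.dim ?S + E.dim ?T"
      by (rule EV.dim_image_plus_kernel[OF eval_linear T(1) E_fin_dim[OF T(2)]])
    moreover have "dim_bound (degree_over \<iota>) (V.dim H)
        = (V.dim H - 1) + dim_bound (degree_over \<iota>) (V.dim H')"
      using degree_pos dimH by (subst dim_bound.simps) simp
    ultimately show ?thesis using rH by linarith
  qed
qed

lemma dim_le_dim_bound:
  assumes "E.subspace T" "T \<subseteq> End\<^sub>D act"
    and "\<And>u y. u \<in> T \<Longrightarrow> u y = y \<Longrightarrow> y = 0"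
    and "infinite (UNIV :: 'f set) \<or> V.dim UNIV \<le> card (UNIV :: 'f set)"
  shows "E.dim T \<le> dim_bound (degree_over \<iota>) (V.dim UNIV)"
  using assms
  by (intro dim_le_dim_bound_aux[where K = "{0}"]) (auto simp: right_subspace_def EndD subset_iff)

text \<open>An injective endomorphism is surjective by dimension over \<open>F\<close>, so
  invertibility reduces to the absence of nonzero fixed vectors, the form in which trivial spectrum
  enters the bound.\<close>

lemma invertible_id_minus_iff:
  assumes u: "u \<in> End\<^sub>D act"
  shows "invertible_in_End act (\<lambda>x. x - u x) \<longleftrightarrow> (\<forall>x. u x = x \<longrightarrow> x = 0)"
proof
  assume "invertible_in_End act (\<lambda>x. x - u x)"
  then obtain v where v: "v \<in> End\<^sub>D act" "v \<circ> (\<lambda>x. x - u x) = id"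
    unfolding invertible_in_End_def by blast
  have "x = 0" if "u x = x" for x
    using fun_cong[OF v(2), of x] that EndD(3)[OF v(1)] by simp
  then show "\<forall>x. u x = x \<longrightarrow> x = 0" by blast
next
  let ?w = "\<lambda>x. x - u x"
  assume *: "\<forall>x. u x = x \<longrightarrow> x = 0"
  have w: "?w \<in> End\<^sub>D act"
    using u by (auto simp: End\<^sub>D_def act_diff_left)
  have inj: "x = y" if "?w x = ?w y" for x y
  proof -
    have "u (x - y) = x - y" using that by (simp add: EndD(4)[OF u] algebra_simps)
    then show ?thesis using * by auto
  qed
  have "V.dim (?w ` UNIV) = V.dim UNIV"
    using VV.dim_image_inj[OF End_linear[OF w] V.subspace_UNIV V_fin_dim] * by force
  moreover have "V.subspace (?w ` UNIV)"
    using module_hom.subspace_image[of "scaleV \<iota> act" "scaleV \<iota> act" ?w UNIV] End_linear[OF w]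
    by (simp add: linear_iff_module_hom)
  ultimately have surj: "?w ` UNIV = UNIV"
    using V.subspace_eq_if_dim_le[OF V_fin_dim V.subspace_UNIV] by simp
  define v where "v = inv ?w"
  have wv: "?w (v y) = y" for y
    unfolding v_def by (rule surj_f_inv_f[OF surj])
  have "v \<in> End\<^sub>D act"
    unfolding End\<^sub>D_def
  proof (intro CollectI conjI allI)
    show "v (x + y) = v x + v y" for x y
      by (rule inj) (simp only: wv EndD(1)[OF w])
    show "v (act x \<alpha>) = act (v x) \<alpha>" for x \<alpha>
      by (rule inj) (simp only: wv EndD(2)[OF w])
  qed
  moreover have "?w \<circ> v = id" using wv by (simp add: fun_eq_iff)
  moreover have "v (?w x) = x" for x by (rule inj) (rule wv)
  then have "v \<circ> ?w = id" by (simp add: fun_eq_iff)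
  ultimately show "invertible_in_End act ?w"
    unfolding invertible_in_End_def by blast
qed

lemma trivial_spectrum_subspace_iff:
  "trivial_spectrum_subspace \<iota> act T \<longleftrightarrow>
    E.subspace T \<and> T \<subseteq> End\<^sub>D act \<and> (\<forall>u\<in>T. \<forall>x. u x = x \<longrightarrow> x = 0)"
  unfolding trivial_spectrum_subspace_def End_subspace_def
  using invertible_id_minus_iff by blast

end


section \<open>Nonisotropic forms and transitivity\<close>

context central_ext
begin

lemma linear_formD:
  assumes "Vector_Spaces.linear (scaleD \<iota>) (*) f"
  shows "f (x + y) = f x + f y" "f (\<iota> a * x) = a * f x" "f (x * \<iota> a) = a * f x"
    "f 0 = 0" "f (x - y) = f x - f y" "f (- x) = - f x"
proof -
  interpret f: Vector_Spaces.linear "scaleD \<iota>" "(*)" f by fact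
  show *: "f (\<iota> a * x) = a * f x"
    using f.scale[of a x] by (simp add: scaleD_def)
  then show "f (x * \<iota> a) = a * f x" by (metis emb_commute)
  show "f (x + y) = f x + f y" "f 0 = 0" "f (x - y) = f x - f y" "f (- x) = - f x"
    by (simp_all add: f.add f.zero f.diff f.neg)
qed

lemma linear_formI:
  assumes "\<And>x y. f (x + y) = f x + f y" "\<And>a x. f (\<iota> a * x) = a * f x"
  shows "Vector_Spaces.linear (scaleD \<iota>) (*) f"
  by unfold_locales (simp_all add: assms scaleD_def)

lemma form_left_mult_linear:
  assumes "Vector_Spaces.linear (scaleD \<iota>) (*) f"
  shows "Vector_Spaces.linear (scaleD \<iota>) (*) (\<lambda>l. f (c * l))"
  by (rule linear_formI) (simp_all add: linear_formD[OF assms] distrib_left emb_left_commute)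

text \<open>A nonzero \<open>c - c'\<close> is invertible, so
  \<open>l = inverse (c - c') * z\<close> would give the value \<open>f z\<close>.\<close>

lemma form_nondegenerate:
  assumes "f z \<noteq> 0" "\<And>l. f (c * l) = f (c' * l)" and f: "Vector_Spaces.linear (scaleD \<iota>) (*) f"
  shows "c = c'"
proof (rule ccontr)
  assume "c \<noteq> c'"
  have "f ((c - c') * (inverse (c - c') * z)) = 0"
    using assms(2) by (simp add: left_diff_distrib linear_formD[OF f])
  then show False using assms(1) \<open>c \<noteq> c'\<close> by (simp add: mult.assoc[symmetric])
qed

text \<open>By nondegeneracy \<open>c\<close> is determined by the form
  \<open>l \<mapsto> f (c * l)\<close>; the dual space of \<open>D\<close> has dimension at most
  that of \<open>D\<close>, so these forms exhaust it.\<close>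

lemma form_representation:
  assumes f: "Vector_Spaces.linear (scaleD \<iota>) (*) f" "f z \<noteq> 0"
    and g: "Vector_Spaces.linear (scaleD \<iota>) (*) g"
  shows "\<exists>c. \<forall>l. g l = f (c * l)"
proof -
  let ?s = "\<lambda>a (u :: 'd \<Rightarrow> 'f) x. a * u x"
  let ?X = "{h. Vector_Spaces.linear (scaleD \<iota>) (*) h}"
  let ?f = "\<lambda>c l. f (c * l)"
  interpret X: vspace ?s by (rule F.pointwise)
  interpret DX: vspace_pair "scaleD \<iota>" ?s by unfold_locales
  obtain BD where BD: "finite BD" "D.span BD = UNIV" "card BD = D.dim (UNIV :: 'd set)"
    using D.fin_dim_basis[OF D_fin_dim D.subspace_UNIV] by metis
  have X: "X.subspace ?X"
    by (auto simp: X.subspace_def linear_formD distrib_left mult.left_commute intro!: linear_formI)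
  have "h = 0" if "h \<in> ?X" "\<forall>x\<in>BD. h x = 0" for h
  proof
    fix x
    show "h x = 0 x"
      using DF.linear_eq_on[of h "\<lambda>_. 0" x BD] that BD(2) DF.linear_zero by auto
  qed
  then have "X.fin_dim ?X \<and> X.dim ?X \<le> card BD * F.dim UNIV"
    by (intro F.fin_dim_functions[OF fin_dim_field BD(1) X]) auto
  then have dimX: "X.fin_dim ?X" "X.dim ?X \<le> D.dim (UNIV :: 'd set)"
    using BD(3) by (simp_all add: dim_field)
  have lin: "Vector_Spaces.linear (scaleD \<iota>) ?s ?f"
    by unfold_locales (auto simp: fun_eq_iff scaleD_def linear_formD[OF f(1)] distrib_right mult.assoc)
  interpret ff: Vector_Spaces.linear "scaleD \<iota>" ?s ?f by (rule lin)
  have inj: "c = 0" if "?f c = 0" for c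
    using form_nondegenerate[OF f(2) _ f(1), of c 0] that by (simp add: fun_eq_iff linear_formD[OF f(1)])
  have "X.dim (?f ` UNIV) = D.dim (UNIV :: 'd set)"
    by (rule DX.dim_image_inj[OF lin D.subspace_UNIV D_fin_dim inj])
  moreover have "?f ` UNIV \<subseteq> ?X" using form_left_mult_linear[OF f(1)] by blast
  ultimately have "?f ` UNIV = ?X"
    using X.subspace_eq_if_dim_le[OF dimX(1) X ff.subspace_image[OF D.subspace_UNIV]] dimX(2) by simp
  then have "g \<in> ?f ` UNIV" using g by blast
  then show ?thesis by auto
qed

end

section \<open>Decomposition of \<open>V\<close> along a vector, and transitivity\<close>

locale form_ext = vec_ext \<iota> act
  for \<iota> :: "'f::field \<Rightarrow> 'd::division_ring"
    and act :: "'v::ab_group_add \<Rightarrow> 'd \<Rightarrow> 'v" +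
  fixes b :: "'v \<Rightarrow> 'v \<Rightarrow> 'f"
  assumes bilinear: "bilinear_form \<iota> act b" and nonisotropic: "nonisotropic b"
begin

lemma b_linear_right: "Vector_Spaces.linear (scaleV \<iota> act) (*) (\<lambda>y. b x y)"
  and b_linear_left: "Vector_Spaces.linear (scaleV \<iota> act) (*) (\<lambda>x. b x y)"
  using bilinear unfolding bilinear_form_def by blast+

lemma b_right [simp]: "b x (y + z) = b x y + b x z" "b x (act y (\<iota> a)) = a * b x y"
    "b x 0 = 0" "b x (y - z) = b x y - b x z" "b x (- y) = - b x y"
proof -
  interpret Vector_Spaces.linear "scaleV \<iota> act" "(*)" "b x" by (rule b_linear_right)
  show "b x (y + z) = b x y + b x z" "b x (act y (\<iota> a)) = a * b x y"
    "b x 0 = 0" "b x (y - z) = b x y - b x z" "b x (- y) = - b x y"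
    using scale[of a y] by (simp_all add: add zero diff neg scaleV_def)
qed

lemma b_left [simp]: "b (x + y) z = b x z + b y z" "b (act x (\<iota> a)) z = a * b x z"
    "b 0 z = 0" "b (x - y) z = b x z - b y z" "b (- x) z = - b x z"
proof -
  interpret Vector_Spaces.linear "scaleV \<iota> act" "(*)" "\<lambda>x. b x z" by (rule b_linear_left)
  show "b (x + y) z = b x z + b y z" "b (act x (\<iota> a)) z = a * b x z"
    "b 0 z = 0" "b (x - y) z = b x z - b y z" "b (- x) z = - b x z"
    using scale[of a x] by (simp_all add: add zero diff neg scaleV_def)
qed

lemma b_self_eq_0_iff [simp]: "b x x = 0 \<longleftrightarrow> x = 0"
  using nonisotropic unfolding nonisotropic_def by auto

text \<open>The largest \<open>D\<close>-subspace in the kernel of \<open>b x\<close>, which itself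
  is only a subspace over \<open>F\<close>.\<close>

definition perp :: "'v \<Rightarrow> 'v set" where
  "perp x = {y. \<forall>l. b x (act y l) = 0}"

text \<open>For \<open>x \<noteq> 0\<close>, the \<open>D\<close>-linear coordinate along
  \<open>x\<close> in the decomposition of \<open>V\<close> into the line of \<open>x\<close> and
  \<open>perp x\<close>. It is unspecified for \<open>x = 0\<close>.\<close>

definition coord :: "'v \<Rightarrow> 'v \<Rightarrow> 'd" where
  "coord x z = (THE c. \<forall>l. b x (act z l) = b x (act x (c * l)))"

lemma b_act_linear: "Vector_Spaces.linear (scaleD \<iota>) (*) (\<lambda>l. b x (act z l))"
proof (rule linear_formI)
  fix a l
  have "act z (\<iota> a * l) = act (act z l) (\<iota> a)" by (simp add: act_act emb_commute)
  then show "b x (act z (\<iota> a * l)) = a * b x (act z l)" by simp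
qed (simp add: act_add_right)

lemma b_act_nonzero: "x \<noteq> 0 \<Longrightarrow> b x (act x 1) \<noteq> 0"
  by (simp add: act_one)

lemma coord_unique:
  assumes "x \<noteq> 0" "\<And>l. b x (act x (c * l)) = b x (act x (c' * l))"
  shows "c = c'"
  by (rule form_nondegenerate[of "\<lambda>l. b x (act x l)", OF b_act_nonzero[OF assms(1)] assms(2) b_act_linear])

lemma coord:
  assumes "x \<noteq> 0"
  shows "b x (act z l) = b x (act x (coord x z * l))"
proof -
  have "\<exists>c. \<forall>l. b x (act z l) = b x (act x (c * l))"
    using form_representation[OF b_act_linear b_act_nonzero[OF assms] b_act_linear] .
  then have "\<exists>!c. \<forall>l. b x (act z l) = b x (act x (c * l))"
    using coord_unique[OF assms] by (metis (mono_tags))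
  from theI'[OF this] show ?thesis unfolding coord_def by blast
qed

lemma coordI: "x \<noteq> 0 \<Longrightarrow> (\<And>l. b x (act z l) = b x (act x (c * l))) \<Longrightarrow> coord x z = c"
  by (rule coord_unique[of x]) (simp_all add: coord[symmetric])

lemma coord_add: "x \<noteq> 0 \<Longrightarrow> coord x (y + z) = coord x y + coord x z"
  by (rule coordI) (simp_all add: distrib_right act_add_left act_add_right coord[of x y] coord[of x z])

lemma coord_act: "x \<noteq> 0 \<Longrightarrow> coord x (act z \<alpha>) = coord x z * \<alpha>"
  by (rule coordI) (simp_all add: act_act coord[of x z] mult.assoc)

lemma coord_self: "x \<noteq> 0 \<Longrightarrow> coord x x = 1"
  by (rule coordI) simp_all

lemma coord_diff: "x \<noteq> 0 \<Longrightarrow> coord x (y - z) = coord x y - coord x z"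
  using coord_add[of x "y - z" z] by simp

lemma coord_eq_0_iff: "x \<noteq> 0 \<Longrightarrow> coord x z = 0 \<longleftrightarrow> z \<in> perp x"
proof
  assume x: "x \<noteq> 0"
  show "z \<in> perp x" if "coord x z = 0"
    unfolding perp_def using coord[OF x, of z] that by simp
  show "coord x z = 0" if "z \<in> perp x"
    using that by (intro coordI[OF x]) (simp add: perp_def)
qed

lemma minus_coord_in_perp: "x \<noteq> 0 \<Longrightarrow> z - act x (coord x z) \<in> perp x"
  by (subst coord_eq_0_iff[symmetric]) (simp_all add: coord_diff coord_act coord_self)

lemma right_subspace_perp: "right_subspace act (perp x)"
  unfolding right_subspace_def perp_def by (simp add: act_add_left act_act)

lemma \<A>_subspace: "E.subspace (\<A> act b)"
  using End_subspace_UNIV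
  unfolding E.subspace_def \<A>_def by (auto simp: scaleE_def scaleV_def)

lemma \<A>_sub_End: "\<A> act b \<subseteq> End\<^sub>D act"
  unfolding \<A>_def by blast

lemma \<A>_self: "u \<in> \<A> act b \<Longrightarrow> b x (u x) = 0"
  unfolding \<A>_def by blast

lemma \<A>_skew:
  assumes u: "u \<in> \<A> act b"
  shows "b x (u y) = - b y (u x)"
proof -
  have "u \<in> End\<^sub>D act" using u \<A>_sub_End by blast
  then have "b x (u y) + b y (u x) = 0"
    using \<A>_self[OF u, of "x + y"] \<A>_self[OF u, of x] \<A>_self[OF u, of y] by (simp add: EndD add.commute)
  then show ?thesis by (simp add: eq_neg_iff_add_eq_0)
qed

lemma \<A>_trivial_spectrum: "trivial_spectrum_subspace \<iota> act (\<A> act b)"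
  unfolding trivial_spectrum_subspace_iff
proof (intro conjI ballI allI impI)
  fix u x assume "u \<in> \<A> act b" "u x = x"
  then show "x = 0" using \<A>_self[of u x] by simp
qed (simp_all add: \<A>_subspace \<A>_sub_End)

definition transitive :: bool where
  "transitive \<longleftrightarrow> (\<forall>x y. x \<noteq> 0 \<longrightarrow> b x y = 0 \<longrightarrow> (\<exists>u\<in>\<A> act b. u x = y))"

text \<open>The orbit of a nonzero \<open>x\<close> is the hyperplane \<open>b x y = 0\<close>,
  which misses \<open>x\<close>; an invariant subspace containing \<open>x\<close> contains this
  hyperplane as well and is everything.\<close>

lemma transitive_imp_irreducible:
  assumes "transitive" "(UNIV :: 'v set) \<noteq> {0}"
  shows "irreducible_in_End act (\<A> act b)"
  unfolding irreducible_in_End_def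
proof (intro conjI allI impI)
  fix W assume W: "right_subspace act W \<and> (\<forall>u\<in>\<A> act b. u ` W \<subseteq> W)"
  show "W = {0} \<or> W = UNIV"
  proof (rule disjCI)
    assume "W \<noteq> UNIV"
    show "W = {0}"
    proof (rule ccontr)
      assume "W \<noteq> {0}"
      then obtain x where x: "x \<in> W" "x \<noteq> 0"
        using W unfolding right_subspace_def by blast
      have "z \<in> W" for z
      proof -
        let ?a = "b x z / b x x"
        have "b x (z - act x (\<iota> ?a)) = 0" using x by simp
        then have "z - act x (\<iota> ?a) \<in> W"
          using assms(1) x W unfolding transitive_def by (metis image_subset_iff)
        moreover have "act x (\<iota> ?a) \<in> W" using W x unfolding right_subspace_def by blast
        ultimately have "(z - act x (\<iota> ?a)) + act x (\<iota> ?a) \<in> W"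
          using W unfolding right_subspace_def by blast
        then show ?thesis by simp
      qed
      then show False using \<open>W \<noteq> UNIV\<close> by blast
    qed
  qed
qed (rule assms)

text \<open>
  The comparison space \<open>T\<close> is block triangular with respect to \<open>V = x D \<oplus> perp x\<close>: it acts on \<open>x\<close>
  in all ways allowed by \<open>b\<close>, and its elements that kill \<open>x\<close> include those of \<open>\<A> act b\<close>.
\<close>

lemma optimal_imp_transitive:
  assumes "optimal_trivial_spectrum_subspace \<iota> act (\<A> act b)"
  shows transitive
  unfolding transitive_def
proof (intro allI impI)
  fix x y assume x: "x \<noteq> 0" and xy: "b x y = 0"
  let ?A = "\<A> act b"
  let ?T = "{u\<in>End\<^sub>D act. b x (u x) = 0 \<and> (\<forall>w\<in>perp x. u w \<in> perp x \<and> b w (u w) = 0)}"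
  interpret ev: Vector_Spaces.linear "scaleE \<iota> act" "scaleV \<iota> act" "\<lambda>u. u x"
    by (rule eval_linear)
  have T: "E.subspace ?T"
    using End_subspace_UNIV V.subspace_add[OF right_subspace_subspace[OF right_subspace_perp]]
      V.subspace_scale[OF right_subspace_subspace[OF right_subspace_perp]]
      V.subspace_0[OF right_subspace_subspace[OF right_subspace_perp]]
    unfolding E.subspace_def by (auto simp: scaleE_def) (auto simp: scaleV_def)
  have "z = 0" if u: "u \<in> ?T" and z: "u z = z" for u z
  proof -
    have uE: "u \<in> End\<^sub>D act" using u by blast
    \<comment> \<open>Modulo \<open>perp x\<close>, the fixed vector \<open>z\<close> is
      \<open>act x ?c\<close>, and \<open>u\<close> multiplies \<open>?c\<close> by
      \<open>coord x (u x)\<close>, which differs from 1. So \<open>?c = 0\<close>, and on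
      \<open>perp x\<close> a nonzero fixed vector is excluded by nonisotropy.\<close>
    let ?c = "coord x z"
    let ?w = "z - act x ?c"
    have "coord x (u x) \<noteq> 1"
    proof
      assume "coord x (u x) = 1"
      then have "b x (act (u x) 1) = b x (act x 1)" using coord[OF x, of "u x" 1] by simp
      then show False using u x by (simp add: act_one)
    qed
    moreover have "u ?w \<in> perp x" using u minus_coord_in_perp[OF x] by blast
    then have "coord x (u ?w) = 0" by (simp add: coord_eq_0_iff[OF x])
    then have "?c = coord x (u x) * ?c"
      using z x by (simp add: EndD[OF uE] coord_diff coord_act)
    ultimately have "?c = 0" by (metis mult_cancel_right1 mult.commute mult_1)
    then have "z \<in> perp x" by (simp add: coord_eq_0_iff[OF x])
    then have "b z (u z) = 0" using u by blast
    then show ?thesis using z by simp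
  qed
  then have "trivial_spectrum_subspace \<iota> act ?T"
    unfolding trivial_spectrum_subspace_iff using T by blast
  then have le: "E.dim ?T \<le> E.dim ?A"
    using assms unfolding optimal_trivial_spectrum_subspace_def by blast
  let ?K = "{u\<in>?A. u x = 0}" and ?L = "{u\<in>?T. u x = 0}"
  let ?H = "{y. b x y = 0}"
  \<comment> \<open>Skew symmetry turns \<open>u x = 0\<close> into \<open>b x (u v) = 0\<close> for
    every \<open>v\<close>, in particular for all multiples of \<open>w\<close>.\<close>
  have "u w \<in> perp x" if u: "u \<in> ?K" for u w
  proof -
    have uE: "u \<in> End\<^sub>D act" using u \<A>_sub_End by blast
    have "b x (act (u w) l) = 0" for l
      using \<A>_skew[of u x "act w l"] u by (simp add: EndD[OF uE])
    then show ?thesis unfolding perp_def by blast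
  qed
  then have "?K \<subseteq> ?L" using \<A>_sub_End \<A>_self by blast
  moreover have "E.subspace ?K" "E.subspace ?L"
    using \<A>_subspace T by (auto simp: E.subspace_def scaleE_def)
  moreover have "?L \<subseteq> End\<^sub>D act" by blast
  ultimately have KL: "E.dim ?K \<le> E.dim ?L"
    by (intro E.dim_mono_fin_dim E_fin_dim)
  have "?H \<subseteq> (\<lambda>u. u x) ` ?T"
  proof
    fix y assume y: "y \<in> ?H"
    \<comment> \<open>Every value at \<open>x\<close> allowed by \<open>b\<close> is realized by a
      map that kills \<open>perp x\<close>.\<close>
    let ?u = "\<lambda>z. act y (coord x z)"
    have "?u \<in> End\<^sub>D act"
      unfolding End\<^sub>D_def by (simp add: coord_add[OF x] coord_act[OF x] act_add_right act_act)
    moreover have "?u x = y" by (simp add: coord_self[OF x] act_one)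
    moreover have "?u w = 0" if "w \<in> perp x" for w
    proof -
      have "coord x w = 0" using that coord_eq_0_iff[OF x] by blast
      then show ?thesis by simp
    qed
    moreover have "0 \<in> perp x" by (simp add: perp_def)
    ultimately have "?u \<in> ?T" using y by (simp del: act_eq_0_iff)
    then show "y \<in> (\<lambda>u. u x) ` ?T" using \<open>?u x = y\<close> by (intro image_eqI[of _ _ ?u]) simp_all
  qed
  moreover have "(\<lambda>u. u x) ` ?T \<subseteq> ?H" by (rule image_subsetI) simp
  ultimately have TH: "(\<lambda>u. u x) ` ?T = ?H" by (rule equalityI[rotated])
  have dimT: "E.dim ?T = V.dim ((\<lambda>u. u x) ` ?T) + E.dim ?L"
    by (rule EV.dim_image_plus_kernel[OF eval_linear T E_fin_dim]) blast
  have dimA: "E.dim ?A = V.dim ((\<lambda>u. u x) ` ?A) + E.dim ?K"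
    by (rule EV.dim_image_plus_kernel[OF eval_linear \<A>_subspace E_fin_dim[OF \<A>_sub_End]])
  \<comment> \<open>The kernels of evaluation at \<open>x\<close> compare as
    \<open>?K \<subseteq> ?L\<close>, so the optimality inequality passes to the orbits.\<close>
  have dim: "V.dim ?H \<le> V.dim ((\<lambda>u. u x) ` ?A)"
    using le KL unfolding dimA dimT TH by linarith
  have "V.subspace ?H" by (auto simp: V.subspace_def scaleV_def)
  moreover have "(\<lambda>u. u x) ` ?A \<subseteq> ?H" using \<A>_self by blast
  ultimately have "(\<lambda>u. u x) ` ?A = ?H"
    using V.subspace_eq_if_dim_le[OF V_fin_dim _ ev.subspace_image[OF \<A>_subspace]] dim by blast
  then have "y \<in> (\<lambda>u. u x) ` ?A" using xy by simp
  then show "\<exists>u\<in>?A. u x = y" by (rule imageE) (rule bexI, rule sym)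
qed

end


section \<open>Conjugations and division rings of quadratic type\<close>

context central_ext
begin

lemma range_emb_closed:
  assumes "x \<in> range \<iota>" "y \<in> range \<iota>"
  shows "x + y \<in> range \<iota>" "x - y \<in> range \<iota>" "x * y \<in> range \<iota>" "- x \<in> range \<iota>"
    "inverse x \<in> range \<iota>"
proof -
  obtain a c where "x = \<iota> a" "y = \<iota> c" using assms by blast
  then show "x + y \<in> range \<iota>" "x - y \<in> range \<iota>" "x * y \<in> range \<iota>" "- x \<in> range \<iota>"
    "inverse x \<in> range \<iota>"
    by (simp_all flip: emb_add emb_diff emb_mult emb_minus emb_inverse)
qed

lemma zero_one_range_emb: "0 \<in> range \<iota>" "1 \<in> range \<iota>"
  using rangeI[of \<iota> 0] rangeI[of \<iota> 1] by simp_all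

lemma range_emb_commute: "c \<in> range \<iota> \<Longrightarrow> c * x = x * c"
  using emb_commute by auto

lemma range_emb_cancel:
  assumes "c \<in> range \<iota>" "c \<noteq> 0" "c * x \<in> range \<iota>"
  shows "x \<in> range \<iota>"
proof -
  have "inverse c * (c * x) \<in> range \<iota>" 
    by (rule range_emb_closed(3)[OF range_emb_closed(5)[OF assms(1) assms(1)] assms(3)])
  then show ?thesis using assms(2) by (simp add: mult.assoc[symmetric])
qed

lemma commute_inverse:
  assumes "x * y = y * x"
  shows "inverse x * y = y * inverse (x :: 'd)"
proof (cases "x = 0")
  case False
  have "inverse x * y = inverse x * (y * x) * inverse x" using False by (simp add: mult.assoc)
  also have "\<dots> = (inverse x * x) * y * inverse x" by (simp only: assms[symmetric] mult.assoc)
  finally show ?thesis using False by simp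
qed simp

lemma D_span_1: "D.span {1} = range \<iota>"
  by (auto simp: D.span_singleton scaleD_def)

lemma in_D_span_insert: "x \<in> D.span (insert a S) \<longleftrightarrow> (\<exists>k. x - \<iota> k * a \<in> D.span S)"
  unfolding D.span_breakdown_eq scaleD_def ..

lemma degree_eq_card: "D.span S = UNIV \<Longrightarrow> \<not> D.dependent S \<Longrightarrow> degree_over \<iota> = card S"
  using D.dim_eq_card[of S UNIV] degree_eq by simp

lemma independent_1: "\<not> D.dependent {1}"
  by simp

lemma independent_1_insert: "a \<notin> range \<iota> \<Longrightarrow> \<not> D.dependent {a, 1}"
  by (rule D.independent_insertI) (simp_all add: D_span_1)

lemma degree_eq_1_iff: "degree_over \<iota> = 1 \<longleftrightarrow> range \<iota> = UNIV"
proof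
  assume "range \<iota> = UNIV"
  then show "degree_over \<iota> = 1" using degree_eq_card[of "{1}"] D_span_1 by simp
next
  assume 1: "degree_over \<iota> = 1"
  have "D.span {1} = UNIV"
    using D.subspace_eq_if_dim_le[OF D_fin_dim, of UNIV "D.span {1}"] degree_eq 1
      D.dim_span_eq_card_independent[OF independent_1] by simp
  then show "range \<iota> = UNIV" by (simp add: D_span_1)
qed

lemma degree_2_decompose:
  assumes "degree_over \<iota> = 2" "a \<notin> range \<iota>"
  obtains p q where "x = \<iota> p + \<iota> q * a"
proof -
  have "a \<noteq> 1" using assms(2) zero_one_range_emb by blast
  then have "D.span {a, 1} = UNIV"
    using D.subspace_eq_if_dim_le[OF D_fin_dim, of UNIV "D.span {a, 1}"] degree_eq assms(1)
      D.dim_span_eq_card_independent[OF independent_1_insert[OF assms(2)]] by simp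
  then have "x \<in> D.span {a, 1}" by simp
  then obtain q p where "x - \<iota> q * a = \<iota> p"
    unfolding in_D_span_insert D_span_1 by blast
  then show thesis by (intro that[of p q]) (simp add: diff_eq_eq)
qed

lemma degree_eq_2:
  assumes "a \<notin> range \<iota>" "\<And>x. \<exists>p q. x = \<iota> p + \<iota> q * a"
  shows "degree_over \<iota> = 2"
proof -
  have "a \<noteq> 1" using assms(1) zero_one_range_emb by blast
  have "x \<in> D.span {a, 1}" for x
  proof -
    obtain p q where "x = \<iota> p + \<iota> q * a" using assms(2) by blast
    then have "x - \<iota> q * a \<in> D.span {1}" by (simp add: D_span_1)
    then show ?thesis unfolding in_D_span_insert by blast
  qed
  then have "D.span {a, 1} = UNIV" by blast
  from degree_eq_card[OF this independent_1_insert[OF assms(1)]] \<open>a \<noteq> 1\<close> show ?thesis by simp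
qed

section \<open>Polynomials evaluated in \<open>D\<close>, separability of quadratic elements\<close>

lemma poly_at_bound: "degree p \<le> N \<Longrightarrow> poly_at \<iota> p x = (\<Sum>i\<le>N. \<iota> (coeff p i) * x ^ i)"
  unfolding poly_at_def by (rule sum.mono_neutral_left) (auto simp: coeff_eq_0)

lemma poly_at_0 [simp]: "poly_at \<iota> 0 x = 0"
  by (simp add: poly_at_def)

lemma poly_at_pCons [simp]: "poly_at \<iota> (pCons c p) x = \<iota> c + x * poly_at \<iota> p x"
proof -
  have "poly_at \<iota> (pCons c p) x = (\<Sum>i\<le>Suc (degree p). \<iota> (coeff (pCons c p) i) * x ^ i)"
    by (rule poly_at_bound) (rule degree_pCons_le)
  also have "\<dots> = \<iota> c + (\<Sum>i\<le>degree p. \<iota> (coeff p i) * (x * x ^ i))"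
    by (subst sum.atMost_Suc_shift) simp
  finally show ?thesis
    by (simp add: poly_at_def sum_distrib_left emb_left_commute)
qed

lemma poly_at_add: "poly_at \<iota> (p + q) x = poly_at \<iota> p x + poly_at \<iota> q x"
  by (induction p q rule: poly_induct2) (simp_all add: emb_add distrib_left algebra_simps)

lemma poly_at_smult: "poly_at \<iota> (smult c p) x = \<iota> c * poly_at \<iota> p x"
  by (induction p) (simp_all add: emb_mult distrib_left emb_left_commute)

text \<open>Multiplicative in a noncommutative \<open>D\<close> as well, because the coefficients
  are central.\<close>

lemma poly_at_mult: "poly_at \<iota> (p * q) x = poly_at \<iota> p x * poly_at \<iota> q x"
  by (induction p) (simp_all add: poly_at_add poly_at_smult distrib_right mult.assoc)

lemma degree_1_poly_at_nonzero:
  assumes "x \<notin> range \<iota>" "degree p = 1"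
  shows "poly_at \<iota> p x \<noteq> 0"
proof
  assume 0: "poly_at \<iota> p x = 0"
  obtain a c where p: "p = [:a, c:]" "c \<noteq> 0" using assms(2) by (metis degree1_coeffs)
  have "\<iota> c * x = \<iota> (- a)" using 0 unfolding p by (simp add: emb_commute emb_minus eq_neg_iff_add_eq_0 add.commute)
  then show False using range_emb_cancel[of "\<iota> c" x] assms(1) p(2) by simp
qed

lemma irreducible_quadratic:
  assumes "x \<notin> range \<iota>" "poly_at \<iota> p x = 0" "degree p = 2"
  shows "irreducible p"
proof (rule irreducibleI)
  show "p \<noteq> 0" using assms(3) by auto
  show "\<not> p dvd 1" using assms(3) by (simp add: is_unit_iff_degree \<open>p \<noteq> 0\<close>)
  fix q r assume qr: "p = q * r"
  then have nz: "q \<noteq> 0" "r \<noteq> 0" using \<open>p \<noteq> 0\<close> by auto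
  have "poly_at \<iota> q x = 0 \<or> poly_at \<iota> r x = 0" using assms(2) by (simp add: qr poly_at_mult)
  then have "degree q \<noteq> 1 \<or> degree r \<noteq> 1" using degree_1_poly_at_nonzero[OF assms(1)] by blast
  moreover have "degree q + degree r = 2" using assms(3) qr nz by (simp add: degree_mult_eq)
  ultimately have "degree q = 0 \<or> degree r = 0" by linarith
  then show "q dvd 1 \<or> r dvd 1" using nz by (simp add: is_unit_iff_degree)
qed

text \<open>The derivative of \<open>X^2 - t X + m\<close> takes the value
  \<open>x + x - t \<noteq> 0\<close> at \<open>x\<close>, so it is not the zero polynomial; its
  degree is less than that of the irreducible polynomial, which makes the two coprime.\<close>

lemma separable_element_quadratic:
  assumes "x \<notin> range \<iota>" and x: "x * x - \<iota> t * x + \<iota> m = 0" and "x + x \<noteq> \<iota> t"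
  shows "separable_element \<iota> x"
  unfolding separable_element_def
proof (intro exI conjI)
  let ?p = "[:m, - t, 1:]"
  show 0: "poly_at \<iota> ?p x = 0"
    using x by (simp add: emb_minus distrib_left right_diff_distrib emb_commute add.commute)
  show irr: "irreducible ?p" by (rule irreducible_quadratic[OF assms(1) 0]) simp
  have "pderiv ?p \<noteq> 0"
  proof
    assume "pderiv ?p = 0"
    then have "t = 0" "(1::'f) + 1 = 0" by (simp_all add: pderiv_pCons)
    then have "(\<iota> 1 + \<iota> 1) * x = 0" by (simp only: emb_add[symmetric] emb_zero mult_zero_left)
    then show False using assms(3) \<open>t = 0\<close> by (simp only: distrib_right emb_one emb_zero mult_1 simp_thms)
  qed
  moreover have "degree (pderiv ?p) < degree ?p" by (simp add: pderiv_pCons)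
  ultimately have "\<not> ?p dvd pderiv ?p" using dvd_imp_degree_le[of ?p "pderiv ?p"] by linarith
  then show "coprime ?p (pderiv ?p)"
    using irreducibleD'[OF irr] dvd_trans by (intro coprimeI) blast
qed

lemma separable_element_base: "separable_element \<iota> (\<iota> c)"
  unfolding separable_element_def
proof (intro exI conjI)
  show "irreducible [:- c, 1:]" by (simp add: irreducible_linear_field_poly)
  show "poly_at \<iota> [:- c, 1:] (\<iota> c) = 0" by (simp add: emb_minus)
  show "coprime [:- c, 1:] (pderiv [:- c, 1:])" by (simp add: pderiv_pCons pCons_one)
qed

lemma center_superset: "range \<iota> \<subseteq> center"
  unfolding center_def using emb_commute by auto

lemma CHAR_2:
  assumes "x + x = (0 :: 'd)" "x \<noteq> 0"
  shows "CHAR('f) = 2"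
proof -
  have "(\<iota> 1 + \<iota> 1) * x = 0" using assms by (simp only: emb_one distrib_right mult_1)
  then have "\<iota> (1 + 1) = 0" using assms(2) by (metis emb_add mult_eq_0_iff)
  then have "of_nat 2 = (0 :: 'f)" by (simp only: emb_eq_0_iff) simp
  then have "CHAR('f) dvd 2" by (simp only: of_nat_eq_0_iff_char_dvd)
  moreover have "CHAR('f) \<noteq> 1" by simp
  ultimately show ?thesis by (meson prime_nat_iff two_is_prime_nat)
qed

text \<open>\<open>disj\<close> makes the sum of \<open>S\<close> and \<open>S x\<close> direct. For
  a division subring \<open>S\<close> it just says that \<open>x\<close> is outside
  \<open>S\<close>.\<close>

lemma dim_sum_multiples:
  assumes S: "D.subspace S" and disj: "\<And>s. s \<in> S \<Longrightarrow> s * x \<in> S \<Longrightarrow> s = 0" and x: "x \<noteq> 0"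
  shows "D.subspace {s + s' * x |s s'. s \<in> S \<and> s' \<in> S}"
    and "D.dim {s + s' * x |s s'. s \<in> S \<and> s' \<in> S} = 2 * D.dim S"
proof -
  let ?X = "(\<lambda>s. s * x) ` S"
  obtain BD where BD: "finite BD" "BD \<subseteq> UNIV" "\<not> D.dependent BD" "D.span BD = UNIV" "card BD = D.dim UNIV"
    by (rule D.fin_dim_basis[OF D_fin_dim D.subspace_UNIV])
  interpret fd: finite_dimensional_vector_space "scaleD \<iota>" BD
    by unfold_locales (use BD in auto)
  interpret DD: vspace_pair "scaleD \<iota>" "scaleD \<iota>" by unfold_locales
  have lin: "Vector_Spaces.linear (scaleD \<iota>) (scaleD \<iota>) (\<lambda>s. s * x)"
    by unfold_locales (auto simp: scaleD_def distrib_right mult.assoc)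
  interpret lin: Vector_Spaces.linear "scaleD \<iota>" "scaleD \<iota>" "\<lambda>s. s * x" by (rule lin)
  have X: "D.subspace ?X" by (rule lin.subspace_image[OF S])
  have dimX: "D.dim ?X = D.dim S"
    using DD.dim_image_inj[OF lin S D_fin_dim] x by simp
  have "S \<inter> ?X = {0}"
    using disj D.subspace_0[OF S] by force
  then have dim0: "D.dim (S \<inter> ?X) = 0" by simp
  have eq: "{s + s' * x |s s'. s \<in> S \<and> s' \<in> S} = {y + z |y z. y \<in> S \<and> z \<in> ?X}" by blast
  show "D.subspace {s + s' * x |s s'. s \<in> S \<and> s' \<in> S}"
    unfolding eq by (rule D.subspace_sums[OF S X])
  show "D.dim {s + s' * x |s s'. s \<in> S \<and> s' \<in> S} = 2 * D.dim S"
    using fd.dim_sums_Int[OF S X] dimX dim0 unfolding eq by simp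
qed

text \<open>A subfield that is strictly smaller than \<open>D\<close> can be enlarged by a square root, which doubles its dimension.\<close>

lemma hyper_radicial_degree:
  assumes "hyper_radicial \<iota>"
  shows "\<exists>m. degree_over \<iota> = 2 ^ m"
proof -
  have comm: "x * y = y * x" for x y :: 'd
    using assms unfolding hyper_radicial_def commutative_ring_def by blast
  have lcomm: "x * (y * z) = y * (x * z)" for x y z :: 'd
    by (simp only: mult.assoc[symmetric] comm[of x y])
  have sq: "x * x \<in> range \<iota>" for x
    using assms unfolding hyper_radicial_def power2_eq_square by blast
  let ?P = "\<lambda>S. D.subspace S \<and> 1 \<in> S \<and> (\<forall>x\<in>S. \<forall>y\<in>S. x * y \<in> S) \<and> (\<exists>m. D.dim S = 2 ^ m)"
  have "D.dim (range \<iota>) = 1"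
    using D.dim_span_eq_card_independent[OF independent_1] D_span_1 by simp
  then have "?P (range \<iota>)"
    using range_emb_closed zero_one_range_emb D.subspace_span[of "{1}"] D_span_1
    by (metis power_0)
  moreover have "\<forall>S. ?P S \<longrightarrow> D.dim S < D.dim (UNIV :: 'd set) + 1"
    unfolding less_Suc_eq_le Suc_eq_plus1[symmetric]
    by (intro allI impI D.dim_mono_fin_dim) (auto simp: D_fin_dim)
  ultimately have "\<exists>S. ?P S \<and> (\<forall>S'. ?P S' \<longrightarrow> D.dim S' \<le> D.dim S)"
    by (intro ex_has_greatest_nat)
  then obtain S m where S: "D.subspace S" "1 \<in> S" "\<And>x y. x \<in> S \<Longrightarrow> y \<in> S \<Longrightarrow> x * y \<in> S"
      "D.dim S = 2 ^ m" and max: "\<And>S'. ?P S' \<Longrightarrow> D.dim S' \<le> D.dim S"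
    by blast
  have emb: "c * s \<in> S" if "c \<in> range \<iota>" "s \<in> S" for c s
    using that D.subspace_scale[OF S(1)] by (auto simp: scaleD_def)
  have "S = UNIV"
  proof (rule ccontr)
    assume "S \<noteq> UNIV"
    then obtain x where x: "x \<notin> S" by blast
    let ?S = "{s + s' * x |s s'. s \<in> S \<and> s' \<in> S}"
    have x0: "x \<noteq> 0" using x D.subspace_0[OF S(1)] by blast
    have "s' = 0" if "s' \<in> S" "s' * x \<in> S" for s'
    proof (rule ccontr)
      assume "s' \<noteq> 0"
      have "s' * (s' * x) \<in> S" using that S(3) by blast
      then have "inverse (s' * s') * (s' * (s' * x)) \<in> S"
        using emb sq range_emb_closed(5) by blast
      moreover have "inverse (s' * s') * (s' * (s' * x)) = (inverse (s' * s') * (s' * s')) * x"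
        by (simp only: mult.assoc)
      ultimately show False using x \<open>s' \<noteq> 0\<close> by simp
    qed
    note sum = dim_sum_multiples[OF S(1) this x0]
    have dim: "D.dim ?S = 2 ^ Suc m" using sum(2) S(4) by simp
    have "D.subspace ?S" by (rule sum(1))
    moreover have "1 \<in> ?S"
    proof -
      have "1 = 1 + 0 * x" by simp
      then show ?thesis using S(2) D.subspace_0[OF S(1)] by blast
    qed
    moreover have "y * z \<in> ?S" if yz: "y \<in> ?S" "z \<in> ?S" for y z
    proof -
      obtain s s' r r' where s: "y = s + s' * x" "z = r + r' * x" "s \<in> S" "s' \<in> S" "r \<in> S" "r' \<in> S"
        using yz by blast
      have "y * z = (s * r + (x * x) * (s' * r')) + (s * r' + s' * r) * x"
        unfolding s by (simp add: distrib_left distrib_right mult.assoc comm lcomm add_ac)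
      moreover have "s * r + (x * x) * (s' * r') \<in> S" "s * r' + s' * r \<in> S"
        by (intro D.subspace_add[OF S(1)] emb[OF sq] S(3) s(3-6))+
      ultimately show ?thesis by blast
    qed
    ultimately have "?P ?S" using dim by (intro conjI ballI exI[of _ "Suc m"])
    then have "D.dim ?S \<le> D.dim S" by (rule max)
    then show False using dim S(4) by simp
  qed
  then show ?thesis using S(4) degree_eq by metis
qed

text \<open>The properties that the restriction of \<open>b\<close> to a line provides. The norm
  \<open>x * \<sigma> x\<close> is a quadratic form over \<open>F\<close>; trace, involutivity and
  the product rule all derive from it by polarization.\<close>

definition conjugation :: "('d \<Rightarrow> 'd) \<Rightarrow> bool" where
  "conjugation \<sigma> \<longleftrightarrow> (\<forall>x y. \<sigma> (x + y) = \<sigma> x + \<sigma> y) \<and> (\<forall>a x. \<sigma> (\<iota> a * x) = \<iota> a * \<sigma> x) \<and>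
     \<sigma> 1 = 1 \<and> (\<forall>x. x * \<sigma> x \<in> range \<iota>)"

end

section \<open>Algebra of a conjugation\<close>

locale conj_ext = central_ext \<iota>
  for \<iota> :: "'f::field \<Rightarrow> 'd::division_ring" +
  fixes \<sigma> :: "'d \<Rightarrow> 'd"
  assumes conj: "conjugation \<sigma>"
begin

lemma sigma_add: "\<sigma> (x + y) = \<sigma> x + \<sigma> y"
  and sigma_scale: "\<sigma> (\<iota> a * x) = \<iota> a * \<sigma> x"
  and sigma_one [simp]: "\<sigma> 1 = 1"
  and norm_in_range: "x * \<sigma> x \<in> range \<iota>"
  using conj unfolding conjugation_def by blast+

lemma sigma_emb [simp]: "\<sigma> (\<iota> a) = \<iota> a"
  using sigma_scale[of a 1] by simp

lemma sigma_range: "c \<in> range \<iota> \<Longrightarrow> \<sigma> c = c"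
  by auto

lemma sigma_range_mult: "c \<in> range \<iota> \<Longrightarrow> \<sigma> (c * x) = c * \<sigma> x"
  by (auto simp: sigma_scale)

lemma sigma_zero [simp]: "\<sigma> 0 = 0"
  using sigma_emb[of 0] by simp

lemma sigma_minus: "\<sigma> (- x) = - \<sigma> x"
  using sigma_add[of x "- x"] by (simp add: eq_neg_iff_add_eq_0 add.commute)

lemma sigma_diff: "\<sigma> (x - y) = \<sigma> x - \<sigma> y"
  using sigma_add[of x "- y"] by (simp add: sigma_minus)

text \<open>The trace is the polar form of the norm at 1 and \<open>x\<close>.\<close>

lemma trace_in_range: "x + \<sigma> x \<in> range \<iota>"
proof -
  have "(1 + x) * \<sigma> (1 + x) - 1 - x * \<sigma> x \<in> range \<iota>"
    by (intro range_emb_closed norm_in_range zero_one_range_emb)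
  then show ?thesis by (simp add: sigma_add distrib_left distrib_right algebra_simps)
qed

lemma sigma_commute: "\<sigma> x * x = x * \<sigma> x"
  using range_emb_commute[OF trace_in_range, of x x] by (simp add: distrib_left distrib_right)

lemma sigma_sigma [simp]: "\<sigma> (\<sigma> x) = x"
  using sigma_range[OF trace_in_range[of x]] by (simp add: sigma_add add.commute)

lemma sigma_eq_0_iff [simp]: "\<sigma> x = 0 \<longleftrightarrow> x = 0"
  by (metis sigma_sigma sigma_zero)

lemma polar_in_range: "x * \<sigma> y + y * \<sigma> x \<in> range \<iota>"
proof -
  have "(x + y) * \<sigma> (x + y) - x * \<sigma> x - y * \<sigma> y \<in> range \<iota>"
    by (intro range_emb_closed norm_in_range)
  then show ?thesis by (simp add: sigma_add distrib_left distrib_right algebra_simps)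
qed

lemma mult_plus_reverse_in_range: "x * y + \<sigma> y * \<sigma> x \<in> range \<iota>"
  using polar_in_range[of x "\<sigma> y"] by simp

text \<open>\<open>x * y + \<sigma> (x * y)\<close> and
  \<open>x * y + \<sigma> y * \<sigma> x\<close> are both in \<open>F\<close>, as are the products
  of \<open>x * y\<close> with \<open>\<sigma> (x * y)\<close> and with
  \<open>\<sigma> y * \<sigma> x\<close>. So the defect \<open>c\<close> and
  \<open>c * (x * y)\<close> lie in \<open>F\<close>: either \<open>c = 0\<close>, or
  \<open>x * y\<close> is a scalar; then, for \<open>x \<noteq> 0\<close>, \<open>y\<close> is a
  scalar multiple of \<open>\<sigma> x\<close> and the rule is immediate.\<close>

lemma sigma_mult: "\<sigma> (x * y) = \<sigma> y * \<sigma> x"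
proof -
  define c where "c = \<sigma> (x * y) - \<sigma> y * \<sigma> x"
  have c: "c \<in> range \<iota>"
  proof -
    have "(x * y + \<sigma> (x * y)) - (x * y + \<sigma> y * \<sigma> x) \<in> range \<iota>"
      by (intro range_emb_closed trace_in_range mult_plus_reverse_in_range)
    then show ?thesis by (simp add: c_def)
  qed
  have "x * y * (\<sigma> y * \<sigma> x) = x * (y * \<sigma> y) * \<sigma> x" by (simp add: mult.assoc)
  also have "\<dots> = (y * \<sigma> y) * (x * \<sigma> x)"
    by (simp add: range_emb_commute[OF norm_in_range[of y], of x, symmetric] mult.assoc)
  finally have eq: "x * y * (\<sigma> y * \<sigma> x) = (y * \<sigma> y) * (x * \<sigma> x)" .
  have "x * y * (\<sigma> y * \<sigma> x) \<in> range \<iota>"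
    unfolding eq by (intro range_emb_closed norm_in_range)
  then have "x * y * \<sigma> (x * y) - x * y * (\<sigma> y * \<sigma> x) \<in> range \<iota>"
    by (rule range_emb_closed(2)[OF norm_in_range])
  then have xyc: "c * (x * y) \<in> range \<iota>"
    unfolding range_emb_commute[OF c] by (simp add: c_def right_diff_distrib)
  show ?thesis
  proof (cases "c = 0 \<or> x = 0")
    case False
    then have xy: "x * y \<in> range \<iota>" using range_emb_cancel[OF c _ xyc] by blast
    let ?k = "x * y * inverse (x * \<sigma> x)"
    have k: "?k \<in> range \<iota>"
      by (rule range_emb_closed(3)[OF xy range_emb_closed(5)[OF norm_in_range norm_in_range]])
    have y: "y = ?k * \<sigma> x"
    proof -
      have "x * (?k * \<sigma> x) = ?k * (x * \<sigma> x)"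
        using range_emb_commute[OF k, of x] by (simp add: mult.assoc[symmetric])
      also have "\<dots> = x * y" using False by (simp add: mult.assoc)
      finally show ?thesis using False by simp
    qed
    have "\<sigma> y = ?k * x" by (subst y) (simp only: sigma_range_mult[OF k] sigma_sigma)
    then have "\<sigma> y * \<sigma> x = ?k * (x * \<sigma> x)" by (simp only: mult.assoc)
    also have "\<dots> = x * y" using False by (simp add: mult.assoc)
    finally show ?thesis using sigma_range[OF xy] by simp
  qed (auto simp: c_def)
qed

lemma sigma_inverse: "\<sigma> (inverse x) = inverse (\<sigma> x)"
proof (cases "x = 0")
  case False
  then have "\<sigma> x * \<sigma> (inverse x) = 1" by (simp flip: sigma_mult add: sigma_commute)
  then show ?thesis by (rule inverse_unique[symmetric])
qed simp

text \<open>The trace of \<open>x * y\<close> is in \<open>F\<close>, so conjugating it by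
  \<open>x\<close> changes nothing. This conjugation turns \<open>x * y\<close> into
  \<open>y * x\<close>, and \<open>\<sigma> y * \<sigma> x\<close> into
  \<open>\<sigma> x * \<sigma> y\<close> since the norm of \<open>x\<close> is central.\<close>

lemma trace_mult_commute: "x * y + \<sigma> (x * y) = y * x + \<sigma> (y * x)"
proof (cases "x = 0")
  case False
  let ?t = "x * y + \<sigma> (x * y)"
  have "?t = inverse x * (?t * x)"
    using False range_emb_commute[OF trace_in_range[of "x * y"], of x]
    by (simp add: mult.assoc[symmetric])
  also have "\<dots> = inverse x * (x * (y * x)) + inverse x * (\<sigma> y * (\<sigma> x * x))"
    by (simp add: distrib_left distrib_right sigma_mult mult.assoc)
  also have "\<sigma> y * (\<sigma> x * x) = (\<sigma> x * x) * \<sigma> y"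
    using range_emb_commute[OF norm_in_range[of x], of "\<sigma> y"] by (simp add: sigma_commute)
  also have "inverse x * (x * (y * x)) + inverse x * (\<sigma> x * x * \<sigma> y) = y * x + \<sigma> (y * x)"
    using False by (simp add: sigma_commute sigma_mult mult.assoc[symmetric])
  finally show ?thesis .
qed simp

lemma quadratic: "x * x = (x + \<sigma> x) * x - x * \<sigma> x"
  by (simp add: distrib_right sigma_commute)

text \<open>If \<open>a\<close> has nonzero trace, divide it out of the trace of
  \<open>a * c\<close>, which is \<open>(a + \<sigma> a) * c\<close>. Otherwise
  \<open>\<sigma> a = - a \<noteq> a\<close>, so 2 is invertible and the trace \<open>c + c\<close>
  of \<open>c\<close> suffices.\<close>

lemma fixed_commuting_in_range:
  assumes a: "\<sigma> a \<noteq> a" and c: "\<sigma> c = c" "c * a = a * c"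
  shows "c \<in> range \<iota>"
proof (cases "a + \<sigma> a = 0")
  case True
  then have "a + a \<noteq> 0" using a by (metis add_left_cancel)
  have "(1 + 1) * a = a + a" by (simp only: distrib_right mult_1)
  with \<open>a + a \<noteq> 0\<close> have 2: "(1 + 1 :: 'd) \<noteq> 0" by (metis mult_zero_left)
  have "c + \<sigma> c \<in> range \<iota>" by (rule trace_in_range)
  also have "c + \<sigma> c = (1 + 1) * c" by (simp only: distrib_right mult_1 c(1))
  finally show ?thesis using range_emb_cancel[OF _ 2] range_emb_closed(1)[OF zero_one_range_emb(2,2)]
    by blast
next
  case False
  have "a * c + \<sigma> (a * c) \<in> range \<iota>" by (rule trace_in_range)
  also have "a * c + \<sigma> (a * c) = c * a + c * \<sigma> a" by (simp only: sigma_mult c)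
  also have "\<dots> = (a + \<sigma> a) * c"
    using range_emb_commute[OF trace_in_range[of a], of c] by (simp add: distrib_left)
  finally show ?thesis using range_emb_cancel[OF trace_in_range False] by blast
qed

text \<open>The quotient of the skew elements \<open>\<sigma> c - c\<close> and
  \<open>\<sigma> a - a\<close> is fixed by \<open>\<sigma>\<close> and commutes with
  \<open>a\<close>, hence is a scalar \<open>q\<close>; then \<open>c - \<iota> q * a\<close> is
  fixed too, hence a scalar.\<close>

lemma commuting_decompose:
  assumes a: "\<sigma> a \<noteq> a" and c: "c * a = a * c"
  shows "\<exists>p q. c = \<iota> p + \<iota> q * a"
proof -
  define e where "e = \<sigma> a - a"
  define f where "f = \<sigma> c - c"
  have e0: "e \<noteq> 0" using a by (simp add: e_def)
  have comm: "x * \<sigma> y = \<sigma> y * x" if "x * y = y * x" for x y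
  proof -
    have "x * (y + \<sigma> y) = (y + \<sigma> y) * x" using range_emb_commute[OF trace_in_range[of y]] by simp
    then show ?thesis using that by (simp add: distrib_left distrib_right)
  qed
  have ac: "a * c = c * a" using c by simp
  have fa: "f * a = a * f" using c comm[OF ac] by (simp add: f_def left_diff_distrib right_diff_distrib)
  have fe: "e * f = f * e"
    using fa comm[OF fa] by (simp add: e_def left_diff_distrib right_diff_distrib)
  have ea: "e * a = a * e" by (simp add: e_def left_diff_distrib right_diff_distrib sigma_commute)
  have "\<sigma> e = - e" "\<sigma> f = - f" by (simp_all add: e_def f_def sigma_diff)
  then have "\<sigma> (f * inverse e) = inverse e * f"
    by (simp add: sigma_mult sigma_inverse)
  then have 1: "\<sigma> (f * inverse e) = f * inverse e" using commute_inverse[OF fe] by simp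
  have 2: "(f * inverse e) * a = a * (f * inverse e)"
    using commute_inverse[OF ea] fa by (metis mult.assoc)
  obtain q where q: "f * inverse e = \<iota> q"
    using fixed_commuting_in_range[OF a 1 2] by blast
  have f: "f = \<iota> q * e" using q e0 by (metis mult.assoc left_inverse mult.right_neutral)
  have "\<sigma> (c - \<iota> q * a) = c - \<iota> q * a"
  proof -
    have "\<sigma> c = c + \<iota> q * e" using f by (simp add: f_def diff_eq_eq add.commute)
    then show ?thesis by (simp add: sigma_diff sigma_scale e_def right_diff_distrib)
  qed
  moreover have "(c - \<iota> q * a) * a = a * (c - \<iota> q * a)"
    using c by (simp add: left_diff_distrib right_diff_distrib emb_left_commute mult.assoc)
  ultimately obtain p where "c - \<iota> q * a = \<iota> p"
    using fixed_commuting_in_range[OF a] by blast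
  then have "c = \<iota> p + \<iota> q * a" by (simp add: diff_eq_eq)
  then show ?thesis by blast
qed

section \<open>Classification of the division rings with a conjugation\<close>

lemma quadratic_type_commutative_id:
  assumes comm: "\<And>x y :: 'd. x * y = y * x" and id: "\<And>x. \<sigma> x = x"
  shows "quadratic_type \<iota>"
proof (cases "degree_over \<iota> = 1")
  case True
  then show ?thesis by (simp add: quadratic_type_def quadratic_type_i_def)
next
  case False
  then obtain x where x: "x \<notin> range \<iota>" using degree_eq_1_iff by blast
  \<comment> \<open>The trace of \<open>x\<close> is \<open>x + x\<close>, which is in
    \<open>F\<close> while \<open>x\<close> is not.\<close>
  have "(1 + 1 :: 'd) = 0"
  proof (rule ccontr)
    assume 2: "(1 + 1 :: 'd) \<noteq> 0"
    have "(1 + 1) * x \<in> range \<iota>"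
      using trace_in_range[of x] by (simp only: id distrib_right mult_1)
    then show False
      using range_emb_cancel[OF range_emb_closed(1)[OF zero_one_range_emb(2,2)] 2] x by blast
  qed
  then have char: "CHAR('f) = 2" using CHAR_2[of 1] by simp
  have hyper: "hyper_radicial \<iota>"
    unfolding hyper_radicial_def commutative_ring_def power2_eq_square
    using comm norm_in_range id by metis
  obtain m where "degree_over \<iota> = 2 ^ m" using hyper_radicial_degree[OF hyper] by blast
  then have "m \<ge> 1 \<and> degree_over \<iota> = 2 ^ m" using False by (cases m) auto
  then show ?thesis using char hyper unfolding quadratic_type_def quadratic_type_iv_def by blast
qed

text \<open>Everything commutes with \<open>a\<close>, so \<open>D = F + F a\<close>. An
  \<open>x\<close> outside \<open>F\<close> is not fixed by \<open>\<sigma>\<close>, so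
  \<open>x\<close> and \<open>\<sigma> x\<close> are distinct roots of its quadratic
  polynomial.\<close>

lemma quadratic_type_commutative_nonid:
  assumes comm: "\<And>x y :: 'd. x * y = y * x" and a: "\<sigma> a \<noteq> a"
  shows "quadratic_type_ii \<iota>"
  unfolding quadratic_type_ii_def separable_field_ext_def
proof (intro conjI allI)
  have "a \<notin> range \<iota>" using a by auto
  then show "degree_over \<iota> = 2"
    using commuting_decompose[OF a comm] by (rule degree_eq_2)
  show "commutative_ring TYPE('d)" unfolding commutative_ring_def using comm by blast
  fix x
  show "separable_element \<iota> x"
  proof (cases "x \<in> range \<iota>")
    case True
    then show ?thesis using separable_element_base by auto
  next
    case False
    then have "\<sigma> x \<noteq> x" using fixed_commuting_in_range[OF a _ comm] by blast
    moreover obtain t m where tm: "x + \<sigma> x = \<iota> t" "x * \<sigma> x = \<iota> m"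
      using trace_in_range norm_in_range by (metis rangeE)
    ultimately have "x + x \<noteq> \<iota> t" by (metis add_left_cancel)
    moreover have "x * x - \<iota> t * x + \<iota> m = 0"
      using quadratic[of x] by (simp add: tm)
    ultimately show ?thesis using separable_element_quadratic[OF False] by blast
  qed
qed

text \<open>A central \<open>z\<close> moved by \<open>\<sigma>\<close> would give
  \<open>D = F + F z\<close>, which is commutative. A fixed one is in \<open>F\<close>, because
  \<open>\<sigma>\<close> moves some \<open>a\<close>: the identity is no antiautomorphism of a
  noncommutative ring.\<close>

lemma center_noncommutative:
  assumes "x0 * y0 \<noteq> y0 * (x0 :: 'd)"
  shows "center = range \<iota>"
proof
  show "range \<iota> \<subseteq> center" by (rule center_superset)
  show "center \<subseteq> range \<iota>"
  proof
    fix z assume "z \<in> (center :: 'd set)"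
    then have z: "z * x = x * z" for x unfolding center_def by blast
    show "z \<in> range \<iota>"
    proof (cases "\<sigma> z = z")
      case True
      have "\<exists>a. \<sigma> a \<noteq> a"
      proof (rule ccontr)
        assume "\<not> (\<exists>a. \<sigma> a \<noteq> a)"
        then have "\<sigma> (x0 * y0) = x0 * y0" "\<sigma> x0 = x0" "\<sigma> y0 = y0" by blast+
        then show False using assms sigma_mult[of x0 y0] by simp
      qed
      then show ?thesis using fixed_commuting_in_range True z by blast
    next
      case False
      have "\<exists>p q. c = \<iota> p + \<iota> q * z" for c
        using commuting_decompose[OF False, of c] z by simp
      then obtain p q where "x0 = \<iota> p + \<iota> q * z" by blast
      then have "x0 * y0 = y0 * x0"
        by (simp add: distrib_left distrib_right emb_commute[of p] emb_left_commute mult.assoc z)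
      then show ?thesis using assms by blast
    qed
  qed
qed

text \<open>
  Any \<open>j = x a - a x \<noteq> 0\<close> satisfies \<open>j a = \<sigma> a j\<close>, and \<open>D\<close> is the direct sum of \<open>K = F + F a\<close>,
  the centralizer of \<open>a\<close>, and \<open>K j\<close>.
\<close>

lemma quadratic_type_noncommutative:
  assumes nc: "x0 * y0 \<noteq> y0 * (x0 :: 'd)"
  shows "quadratic_type_iii \<iota>"
proof -
  have center: "center = range \<iota>" by (rule center_noncommutative[OF nc])
  have "\<exists>a. \<sigma> a \<noteq> a"
  proof (rule ccontr)
    assume "\<not> (\<exists>a. \<sigma> a \<noteq> a)"
    then have "\<sigma> (x0 * y0) = x0 * y0" "\<sigma> x0 = x0" "\<sigma> y0 = y0" by blast+
    then show False using nc sigma_mult[of x0 y0] by simp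
  qed
  then obtain a where a: "\<sigma> a \<noteq> a" by blast
  then have "a \<notin> center" unfolding center by auto
  then obtain x where "a * x \<noteq> x * a" unfolding center_def by blast
  define j where "j = x * a - a * x"
  have j0: "j \<noteq> 0" using \<open>a * x \<noteq> x * a\<close> by (simp add: j_def)
  obtain t where t: "a + \<sigma> a = \<iota> t" using trace_in_range by (metis rangeE)
  obtain m where m: "a * \<sigma> a = \<iota> m" using norm_in_range by (metis rangeE)
  have sa: "\<sigma> a = \<iota> t - a" using t by (simp add: algebra_simps)
  have a2: "a * a = \<iota> t * a - \<iota> m" using quadratic[of a] t m by simp
  \<comment> \<open>Both this and \<open>centr\<close> rest on
    \<open>a * a = \<iota> t * a - \<iota> m\<close>: commutators with \<open>a\<close> intertwine
    \<open>a\<close> and \<open>\<sigma> a\<close>, while twisted commutators commute with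
    \<open>a\<close>.\<close>
  have twist: "(y * a - a * y) * a = \<sigma> a * (y * a - a * y)" for y
  proof -
    have "(y * a - a * y) * a = y * (a * a) - a * (y * a)" by (simp add: left_diff_distrib mult.assoc)
    moreover have "\<sigma> a * (y * a - a * y) = \<iota> t * (y * a) - \<iota> t * (a * y) - a * (y * a) + (a * a) * y"
      by (simp add: sa left_diff_distrib right_diff_distrib mult.assoc)
    moreover have "y * (a * a) = \<iota> t * (y * a) - \<iota> m * y"
      by (simp add: a2 right_diff_distrib emb_left_commute emb_commute[of m])
    moreover have "(a * a) * y = \<iota> t * (a * y) - \<iota> m * y"
      by (simp add: a2 left_diff_distrib mult.assoc)
    ultimately show ?thesis by simp
  qed
  have ja: "j * a = \<sigma> a * j" unfolding j_def by (rule twist)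
  have centr: "(y * a - \<sigma> a * y) * a = a * (y * a - \<sigma> a * y)" for y
  proof -
    have "(y * a - \<sigma> a * y) * a = (\<iota> t * (y * a) - \<iota> m * y) - \<iota> t * (y * a) + a * (y * a)"
      by (simp add: sa left_diff_distrib right_diff_distrib mult.assoc a2 emb_left_commute emb_commute[of m])
    moreover have "a * (y * a - \<sigma> a * y) = a * (y * a) - \<iota> m * y"
      by (simp add: right_diff_distrib mult.assoc[symmetric] m)
    ultimately show ?thesis by simp
  qed
  have disj: "z = 0" if "z * a = \<sigma> a * z" "z * a = a * z" for z
  proof -
    have "(\<sigma> a - a) * z = 0" using that by (simp only: left_diff_distrib right_minus_eq)
    then show ?thesis using a by auto
  qed
  have "a \<notin> range \<iota>" using a by auto
  have span_commute: "z * a = a * z" if z: "z \<in> D.span {a, 1}" for z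
  proof -
    obtain q p where "z - \<iota> q * a = \<iota> p" using z unfolding in_D_span_insert D_span_1 by blast
    then have "z = \<iota> p + \<iota> q * a" by (simp add: diff_eq_eq)
    then show ?thesis
      by (simp add: distrib_left distrib_right emb_commute[of p] emb_left_commute mult.assoc)
  qed
  have j_span: "j \<notin> D.span {a, 1}" using disj[OF ja] span_commute j0 by blast
  have aj_span: "a * j \<notin> D.span {j, a, 1}"
  proof
    assume "a * j \<in> D.span {j, a, 1}"
    then obtain k where k: "a * j - \<iota> k * j \<in> D.span {a, 1}" unfolding in_D_span_insert[of _ j] by blast
    have "(a * j - \<iota> k * j) * a = a * (\<sigma> a * j) - \<iota> k * (\<sigma> a * j)"
      by (simp add: left_diff_distrib mult.assoc ja)
    also have "\<dots> = \<sigma> a * (a * j - \<iota> k * j)"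
      by (simp add: right_diff_distrib emb_left_commute) (simp add: mult.assoc[symmetric] sigma_commute)
    finally have "a * j - \<iota> k * j = 0" using disj span_commute[OF k] by blast
    then have "(a - \<iota> k) * j = 0" by (simp add: left_diff_distrib)
    then have "a = \<iota> k" using j0 by simp
    then show False using \<open>a \<notin> range \<iota>\<close> by blast
  qed
  have ind: "\<not> D.dependent {a * j, j, a, 1}"
    by (intro D.independent_insertI aj_span j_span independent_1_insert) fact
  have "a \<noteq> 1" using \<open>a \<notin> range \<iota>\<close> zero_one_range_emb by blast
  moreover have "j \<notin> {a, 1}" using j_span D.span_base[of j "{a, 1}"] by blast
  moreover have "a * j \<notin> {j, a, 1}" using aj_span D.span_base[of "a * j" "{j, a, 1}"] by blast
  ultimately have card: "card {a * j, j, a, 1} = 4" by simp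
  have "y \<in> D.span {a * j, j, a, 1}" for y
  proof -
    \<comment> \<open>\<open>w * y = y2 - y1\<close> splits \<open>y\<close>:
      \<open>inverse w * y1\<close> commutes with \<open>a\<close>, and so does
      \<open>inverse w * y2\<close> after division by \<open>j\<close> on the right, as
      \<open>y2\<close> and \<open>j\<close> intertwine \<open>a\<close> and
      \<open>\<sigma> a\<close> alike.\<close>
    define w where "w = \<sigma> a - a"
    define y1 where "y1 = y * a - \<sigma> a * y"
    define y2 where "y2 = y * a - a * y"
    have w0: "w \<noteq> 0" using a by (simp add: w_def)
    have "w * a = a * w" by (simp add: w_def left_diff_distrib right_diff_distrib sigma_commute)
    then have wa: "inverse w * a = a * inverse w" by (rule commute_inverse)
    have "w * y = y2 - y1" by (simp add: w_def y1_def y2_def left_diff_distrib)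
    then have y: "y = inverse w * y2 - inverse w * y1"
      using w0 by (metis mult.assoc left_inverse mult_1 right_diff_distrib)
    have swap: "z * \<sigma> a = a * z" if "z * a = \<sigma> a * z" for z
      using that unfolding sa by (simp add: left_diff_distrib right_diff_distrib emb_commute[of t])
    have "\<sigma> a * inverse j = inverse j * a"
    proof -
      have "\<sigma> a * inverse j = inverse j * (j * \<sigma> a) * inverse j"
        using j0 by (simp add: mult.assoc[symmetric])
      also have "\<dots> = inverse j * a * (j * inverse j)" by (simp only: swap[OF ja] mult.assoc)
      finally show ?thesis using j0 by simp
    qed
    then have "y2 * inverse j * a = y2 * \<sigma> a * inverse j" by (simp add: mult.assoc)
    also have "y2 * \<sigma> a = a * y2" unfolding y2_def by (rule swap[OF twist])
    finally have "inverse w * (y2 * inverse j) * a = a * (inverse w * (y2 * inverse j))"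
      using wa by (metis mult.assoc)
    then obtain r s where rs: "inverse w * (y2 * inverse j) = \<iota> r + \<iota> s * a"
      using commuting_decompose[OF a] by blast
    have "inverse w * y1 * a = a * (inverse w * y1)"
      using centr[of y] wa unfolding y1_def by (metis mult.assoc)
    then obtain p q where pq: "inverse w * y1 = \<iota> p + \<iota> q * a"
      using commuting_decompose[OF a] by blast
    have "inverse w * y2 = (inverse w * (y2 * inverse j)) * j" using j0 by (simp add: mult.assoc)
    then have "y - \<iota> s * (a * j) - \<iota> r * j - \<iota> (- q) * a = \<iota> (- p)"
      unfolding y rs pq by (simp add: distrib_right mult.assoc emb_minus)
    then show ?thesis unfolding in_D_span_insert D_span_1 by blast
  qed
  then have "degree_over \<iota> = 4" using degree_eq_card[OF _ ind] card by auto
  then show ?thesis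
    unfolding quadratic_type_iii_def quaternion_algebra_def using center by blast
qed

lemma quadratic_type: "quadratic_type \<iota>"
proof (cases "\<forall>x y :: 'd. x * y = y * x")
  case True
  then show ?thesis
    using quadratic_type_commutative_id quadratic_type_commutative_nonid
    unfolding quadratic_type_def by blast
next
  case False
  then show ?thesis using quadratic_type_noncommutative unfolding quadratic_type_def by blast
qed

end

context central_ext
begin

text \<open>For \<open>x\<close> outside \<open>F\<close>, the two traces of \<open>x\<close> differ
  by a scalar \<open>c\<close>, and \<open>c * x\<close> is the difference of the norms, again a
  scalar; so \<open>c = 0\<close>.\<close>

lemma conjugation_unique:
  assumes "conjugation \<sigma>" "conjugation \<tau>"
  shows "\<sigma> = \<tau>"
proof
  interpret s: conj_ext \<iota> \<sigma> by unfold_locales (rule assms)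
  interpret t: conj_ext \<iota> \<tau> by unfold_locales (rule assms)
  fix x
  show "\<sigma> x = \<tau> x"
  proof (cases "x \<in> range \<iota>")
    case True
    then show ?thesis by auto
  next
    case False
    let ?c = "(x + \<sigma> x) - (x + \<tau> x)"
    have c: "?c \<in> range \<iota>" by (intro range_emb_closed s.trace_in_range t.trace_in_range)
    have "?c * x = (x * x + x * \<sigma> x) - (x * x + x * \<tau> x)"
      by (simp add: distrib_right left_diff_distrib s.sigma_commute t.sigma_commute)
    also have "\<dots> = x * \<sigma> x - x * \<tau> x" by simp
    also have "\<dots> \<in> range \<iota>"
      by (intro range_emb_closed s.norm_in_range t.norm_in_range)
    finally have "?c = 0" using range_emb_cancel[OF c] False by blast
    then show ?thesis by simp
  qed
qed

end


section \<open>Associated pairs\<close>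

text \<open>In the quaternion case \<open>p\<close>, \<open>q\<close>, \<open>t\<close>,
  \<open>u\<close> are the traces of \<open>x\<close>, \<open>y\<close>, \<open>x + y\<close> and
  \<open>x + \<iota> a * y\<close>. The two equations combine to
  \<open>(a - 1) * (t - (p + q)) = 0\<close>.\<close>

lemma trace_additivity:
  fixes a t u p q :: "'a::field"
  assumes "(u - p) - a * (t - p) = 0" "(a * u - a * a * q) - a * (t - q) = 0" "a \<noteq> 0" "a \<noteq> 1"
  shows "t = p + q"
proof -
  have "(a * u - a * a * q) - a * (t - q) = a * ((u - a * q) - (t - q))"
    by (simp only: right_diff_distrib mult.assoc)
  then have "(u - a * q) - (t - q) = 0" using assms(2,3) by simp
  moreover have "(a - 1) * (t - (p + q)) = ((u - a * q) - (t - q)) - ((u - p) - a * (t - p))"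
    by (simp add: algebra_simps)
  ultimately have "(a - 1) * (t - (p + q)) = 0" using assms(1) by simp
  then show ?thesis using assms(4) by simp
qed

context central_ext
begin

lemma conjugation_id_commutative:
  assumes "\<And>x. x * x \<in> range \<iota>"
  shows "conjugation id"
  unfolding conjugation_def using assms by simp

section \<open>Automorphisms in degrees 1 and 2\<close>

lemma algebra_autsD:
  assumes "\<tau> \<in> algebra_auts \<iota>"
  shows "\<tau> (x + y) = \<tau> x + \<tau> y" "\<tau> (x * y) = \<tau> x * \<tau> y" "\<tau> (\<iota> a) = \<iota> a"
  using assms unfolding algebra_auts_def by auto

lemma id_in_algebra_auts: "id \<in> algebra_auts \<iota>"
  unfolding algebra_auts_def by simp

lemma algebra_auts_type_i:
  assumes "quadratic_type_i \<iota>"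
  shows "algebra_auts \<iota> = {id}"
proof
  have R: "range \<iota> = UNIV" using assms degree_eq_1_iff unfolding quadratic_type_i_def by blast
  have "\<tau> x = x" if "\<tau> \<in> algebra_auts \<iota>" for \<tau> x
  proof -
    obtain a where "x = \<iota> a" using R by blast
    then show ?thesis using algebra_autsD(3)[OF that] by simp
  qed
  then show "algebra_auts \<iota> \<subseteq> {id}" by (auto simp: fun_eq_iff)
qed (simp add: id_in_algebra_auts)

text \<open>Separability enters here: the roots \<open>a\<close> and \<open>\<iota> q - a\<close> of
  the polynomial of \<open>a\<close> are distinct. Equality would force characteristic 2 and
  \<open>q = 0\<close>; then \<open>X^2 - p\<close> has derivative 0 and divides every polynomial
  that vanishes at \<open>a\<close>, so none of these is both irreducible and separable.\<close>

lemma type_ii_generator: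
  assumes "quadratic_type_ii \<iota>"
  obtains a p q where "a \<notin> range \<iota>" "a * a = \<iota> p + \<iota> q * a" "a + a \<noteq> \<iota> q"
proof -
  have deg: "degree_over \<iota> = 2" using assms unfolding quadratic_type_ii_def by blast
  then have "range \<iota> \<noteq> UNIV" using degree_eq_1_iff by simp
  then obtain a where a: "a \<notin> range \<iota>" by blast
  obtain p q where pq: "a * a = \<iota> p + \<iota> q * a" by (rule degree_2_decompose[OF deg a])
  have "a + a \<noteq> \<iota> q"
  proof
    assume q: "a + a = \<iota> q"
    then have q': "(1 + 1) * a = \<iota> q" by (simp only: distrib_right mult_1)
    have 2: "(1 + 1 :: 'd) = 0"
    proof (rule ccontr)
      assume "(1 + 1 :: 'd) \<noteq> 0"
      moreover have "(1 + 1) * a \<in> range \<iota>" unfolding q' by (rule rangeI)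
      ultimately show False
        using range_emb_cancel[OF range_emb_closed(1)[OF zero_one_range_emb(2,2)]] a by blast
    qed
    then have "\<iota> q = 0" using q' by (metis mult_zero_left)
    then have q0: "q = 0" by simp
    have "\<iota> (1 + 1) = 0" using 2 by (simp only: emb_add emb_one)
    then have f2: "(1 + 1 :: 'f) = 0" by (simp only: emb_eq_0_iff)
    let ?p = "[:- p, 0, 1:]"
    have pa: "poly_at \<iota> ?p a = 0" using pq q0 by (simp add: emb_minus)
    have irr: "irreducible ?p" by (rule irreducible_quadratic[OF a pa]) simp
    have dp: "pderiv ?p = 0" using f2 by (simp add: pderiv_pCons)
    have "separable_element \<iota> a"
      using assms unfolding quadratic_type_ii_def separable_field_ext_def by blast
    then obtain P where P: "irreducible P" "poly_at \<iota> P a = 0" "coprime P (pderiv P)"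
      unfolding separable_element_def by blast
    let ?r = "P mod ?p"
    have "P = ?p * (P div ?p) + ?r" by (rule mult_div_mod_eq[symmetric])
    then have "poly_at \<iota> P a = poly_at \<iota> (?p * (P div ?p)) a + poly_at \<iota> ?r a"
      by (metis poly_at_add)
    then have r: "poly_at \<iota> ?r a = 0" using P(2) pa by (simp only: poly_at_mult mult_zero_left add_0)
    have "?r = 0"
    proof (rule ccontr)
      assume r0: "?r \<noteq> 0"
      then have "degree ?r < 2" using degree_mod_less[of ?p P] by simp
      moreover have "degree ?r \<noteq> 1" using degree_1_poly_at_nonzero[OF a, of ?r] r by blast
      ultimately have "degree ?r = 0" by linarith
      then obtain c where "?r = [:c:]" by (metis degree_eq_zeroE)
      then show False using r r0 by simp
    qed
    then have "?p dvd P" by (simp add: dvd_eq_mod_eq_0)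
    then obtain Q where Q: "P = ?p * Q" by (rule dvdE)
    have "\<not> is_unit ?p" by (simp add: is_unit_iff_degree)
    then have "is_unit Q" using irreducibleD[OF P(1) Q] by blast
    moreover have "Q \<noteq> 0" using Q P(1) by auto
    ultimately have "degree Q = 0" by (simp add: is_unit_iff_degree)
    then have "pderiv Q = 0" by (elim degree_eq_zeroE) (simp add: pderiv_pCons)
    then have "pderiv P = 0" by (simp add: Q pderiv_mult dp del: mult_pCons_left pderiv_pCons)
    then have "is_unit P" using P(3) by simp
    then show False using P(1) irreducible_not_unit by blast
  qed
  then show thesis using that a pq by blast
qed

lemma type_ii_commute: "quadratic_type_ii \<iota> \<Longrightarrow> x * y = y * (x :: 'd)"
  unfolding quadratic_type_ii_def separable_field_ext_def commutative_ring_def by blast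

text \<open>An automorphism is determined by the image of \<open>a\<close>, which is
  \<open>a\<close> or \<open>\<iota> q - a\<close>. The norm is in \<open>F\<close> because
  \<open>a * (\<iota> q - a) = - \<iota> p\<close>.\<close>

lemma type_ii_aut:
  assumes ii: "quadratic_type_ii \<iota>" and s: "\<sigma> \<in> algebra_auts \<iota>" "\<sigma> \<noteq> id"
  shows "algebra_auts \<iota> = {id, \<sigma>}" and "conjugation \<sigma>"
proof -
  note comm = type_ii_commute[OF ii]
  have lcomm: "x * (y * z) = y * (x * z)" for x y z :: 'd
    by (simp only: mult.assoc[symmetric] comm[of x y])
  have deg: "degree_over \<iota> = 2" using ii unfolding quadratic_type_ii_def by blast
  obtain a p q where a: "a \<notin> range \<iota>" "a * a = \<iota> p + \<iota> q * a" "a + a \<noteq> \<iota> q"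
    by (rule type_ii_generator[OF ii])
  have root: "\<tau> a = a \<or> \<tau> a = \<iota> q - a" if t: "\<tau> \<in> algebra_auts \<iota>" for \<tau>
  proof -
    have "\<tau> a * \<tau> a = \<iota> p + \<iota> q * \<tau> a"
      using arg_cong[OF a(2), of \<tau>] by (simp only: algebra_autsD[OF t])
    then have "(\<tau> a - a) * (\<tau> a - (\<iota> q - a)) = 0"
      using a(2) comm[of "\<tau> a" a] comm[of "\<tau> a" "\<iota> q"] comm[of a "\<iota> q"]
      by (simp add: left_diff_distrib right_diff_distrib)
    then show ?thesis by auto
  qed
  have val: "\<tau> (\<iota> r + \<iota> s * a) = \<iota> r + \<iota> s * \<tau> a" if "\<tau> \<in> algebra_auts \<iota>" for \<tau> r s
    by (simp only: algebra_autsD[OF that])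
  have det: "\<tau> = \<tau>'" if "\<tau> \<in> algebra_auts \<iota>" "\<tau>' \<in> algebra_auts \<iota>" "\<tau> a = \<tau>' a" for \<tau> \<tau>'
  proof
    fix x
    obtain r s where "x = \<iota> r + \<iota> s * a" by (rule degree_2_decompose[OF deg a(1)])
    then show "\<tau> x = \<tau>' x" using that by (simp only: val)
  qed
  have "\<sigma> a \<noteq> a" using det[OF s(1) id_in_algebra_auts] s(2) by fastforce
  then have sa: "\<sigma> a = \<iota> q - a" using root[OF s(1)] by blast
  show "algebra_auts \<iota> = {id, \<sigma>}"
  proof
    show "algebra_auts \<iota> \<subseteq> {id, \<sigma>}"
    proof
      fix \<tau> assume t: "\<tau> \<in> algebra_auts \<iota>"
      from root[OF t] have "\<tau> = id \<or> \<tau> = \<sigma>"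
      proof
        assume "\<tau> a = a"
        then have "\<tau> = id" by (intro det[OF t id_in_algebra_auts]) simp
        then show ?thesis ..
      next
        assume "\<tau> a = \<iota> q - a"
        then have "\<tau> = \<sigma>" by (intro det[OF t s(1)]) (simp add: sa)
        then show ?thesis ..
      qed
      then show "\<tau> \<in> {id, \<sigma>}" by blast
    qed
  qed (use s(1) id_in_algebra_auts in blast)
  have "x * \<sigma> x \<in> range \<iota>" for x
  proof -
    obtain r s where x: "x = \<iota> r + \<iota> s * a" by (rule degree_2_decompose[OF deg a(1)])
    have aq: "a * (\<iota> q - a) = - \<iota> p"
      using a(2) comm[of a "\<iota> q"] by (simp add: right_diff_distrib)
    have "x * \<sigma> x = (\<iota> r + \<iota> s * a) * (\<iota> r + \<iota> s * (\<iota> q - a))"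
      using val[OF s(1), of r s] by (simp only: x sa)
    also have "\<dots> = \<iota> r * \<iota> r + \<iota> r * (\<iota> s * \<iota> q) + \<iota> s * \<iota> s * (a * (\<iota> q - a))"
      by (simp add: distrib_left distrib_right right_diff_distrib mult.assoc comm lcomm)
    also have "\<dots> \<in> range \<iota>"
      unfolding aq by (intro range_emb_closed(1,3) range_emb_closed(4)[OF _ rangeI] rangeI)
    finally show ?thesis .
  qed
  then show "conjugation \<sigma>"
    unfolding conjugation_def
    using algebra_autsD[OF s(1)] algebra_autsD(3)[OF s(1), of 1] by simp
qed

text \<open>The automorphism exchanges \<open>a\<close> with the other root
  \<open>\<iota> q - a\<close>. The product formula \<open>prod\<close> rests on
  \<open>c * c = \<iota> p + \<iota> q * c\<close>, true of both roots, so multiplication is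
  preserved.\<close>

lemma type_ii_aut_exists:
  assumes ii: "quadratic_type_ii \<iota>"
  shows "\<exists>\<sigma>\<in>algebra_auts \<iota>. \<sigma> \<noteq> id"
proof -
  note comm = type_ii_commute[OF ii]
  have deg: "degree_over \<iota> = 2" using ii unfolding quadratic_type_ii_def by blast
  obtain a p q where a: "a \<notin> range \<iota>" "a * a = \<iota> p + \<iota> q * a" "a + a \<noteq> \<iota> q"
    by (rule type_ii_generator[OF ii])
  let ?b = "\<iota> q - a"
  have b2: "?b * ?b = \<iota> p + \<iota> q * ?b"
    using a(2) comm[of a "\<iota> q"] by (simp add: left_diff_distrib right_diff_distrib)
  have "\<forall>x. \<exists>m. x = \<iota> (fst m) + \<iota> (snd m) * a"
  proof
    fix x
    obtain m k where "x = \<iota> m + \<iota> k * a" by (rule degree_2_decompose[OF deg a(1)])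
    then show "\<exists>m. x = \<iota> (fst m) + \<iota> (snd m) * a" by (intro exI[of _ "(m, k)"]) simp
  qed
  then obtain f where f: "\<forall>x. x = \<iota> (fst (f x)) + \<iota> (snd (f x)) * a" by (rule choice[THEN exE])
  define r where "r x = fst (f x)" for x
  define s where "s x = snd (f x)" for x
  have rs: "x = \<iota> (r x) + \<iota> (s x) * a" for x
    unfolding r_def s_def using f by blast
  define \<sigma> where "\<sigma> x = \<iota> (r x) + \<iota> (s x) * ?b" for x
  have uniq: "m = m' \<and> k = k'" if e: "\<iota> m + \<iota> k * a = \<iota> m' + \<iota> k' * a" for m k m' k'
  proof -
    have 1: "\<iota> (k - k') * a = \<iota> (m' - m)"
    proof -
      have "\<iota> k * a = (\<iota> m' + \<iota> k' * a) - \<iota> m" unfolding e[symmetric] by simp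
      then show ?thesis by (simp add: emb_diff left_diff_distrib)
    qed
    have "k - k' = 0"
    proof (rule ccontr)
      assume "k - k' \<noteq> 0"
      then show False using range_emb_cancel[of "\<iota> (k - k')" a] a(1) 1 by simp
    qed
    then show ?thesis using 1 by simp
  qed
  have sv: "\<sigma> (\<iota> m + \<iota> k * a) = \<iota> m + \<iota> k * ?b" for m k
  proof -
    have "m = r (\<iota> m + \<iota> k * a) \<and> k = s (\<iota> m + \<iota> k * a)"
      by (rule uniq) (rule rs)
    then have "r (\<iota> m + \<iota> k * a) = m" "s (\<iota> m + \<iota> k * a) = k" by simp_all
    then show ?thesis by (simp only: \<sigma>_def)
  qed
  have prod: "(\<iota> m + \<iota> k * c) * (\<iota> m' + \<iota> k' * c)
      = \<iota> (m * m' + k * k' * p) + \<iota> (m * k' + k * m' + k * k' * q) * c"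
    if "c * c = \<iota> p + \<iota> q * c" for c m k m' k'
  proof -
    have "(\<iota> m + \<iota> k * c) * (\<iota> m' + \<iota> k' * c)
      = \<iota> m * \<iota> m' + \<iota> m * \<iota> k' * c + \<iota> k * (c * \<iota> m') + \<iota> k * (c * (\<iota> k' * c))"
      by (simp add: distrib_left distrib_right mult.assoc)
    also have "\<dots> = \<iota> m * \<iota> m' + \<iota> m * \<iota> k' * c + \<iota> k * (\<iota> m' * c) + \<iota> k * (\<iota> k' * (c * c))"
      by (simp only: comm[of c "\<iota> m'"] emb_left_commute[of c])
    also have "\<dots> = \<iota> (m * m' + k * k' * p) + \<iota> (m * k' + k * m' + k * k' * q) * c"
      by (simp only: that emb_add emb_mult distrib_left distrib_right mult.assoc add_ac)
    finally show ?thesis .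
  qed
  have add: "\<sigma> (x + y) = \<sigma> x + \<sigma> y" for x y
  proof -
    have "x + y = \<iota> (r x + r y) + \<iota> (s x + s y) * a"
      using arg_cong2[OF rs[of x] rs[of y], of "(+)"] by (simp add: emb_add distrib_right add_ac)
    then have "\<sigma> (x + y) = \<iota> (r x + r y) + \<iota> (s x + s y) * ?b" by (simp only: sv)
    then show ?thesis unfolding \<sigma>_def by (simp add: emb_add distrib_right)
  qed
  have mult: "\<sigma> (x * y) = \<sigma> x * \<sigma> y" for x y
  proof -
    have "x * y = (\<iota> (r x) + \<iota> (s x) * a) * (\<iota> (r y) + \<iota> (s y) * a)"
      by (rule arg_cong2[OF rs[of x] rs[of y]])
    then have "\<sigma> (x * y) = \<iota> (r x * r y + s x * s y * p) + \<iota> (r x * s y + s x * r y + s x * s y * q) * ?b"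
      by (simp only: prod[OF a(2)] sv)
    then show ?thesis unfolding \<sigma>_def by (simp only: prod[OF b2])
  qed
  have sq: "\<sigma> (\<iota> k) = \<iota> k" for k using sv[of k 0] by simp
  have sb: "\<sigma> a = ?b" using sv[of 0 1] by simp
  have "\<sigma> (\<sigma> x) = x" for x
  proof -
    have "\<sigma> ?b + \<sigma> a = \<sigma> (\<iota> q)" by (simp flip: add)
    then have "\<sigma> ?b = a" by (simp add: sq sb algebra_simps)
    then have "\<sigma> (\<sigma> x) = \<iota> (r x) + \<iota> (s x) * a"
      unfolding \<sigma>_def[of x] by (simp only: add mult sq)
    then show ?thesis using rs[of x] by simp
  qed
  then have "bij \<sigma>" by (rule involuntory_imp_bij)
  then have "\<sigma> \<in> algebra_auts \<iota>" unfolding algebra_auts_def using add mult sq by blast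
  moreover have "\<sigma> a \<noteq> a" unfolding sb using a(3) by (metis diff_eq_eq)
  ultimately show ?thesis by (metis id_apply)
qed


section \<open>Conjugation on a quaternion algebra\<close>

text \<open>
  If \<open>1, x, x x\<close> are independent, the double centralizer \<open>K\<close> of \<open>x\<close>, a subfield, has dimension at least 3; as
  \<open>K \<oplus> K y \<subseteq> D\<close> for \<open>y \<notin> K\<close>, it is all of \<open>D\<close>, so that \<open>x\<close> is central.
\<close>

lemma type_iii_quadratic:
  assumes iii: "quadratic_type_iii \<iota>" and x: "x \<notin> range \<iota>"
  shows "\<exists>t. x * x - \<iota> t * x \<in> range \<iota>"
proof (rule ccontr)
  assume no: "\<not> ?thesis"
  have deg: "degree_over \<iota> = 4" and center: "center = range \<iota>"
    using iii unfolding quadratic_type_iii_def quaternion_algebra_def by auto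
  let ?K = "{y. \<forall>z. z * x = x * z \<longrightarrow> y * z = z * y}"
  have K: "D.subspace ?K"
    unfolding D.subspace_def scaleD_def
    by (auto simp: distrib_left distrib_right mult.assoc emb_left_commute)
  have Kmult: "y * z \<in> ?K" if y: "y \<in> ?K" and z: "z \<in> ?K" for y z
  proof (intro CollectI allI impI)
    fix w assume w: "w * x = x * w"
    have "y * z * w = y * (w * z)" using z w by (simp add: mult.assoc)
    also have "\<dots> = w * y * z" using y w by (simp add: mult.assoc[symmetric])
    finally show "y * z * w = w * (y * z)" by (simp add: mult.assoc)
  qed
  have Kinv: "inverse y \<in> ?K" if "y \<in> ?K" for y
    using that by (auto intro!: commute_inverse)
  have "x * x \<notin> D.span {x, 1}" using no unfolding in_D_span_insert D_span_1 by blast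
  then have ind: "\<not> D.dependent {x * x, x, 1}"
    by (intro D.independent_insertI independent_1_insert x)
  have "x * x \<notin> {x, 1}" using \<open>x * x \<notin> D.span {x, 1}\<close> D.span_base[of "x * x" "{x, 1}"] by blast
  moreover have "x \<noteq> 1" using x zero_one_range_emb by blast
  ultimately have card: "card {x * x, x, 1} = 3" by simp
  have xK: "x \<in> ?K" by simp
  then have "{x * x, x, 1} \<subseteq> ?K" using Kmult[OF xK xK] by simp
  then have dimK: "D.dim ?K \<ge> 3"
    using D.independent_card_le_fin_dim[OF D_fin_dim K ind] card by simp
  have "?K = UNIV"
  proof (rule ccontr)
    assume "?K \<noteq> UNIV"
    then obtain y where y: "y \<notin> ?K" by blast
    have "s = 0" if s: "s \<in> ?K" "s * y \<in> ?K" for s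
    proof (rule ccontr)
      assume "s \<noteq> 0"
      have "inverse s * (s * y) \<in> ?K" by (rule Kmult[OF Kinv[OF s(1)] s(2)])
      then show False using y \<open>s \<noteq> 0\<close> by (simp add: mult.assoc[symmetric])
    qed
    moreover have "y \<noteq> 0" using y D.subspace_0[OF K] by blast
    ultimately have *: "D.subspace {s + s' * y |s s'. s \<in> ?K \<and> s' \<in> ?K}"
      "D.dim {s + s' * y |s s'. s \<in> ?K \<and> s' \<in> ?K} = 2 * D.dim ?K"
      using dim_sum_multiples[OF K] by blast+
    have "D.dim {s + s' * y |s s'. s \<in> ?K \<and> s' \<in> ?K} \<le> D.dim (UNIV :: 'd set)"
      by (rule D.dim_mono_fin_dim[OF D_fin_dim D.subspace_UNIV *(1) subset_UNIV])
    then show False using *(2) dimK deg degree_eq by simp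
  qed
  then have "y \<in> ?K" for y by (simp only: UNIV_I)
  then have "y * x = x * y" for y by blast
  then have "x \<in> center" unfolding center_def by simp
  then show False using x center by simp
qed

text \<open>If the three quadratic expressions on the left are scalars, so is the right-hand side,
  which is \<open>\<iota> s * (x * y + y * x)\<close> up to a scalar combination of \<open>x\<close>
  and \<open>y\<close>.\<close>

lemma quadratic_polarization:
  "((x + \<iota> s * y) * (x + \<iota> s * y) - \<iota> t * (x + \<iota> s * y)) - (x * x - \<iota> k * x)
    - \<iota> s * \<iota> s * (y * y - \<iota> m * y)
    = \<iota> s * (x * y + y * x) - \<iota> (t - k) * x - \<iota> (s * t - s * s * m) * y"
proof -
  have "(x + \<iota> s * y) * (x + \<iota> s * y)
      = x * x + \<iota> s * (x * y + y * x) + \<iota> s * (\<iota> s * (y * y))"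
    by (simp add: distrib_left distrib_right mult.assoc emb_left_commute[of x] emb_left_commute[of y] add_ac)
  moreover have "\<iota> t * (\<iota> s * y) = \<iota> s * (\<iota> t * y)" by (rule emb_left_commute)
  ultimately show ?thesis
    by (simp only: emb_diff emb_mult distrib_left[of "\<iota> t"] left_diff_distrib right_diff_distrib mult.assoc) simp
qed

text \<open>Eliminates \<open>z = x * y + y * x\<close> between the polarizations at
  \<open>s = 1\<close> and \<open>s = a\<close>.\<close>

lemma elimination_identity:
  "\<iota> a * (z - \<iota> p * x - \<iota> q * y) - (\<iota> a * z - \<iota> r * x - \<iota> w * y)
    = \<iota> (r - a * p) * x + \<iota> (w - a * q) * y"
  by (simp only: emb_diff emb_mult left_diff_distrib right_diff_distrib mult.assoc) simp

text \<open>\<open>T\<close> is the reduced trace: \<open>2 x\<close> on \<open>F\<close>, and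
  otherwise the unique \<open>t\<close> with \<open>x^2 - t x\<close> in \<open>F\<close>; then
  \<open>\<sigma> x = T x - x\<close>. Additivity is the issue: if 1, \<open>x\<close>,
  \<open>y\<close> are independent, the polarizations at \<open>s = 1\<close> and
  \<open>s = a\<close> leave a scalar combination of \<open>x\<close> and \<open>y\<close> that is
  in \<open>F\<close>, so its coefficients vanish.\<close>

lemma type_iii_conjugation:
  assumes iii: "quadratic_type_iii \<iota>" and a: "(a :: 'f) \<noteq> 0" "a \<noteq> 1"
  shows "\<exists>\<sigma>. conjugation \<sigma>"
proof -
  have "\<forall>x. \<exists>t. if x \<in> range \<iota> then \<iota> t = x + x else x * x - \<iota> t * x \<in> range \<iota>"
  proof
    fix x
    show "\<exists>t. if x \<in> range \<iota> then \<iota> t = x + x else x * x - \<iota> t * x \<in> range \<iota>"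
    proof (cases "x \<in> range \<iota>")
      case True
      then obtain c where "x = \<iota> c" by blast
      then have "\<iota> (c + c) = x + x" by (simp only: emb_add)
      then show ?thesis using True by auto
    next
      case False
      then show ?thesis using type_iii_quadratic[OF iii False] by simp
    qed
  qed
  then obtain T where "\<forall>x. if x \<in> range \<iota> then \<iota> (T x) = x + x else x * x - \<iota> (T x) * x \<in> range \<iota>"
    by (rule choice[THEN exE])
  then have T: "\<And>x. x \<in> range \<iota> \<Longrightarrow> \<iota> (T x) = x + x"
      "\<And>x. x \<notin> range \<iota> \<Longrightarrow> x * x - \<iota> (T x) * x \<in> range \<iota>"
    by (auto split: if_splits)
  have Tunique: "T x = t" if x: "x \<notin> range \<iota>" and t: "x * x - \<iota> t * x \<in> range \<iota>" for x t
  proof (rule ccontr)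
    assume "T x \<noteq> t"
    have "(x * x - \<iota> t * x) - (x * x - \<iota> (T x) * x) \<in> range \<iota>"
      by (rule range_emb_closed(2)[OF t T(2)[OF x]])
    also have "(x * x - \<iota> t * x) - (x * x - \<iota> (T x) * x) = \<iota> (T x - t) * x"
      by (simp add: emb_diff left_diff_distrib)
    finally show False
      using range_emb_cancel[of "\<iota> (T x - t)" x] x \<open>T x \<noteq> t\<close> by simp
  qed
  have Temb: "T (\<iota> c) = c + c" for c
    using T(1)[of "\<iota> c"] by (simp flip: emb_add)
  \<comment> \<open>This covers additivity for dependent 1, \<open>x\<close>, \<open>y\<close>, and
    homogeneity.\<close>
  have affine: "T (\<iota> c + \<iota> s * x) = c + c + s * T x" for c s x
  proof (cases "x \<in> range \<iota> \<or> s = 0")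
    case True
    then show ?thesis
    proof
      assume "x \<in> range \<iota>"
      then obtain k where k: "x = \<iota> k" by blast
      show ?thesis
        unfolding k by (simp only: emb_add[symmetric] emb_mult[symmetric] Temb distrib_left add_ac)
    qed (simp add: Temb)
  next
    case False
    let ?y = "\<iota> c + \<iota> s * x"
    have y: "?y \<notin> range \<iota>"
    proof
      assume "?y \<in> range \<iota>"
      then have "?y - \<iota> c \<in> range \<iota>" by (intro range_emb_closed(2) rangeI)
      then show False using range_emb_cancel[of "\<iota> s" x] False by simp
    qed
    have "?y * ?y - \<iota> (c + c + s * T x) * ?y
      = \<iota> s * \<iota> s * (x * x - \<iota> (T x) * x) - \<iota> c * \<iota> c - \<iota> c * (\<iota> s * \<iota> (T x))"
    proof -
      have e: "x * \<iota> c = \<iota> c * x" "\<iota> s * \<iota> c = \<iota> c * \<iota> s" "\<iota> (T x) * \<iota> c = \<iota> c * \<iota> (T x)"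
        "\<iota> (T x) * \<iota> s = \<iota> s * \<iota> (T x)" "x * \<iota> s = \<iota> s * x"
        by (rule emb_commute[symmetric])+
      have e': "x * (\<iota> k * z) = \<iota> k * (x * z)" for k z by (rule emb_left_commute)
      have e'': "\<iota> s * (\<iota> c * z) = \<iota> c * (\<iota> s * z)" "\<iota> (T x) * (\<iota> c * z) = \<iota> c * (\<iota> (T x) * z)"
          "\<iota> (T x) * (\<iota> s * z) = \<iota> s * (\<iota> (T x) * z)" for z
        by (rule emb_left_commute)+
      show ?thesis
        by (simp only: emb_add emb_mult)
          (simp add: distrib_left distrib_right left_diff_distrib right_diff_distrib mult.assoc e e' e'')
    qed
    also have "\<dots> \<in> range \<iota>"
      by (intro range_emb_closed(1-3) T(2) rangeI) (use False in blast)
    finally show ?thesis by (rule Tunique[OF y])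
  qed
  have add: "T (x + y) = T x + T y" for x y
  proof (cases "x \<in> range \<iota> \<or> y \<in> D.span {x, 1}")
    case True
    then show ?thesis
    proof
      assume "x \<in> range \<iota>"
      then obtain c where "x = \<iota> c" by blast
      then show ?thesis using affine[of c 1 y] Temb by simp
    next
      assume "y \<in> D.span {x, 1}"
      then obtain s c where "y - \<iota> s * x = \<iota> c" unfolding in_D_span_insert D_span_1 by blast
      then have y: "y = \<iota> c + \<iota> s * x" by (simp add: diff_eq_eq)
      have xy: "x + y = \<iota> c + \<iota> (1 + s) * x" by (simp add: y emb_add distrib_right)
      show ?thesis unfolding xy affine unfolding y affine by (simp add: algebra_simps)
    qed
  next
    case False
    have ind: "p = 0 \<and> q = 0" if pq: "\<iota> p * x + \<iota> q * y \<in> range \<iota>" for p q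
    proof -
      have q: "q = 0"
      proof (rule ccontr)
        assume "q \<noteq> 0"
        have "scaleD \<iota> (inverse q) (\<iota> p * x + \<iota> q * y) \<in> D.span {x, 1}"
          using pq D.span_mono[of "{1}" "{x, 1}"] by (intro D.span_scale) (auto simp: D_span_1)
        also have "scaleD \<iota> (inverse q) (\<iota> p * x + \<iota> q * y) = scaleD \<iota> (inverse q * p) x + y"
          using \<open>q \<noteq> 0\<close> by (simp add: scaleD_def distrib_left mult.assoc[symmetric] emb_mult[symmetric])
        finally have "y \<in> D.span {x, 1}"
          using D.span_add_eq[OF D.span_scale[OF D.span_base[of x "{x, 1}"]]] by simp
        then show False using False by blast
      qed
      then show ?thesis using pq range_emb_cancel[of "\<iota> p" x] False by auto
    qed
    have nr: "x + \<iota> s * y \<notin> range \<iota>" for s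
      using ind[of 1 s] by auto
    have x: "x \<notin> range \<iota>" using False by blast
    have y: "y \<notin> range \<iota>" using False D.span_mono[of "{1}" "{x, 1}"] by (auto simp: D_span_1)
    have key: "\<iota> s * (x * y + y * x) - \<iota> (T (x + \<iota> s * y) - T x) * x
        - \<iota> (s * T (x + \<iota> s * y) - s * s * T y) * y \<in> range \<iota>" for s
    proof -
      let ?w = "x + \<iota> s * y"
      have "(?w * ?w - \<iota> (T ?w) * ?w) - (x * x - \<iota> (T x) * x)
        - \<iota> s * \<iota> s * (y * y - \<iota> (T y) * y) \<in> range \<iota>"
        by (intro range_emb_closed(2,3) T(2) nr x y rangeI)
      also have "(?w * ?w - \<iota> (T ?w) * ?w) - (x * x - \<iota> (T x) * x)
        - \<iota> s * \<iota> s * (y * y - \<iota> (T y) * y) =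
        \<iota> s * (x * y + y * x) - \<iota> (T ?w - T x) * x - \<iota> (s * T ?w - s * s * T y) * y"
        by (rule quadratic_polarization)
      finally show ?thesis .
    qed
    let ?t = "T (x + y)" and ?u = "T (x + \<iota> a * y)"
    let ?z = "x * y + y * x"
    have k1: "?z - \<iota> (?t - T x) * x - \<iota> (?t - T y) * y \<in> range \<iota>"
      using key[of 1] by simp
    have "\<iota> a * (?z - \<iota> (?t - T x) * x - \<iota> (?t - T y) * y)
        - (\<iota> a * ?z - \<iota> (?u - T x) * x - \<iota> (a * ?u - a * a * T y) * y) \<in> range \<iota>"
      by (rule range_emb_closed(2)[OF range_emb_closed(3)[OF rangeI k1] key[of a]])
    then have k2: "\<iota> ((?u - T x) - a * (?t - T x)) * x + \<iota> ((a * ?u - a * a * T y) - a * (?t - T y)) * y \<in> range \<iota>"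
      unfolding elimination_identity .
    have "(?u - T x) - a * (?t - T x) = 0" and "(a * ?u - a * a * T y) - a * (?t - T y) = 0"
      using ind[OF k2] by blast+
    then show ?thesis using a by (rule trace_additivity)
  qed
  define \<sigma> where "\<sigma> x = \<iota> (T x) - x" for x
  have "conjugation \<sigma>"
    unfolding conjugation_def
  proof (intro conjI allI)
    show "\<sigma> (x + y) = \<sigma> x + \<sigma> y" for x y by (simp add: \<sigma>_def add emb_add)
    show "\<sigma> (\<iota> s * x) = \<iota> s * \<sigma> x" for s x
      using affine[of 0 s x] by (simp add: \<sigma>_def emb_mult right_diff_distrib)
    show "\<sigma> 1 = 1" unfolding \<sigma>_def using T(1)[of 1] zero_one_range_emb(2) by simp
    show "x * \<sigma> x \<in> range \<iota>" for x
    proof (cases "x \<in> range \<iota>")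
      case True
      then show ?thesis unfolding \<sigma>_def by (intro range_emb_closed(2,3) rangeI)
    next
      case False
      have "x * \<sigma> x = - (x * x - \<iota> (T x) * x)"
        using emb_commute[of "T x" x] by (simp add: \<sigma>_def right_diff_distrib)
      then show ?thesis using range_emb_closed(4)[OF T(2)[OF False] rangeI] by simp
    qed
  qed
  then show ?thesis by blast
qed

section \<open>Trace forms and the existence of associated pairs\<close>

lemma trace_form:
  assumes "conjugation \<sigma>"
  shows "\<exists>e. Vector_Spaces.linear (scaleD \<iota>) (*) e \<and> (\<forall>x. \<iota> (e x) = x + \<sigma> x)"
proof -
  interpret conj_ext \<iota> \<sigma> by unfold_locales (rule assms)
  define e where "e x = (SOME c. \<iota> c = x + \<sigma> x)" for x
  have "\<iota> (e x) = x + \<sigma> x" for x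
  proof -
    obtain c where "x + \<sigma> x = \<iota> c" using trace_in_range[of x] by (rule rangeE)
    then have "\<iota> c = x + \<sigma> x" by (rule sym)
    then show ?thesis unfolding e_def by (rule someI)
  qed
  note e = this
  have "Vector_Spaces.linear (scaleD \<iota>) (*) e"
  proof (rule linear_formI)
    show "e (x + y) = e x + e y" for x y
    proof -
      have "\<iota> (e (x + y)) = \<iota> (e x + e y)" by (simp only: e emb_add sigma_add add_ac)
      then show ?thesis by simp
    qed
    show "e (\<iota> a * x) = a * e x" for a x
    proof -
      have "\<iota> (e (\<iota> a * x)) = \<iota> (a * e x)" by (simp only: e emb_mult sigma_scale distrib_left)
      then show ?thesis by simp
    qed
  qed
  then show ?thesis using e by blast
qed

lemma quaternion_conjugationI:
  assumes "conjugation \<sigma>"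
  shows "quaternion_conjugation \<iota> \<sigma>"
proof -
  interpret conj_ext \<iota> \<sigma> by unfold_locales (rule assms)
  have "Vector_Spaces.linear (scaleD \<iota>) (scaleD \<iota>) \<sigma>"
    by unfold_locales (auto simp: scaleD_def sigma_add sigma_scale)
  then show ?thesis
    unfolding quaternion_conjugation_def using sigma_mult trace_in_range norm_in_range by simp
qed

lemma conjugation_if_quaternion_conjugation:
  assumes "quaternion_conjugation \<iota> \<sigma>"
  shows "conjugation \<sigma>"
proof -
  interpret s: Vector_Spaces.linear "scaleD \<iota>" "scaleD \<iota>" \<sigma>
    using assms unfolding quaternion_conjugation_def by blast
  have inv: "\<sigma> (\<sigma> x) = x" and mult: "\<sigma> (x * y) = \<sigma> y * \<sigma> x" for x y
    using assms unfolding quaternion_conjugation_def by auto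
  have "\<sigma> 1 = 1"
    using mult[of 1 "\<sigma> 1"] inv[of 1] by simp
  then show ?thesis
    using assms s.scale unfolding conjugation_def quaternion_conjugation_def
    by (simp add: s.add scaleD_def)
qed

text \<open>If all traces vanish, the trace of 1 gives characteristic 2 and \<open>\<sigma>\<close>
  is the identity; as an antiautomorphism it forces commutativity, against centre \<open>F\<close>
  and degree 4.\<close>

lemma trace_form_nonzero_iii:
  assumes "quadratic_type_iii \<iota>" "conjugation \<sigma>" "\<And>x. \<iota> (e x) = x + \<sigma> x"
  shows "\<exists>x. e x \<noteq> 0"
proof (rule ccontr)
  interpret conj_ext \<iota> \<sigma> by unfold_locales (rule assms)
  assume "\<not> ?thesis"
  then have s: "x + \<sigma> x = 0" for x using assms(3)[of x] by simp
  then have "(1 + 1 :: 'd) = 0" using s[of 1] by simp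
  then have "x + x = 0" for x :: 'd
    using distrib_right[of 1 1 x] by simp
  then have id: "\<sigma> x = x" for x using s by (metis add_left_cancel)
  have "x * y = y * x" for x y :: 'd
    using sigma_mult[of x y] by (simp only: id)
  then have "center = (UNIV :: 'd set)" unfolding center_def by blast
  then have "range \<iota> = UNIV"
    using assms(1) unfolding quadratic_type_iii_def quaternion_algebra_def by simp
  then show False
    using assms(1) degree_eq_1_iff unfolding quadratic_type_iii_def by simp
qed

lemma trace_form_nonzero_ii:
  assumes "quadratic_type_ii \<iota>" "conjugation \<sigma>" "\<sigma> \<noteq> id" "\<And>x. \<iota> (e x) = x + \<sigma> x"
  shows "\<exists>x. e x \<noteq> 0"
proof (rule ccontr)
  interpret conj_ext \<iota> \<sigma> by unfold_locales (rule assms)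
  assume "\<not> ?thesis"
  then have s: "x + \<sigma> x = 0" for x using assms(4)[of x] by simp
  then have "(1 + 1 :: 'd) = 0" using s[of 1] by simp
  then have "x + x = 0" for x :: 'd
    using distrib_right[of 1 1 x] by simp
  then have "\<sigma> x = x" for x using s by (metis add_left_cancel)
  then show False using assms(3) by (simp add: fun_eq_iff)
qed

lemma galois_trace_ii:
  assumes "quadratic_type_ii \<iota>" "\<sigma> \<in> algebra_auts \<iota>" "\<sigma> \<noteq> id"
  shows "galois_trace \<iota> e \<longleftrightarrow> (\<forall>x. \<iota> (e x) = x + \<sigma> x)"
  using assms(3) unfolding galois_trace_def type_ii_aut(1)[OF assms] by auto

lemma galois_trace_i:
  assumes "quadratic_type_i \<iota>"
  shows "galois_trace \<iota> e \<longleftrightarrow> (\<forall>x. \<iota> (e x) = x)"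
  unfolding galois_trace_def algebra_auts_type_i[OF assms] by simp

lemma exists_associated_pair:
  assumes "quadratic_type \<iota>"
    and big: "quadratic_type_iii \<iota> \<Longrightarrow> \<exists>a :: 'f. a \<noteq> 0 \<and> a \<noteq> 1"
  shows "\<exists>\<sigma> e. associated_pair \<iota> \<sigma> e"
proof -
  \<comment> \<open>\<open>associated_pair\<close> imposes the requirement of every type that
    applies. So case iv excludes the other types before choosing \<open>e\<close>, and the other
    cases check that \<open>e\<close> is nonzero against an overlap with type iv.\<close>
  consider (i) "quadratic_type_i \<iota>" | (ii) "quadratic_type_ii \<iota>" | (iii) "quadratic_type_iii \<iota>"
    | (iv) "quadratic_type_iv \<iota>" "\<not> quadratic_type_i \<iota>" "\<not> quadratic_type_ii \<iota>" "\<not> quadratic_type_iii \<iota>"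
    using assms(1) unfolding quadratic_type_def by blast
  then show ?thesis
  proof cases
    case i
    then have R: "range \<iota> = UNIV" using degree_eq_1_iff unfolding quadratic_type_i_def by blast
    then have e: "\<iota> (inv \<iota> x) = x" for x by (rule surj_f_inv_f)
    have "Vector_Spaces.linear (scaleD \<iota>) (*) (inv \<iota>)"
    proof (rule linear_formI)
      show "inv \<iota> (x + y) = inv \<iota> x + inv \<iota> y" for x y
        using e by (simp flip: emb_eq_iff add: emb_add)
      show "inv \<iota> (\<iota> a * x) = a * inv \<iota> x" for a x
        using e by (simp flip: emb_eq_iff add: emb_mult)
    qed
    moreover have "inv \<iota> 1 \<noteq> 0" using e[of 1] emb_zero by (metis zero_neq_one)
    moreover have "\<not> quadratic_type_iii \<iota>"
      using i unfolding quadratic_type_i_def quadratic_type_iii_def by simp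
    ultimately have "associated_pair \<iota> id (inv \<iota>)"
      unfolding associated_pair_def standard_involution_def galois_trace_i[OF i]
      using i e by blast
    then show ?thesis by blast
  next
    case ii
    obtain \<sigma> where s: "\<sigma> \<in> algebra_auts \<iota>" "\<sigma> \<noteq> id" using type_ii_aut_exists[OF ii] by blast
    note c = type_ii_aut(2)[OF ii s]
    obtain e where e: "Vector_Spaces.linear (scaleD \<iota>) (*) e" "\<And>x. \<iota> (e x) = x + \<sigma> x"
      using trace_form[OF c] by blast
    have "\<exists>x. e x \<noteq> 0" by (rule trace_form_nonzero_ii[OF ii c s(2) e(2)])
    moreover have "\<not> quadratic_type_iii \<iota>"
      using ii unfolding quadratic_type_ii_def quadratic_type_iii_def by simp
    ultimately have "associated_pair \<iota> \<sigma> e"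
      unfolding associated_pair_def standard_involution_def galois_trace_ii[OF ii s]
      using ii s e by blast
    then show ?thesis by blast
  next
    case iii
    obtain a :: 'f where "a \<noteq> 0" "a \<noteq> 1" using big[OF iii] by blast
    then obtain \<sigma> where c: "conjugation \<sigma>" using type_iii_conjugation[OF iii] by blast
    obtain e where e: "Vector_Spaces.linear (scaleD \<iota>) (*) e" "\<And>x. \<iota> (e x) = x + \<sigma> x"
      using trace_form[OF c] by blast
    have "\<exists>x. e x \<noteq> 0" by (rule trace_form_nonzero_iii[OF iii c e(2)])
    moreover have "\<not> quadratic_type_i \<iota>" "\<not> quadratic_type_ii \<iota>"
      using iii unfolding quadratic_type_i_def quadratic_type_ii_def quadratic_type_iii_def by simp_all
    ultimately have "associated_pair \<iota> \<sigma> e"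
      unfolding associated_pair_def standard_involution_def
      using iii quaternion_conjugationI[OF c] e by blast
    then show ?thesis by blast
  next
    case iv
    from DF.linear_independent_extend[OF independent_1, of "\<lambda>_. 1"]
    obtain e where "Vector_Spaces.linear (scaleD \<iota>) (*) e" "e 1 = 1" by auto
    then have "associated_pair \<iota> id e"
      unfolding associated_pair_def standard_involution_def using iv by (metis zero_neq_one)
    then show ?thesis by blast
  qed
qed

text \<open>The interface to the four types. Types i and iv share \<open>\<sigma> = id\<close> with
  squares in \<open>F\<close>, so \<open>q * c * q\<close> is a scalar multiple of \<open>c\<close>;
  types ii and iii share \<open>\<iota> (e x) = x + \<sigma> x\<close>, where
  \<open>q * (c + \<sigma> c) * \<sigma> q\<close> vanishes with the trace of
  \<open>c\<close>.\<close>

lemma associated_pairD: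
  assumes "associated_pair \<iota> \<sigma> e"
  shows "conjugation \<sigma>" and "Vector_Spaces.linear (scaleD \<iota>) (*) e" and "\<exists>x. e x \<noteq> 0"
    and "e (x * y) = e (y * x)" and "e (\<sigma> x) = e x" and "e c = 0 \<Longrightarrow> e (q * c * \<sigma> q) = 0"
proof -
  show lin: "Vector_Spaces.linear (scaleD \<iota>) (*) e"
    using assms unfolding associated_pair_def by blast
  note e = linear_formD[OF lin]
  have *: "conjugation \<sigma> \<and> (\<exists>x. e x \<noteq> 0) \<and> (\<forall>x y. e (x * y) = e (y * x)) \<and> (\<forall>x. e (\<sigma> x) = e x)
    \<and> (\<forall>c q. e c = 0 \<longrightarrow> e (q * c * \<sigma> q) = 0)"
  proof -
    have radicial: ?thesis if sid: "\<sigma> = id" and nz: "\<exists>x. e x \<noteq> 0"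
      and comm: "\<And>x y :: 'd. x * y = y * x" and sq: "\<And>x. x * x \<in> range \<iota>"
    proof -
      have "e (q * c * \<sigma> q) = 0" if "e c = 0" for c q
      proof -
        obtain k where k: "q * q = \<iota> k" using sq by blast
        have "q * c * q = \<iota> k * c" using comm[of "q * c" q] by (simp add: mult.assoc[symmetric] k)
        then show ?thesis using that e(2) sid by simp
      qed
      then show ?thesis
        using conjugation_id_commutative[OF sq] nz comm sid by auto
    qed
    have separable: ?thesis if c: "conjugation \<sigma>" and nz: "\<exists>x. e x \<noteq> 0" and ex: "\<And>x. \<iota> (e x) = x + \<sigma> x"
    proof -
      interpret conj_ext \<iota> \<sigma> by unfold_locales (rule c)
      have "e (x * y) = e (y * x)" for x y
        using trace_mult_commute[of x y] unfolding ex[symmetric] by simp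
      moreover have "e (\<sigma> x) = e x" for x
      proof -
        have "\<iota> (e (\<sigma> x)) = \<iota> (e x)" unfolding ex by (simp add: add.commute)
        then show ?thesis by simp
      qed
      moreover have "e (q * c * \<sigma> q) = 0" if "e c = 0" for c q
      proof -
        have "\<iota> (e (q * c * \<sigma> q)) = q * (c + \<sigma> c) * \<sigma> q"
          unfolding ex by (simp add: sigma_mult distrib_left distrib_right mult.assoc)
        also have "c + \<sigma> c = 0" using ex[of c] that by simp
        finally show ?thesis by simp
      qed
      ultimately show ?thesis using c nz by blast
    qed
    from assms consider (i) "quadratic_type_i \<iota>" "\<sigma> = id" "galois_trace \<iota> e"
      | (ii) "quadratic_type_ii \<iota>" "\<sigma> \<in> algebra_auts \<iota>" "\<sigma> \<noteq> id" "galois_trace \<iota> e"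
      | (iii) "quadratic_type_iii \<iota>" "quaternion_conjugation \<iota> \<sigma>" "\<And>x. \<iota> (e x) = x + \<sigma> x"
      | (iv) "quadratic_type_iv \<iota>" "\<sigma> = id" "\<exists>x. e x \<noteq> 0"
      unfolding associated_pair_def standard_involution_def by blast
    then show ?thesis
    proof cases
      case i
      have R: "range \<iota> = UNIV"
        using i(1) degree_eq_1_iff unfolding quadratic_type_i_def by blast
      have comm: "x * y = y * x" for x y :: 'd by (rule range_emb_commute) (simp add: R)
      have "\<iota> (e 1) = 1" using i(3) unfolding galois_trace_i[OF i(1)] by blast
      then have "e 1 \<noteq> 0" using emb_zero by force
      then show ?thesis by (intro radicial i(2) comm) (auto simp: R)
    next
      case ii
      note c = type_ii_aut(2)[OF ii(1-3)]
      have ex: "\<iota> (e x) = x + \<sigma> x" for x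
        using ii(4) unfolding galois_trace_ii[OF ii(1-3)] by blast
      show ?thesis by (rule separable[OF c trace_form_nonzero_ii[OF ii(1) c ii(3) ex] ex])
    next
      case iii
      note c = conjugation_if_quaternion_conjugation[OF iii(2)]
      show ?thesis by (rule separable[OF c trace_form_nonzero_iii[OF iii(1) c iii(3)] iii(3)])
    next
      case iv
      then have h: "hyper_radicial \<iota>" unfolding quadratic_type_iv_def by blast
      show ?thesis
        by (rule radicial[OF iv(2,3)])
          (use h in \<open>auto simp: hyper_radicial_def commutative_ring_def power2_eq_square\<close>)
    qed
  qed
  show "conjugation \<sigma>" "\<exists>x. e x \<noteq> 0" "e (x * y) = e (y * x)" "e (\<sigma> x) = e x"
    "e c = 0 \<Longrightarrow> e (q * c * \<sigma> q) = 0"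
    using * by blast+
qed

end


section \<open>Sesquilinear representation\<close>

context form_ext
begin

text \<open>Subtracting the scalar \<open>?k\<close> from \<open>c\<close> makes
  \<open>b x (act x ?c) = 0\<close>, so that \<open>act x ?c\<close> is a value \<open>u x\<close>;
  the claim is \<open>b z (u z) = 0\<close> at \<open>z = act x \<alpha>\<close>, where
  \<open>u z = act x (?c * \<alpha>)\<close>.\<close>

lemma transitive_self_orbit:
  assumes "transitive" "x \<noteq> 0"
  shows "b (act x \<alpha>) (act x (c * \<alpha>)) = b (act x \<alpha>) (act x \<alpha>) / b x x * b x (act x c)"
proof -
  let ?k = "b x (act x c) / b x x"
  let ?c = "c - \<iota> ?k"
  have "b x (act x ?c) = 0" using assms(2) by (simp add: act_diff_right)
  then obtain u where u: "u \<in> \<A> act b" "u x = act x ?c"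
    using assms unfolding transitive_def by blast
  have "u \<in> End\<^sub>D act" using u(1) \<A>_sub_End by blast
  then have "u (act x \<alpha>) = act x (?c * \<alpha>)" by (simp only: EndD u(2) act_act)
  then have "b (act x \<alpha>) (act x (?c * \<alpha>)) = 0" using \<A>_self[OF u(1), of "act x \<alpha>"] by simp
  moreover have "act x (?c * \<alpha>) = act x (c * \<alpha>) - act (act x \<alpha>) (\<iota> ?k)"
    by (simp only: left_diff_distrib act_diff_right act_act emb_commute)
  ultimately show ?thesis by (simp only: b_right) simp
qed

lemma transitive_conjugation:
  assumes "transitive" "x \<noteq> 0"
  shows "\<exists>\<sigma>. conjugation \<sigma> \<and> (\<forall>\<alpha> \<beta>. b (act x \<alpha>) (act x \<beta>) = b x (act x (\<beta> * \<sigma> \<alpha>)))"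
proof -
  \<comment> \<open>Forced by \<open>\<alpha> * \<sigma> \<alpha>\<close> being the ratio of the
    values of \<open>b\<close> at \<open>act x \<alpha>\<close> and at \<open>x\<close>;
    \<open>inverse 0 = 0\<close> makes \<open>\<sigma> 0 = 0\<close>.\<close>
  define \<sigma> where "\<sigma> \<alpha> = inverse \<alpha> * \<iota> (b (act x \<alpha>) (act x \<alpha>) / b x x)" for \<alpha>
  have rep: "b (act x \<alpha>) (act x \<beta>) = b x (act x (\<beta> * \<sigma> \<alpha>))" for \<alpha> \<beta>
  proof (cases "\<alpha> = 0")
    case False
    have "b (act x \<alpha>) (act x \<beta>) = b (act x \<alpha>) (act x (\<beta> * inverse \<alpha> * \<alpha>))"
      using False by (simp add: mult.assoc)
    also have "\<dots> = b (act x \<alpha>) (act x \<alpha>) / b x x * b x (act x (\<beta> * inverse \<alpha>))"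
      by (rule transitive_self_orbit[OF assms])
    also have "\<dots> = b x (act x (\<beta> * \<sigma> \<alpha>))"
      by (simp only: \<sigma>_def mult.assoc[symmetric] act_act[symmetric] b_right)
    finally show ?thesis .
  qed (simp add: \<sigma>_def)
  have nondeg: "c = c'" if "\<And>\<beta>. b x (act x (\<beta> * c)) = b x (act x (\<beta> * c'))" for c c'
  proof (rule ccontr)
    assume "c \<noteq> c'"
    then have 1: "inverse (c - c') * (c - c') = 1" by simp
    have "b x (act x (inverse (c - c') * (c - c'))) = 0"
      by (simp only: right_diff_distrib act_diff_right b_right that) simp
    then show False unfolding 1 using assms(2) by (simp add: act_one)
  qed
  have "conjugation \<sigma>"
    unfolding conjugation_def
  proof (intro conjI allI)
    show "\<sigma> (\<alpha> + \<beta>) = \<sigma> \<alpha> + \<sigma> \<beta>" for \<alpha> \<beta>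
      by (rule nondeg) (simp only: rep[symmetric] act_add_right distrib_left b_left b_right)
    show "\<sigma> (\<iota> a * \<alpha>) = \<iota> a * \<sigma> \<alpha>" for a \<alpha>
    proof (rule nondeg)
      fix \<beta>
      have "b x (act x (\<beta> * \<sigma> (\<iota> a * \<alpha>))) = b (act (act x \<alpha>) (\<iota> a)) (act x \<beta>)"
        by (simp only: rep[symmetric] act_act emb_commute)
      also have "\<dots> = a * b x (act x (\<beta> * \<sigma> \<alpha>))" by (simp only: b_left rep)
      also have "\<dots> = b x (act (act x (\<beta> * \<sigma> \<alpha>)) (\<iota> a))" by (simp only: b_right)
      also have "\<dots> = b x (act x (\<beta> * (\<iota> a * \<sigma> \<alpha>)))"
        by (simp only: act_act emb_commute mult.assoc)
      finally show "b x (act x (\<beta> * \<sigma> (\<iota> a * \<alpha>))) = b x (act x (\<beta> * (\<iota> a * \<sigma> \<alpha>)))" .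
    qed
    show "\<sigma> 1 = 1" using assms(2) by (simp add: \<sigma>_def act_one)
    show "\<alpha> * \<sigma> \<alpha> \<in> range \<iota>" for \<alpha>
      using zero_one_range_emb by (cases "\<alpha> = 0") (simp_all add: \<sigma>_def mult.assoc[symmetric])
  qed
  then show ?thesis using rep by blast
qed

text \<open>If \<open>u x = act y (inverse \<alpha>)\<close>, then \<open>u\<close> sends
  \<open>act x \<alpha>\<close> to \<open>y\<close>. So \<open>perp x\<close> is orthogonal to the
  whole line of \<open>x\<close>.\<close>

lemma transitive_perp:
  assumes "transitive" "x \<noteq> 0" "y \<in> perp x"
  shows "b (act x \<alpha>) y = 0"
proof (cases "\<alpha> = 0")
  case False
  have "b x (act y (inverse \<alpha>)) = 0" using assms(3) unfolding perp_def by blast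
  then obtain u where u: "u \<in> \<A> act b" "u x = act y (inverse \<alpha>)"
    using assms(1,2) unfolding transitive_def by blast
  have "u \<in> End\<^sub>D act" using u(1) \<A>_sub_End by blast
  then have "u (act x \<alpha>) = y" using False by (simp add: EndD u(2) act_act act_one)
  then show ?thesis using \<A>_self[OF u(1), of "act x \<alpha>"] by simp
qed simp

lemma form_representation_unique:
  assumes "associated_pair \<iota> \<sigma> e" "sesquilinear act \<sigma> B" "sesquilinear act \<sigma> C"
    and "\<And>x y. e (B x y) = e (C x y)"
  shows "B = C"
proof (intro ext)
  fix x y
  obtain z where z: "e z \<noteq> 0" using associated_pairD(3)[OF assms(1)] by blast
  have act: "S x (act y l) = S x y * l" if "sesquilinear act \<sigma> S" for S l
  proof -
    have s: "S x (act v \<alpha> + w) = S x v * \<alpha> + S x w" for v w \<alpha>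
      using that unfolding sesquilinear_def by blast
    have "S x 0 = 0" using s[of 0 1 0] by simp
    then show ?thesis using s[of y l 0] by simp
  qed
  show "B x y = C x y"
  proof (rule form_nondegenerate[OF z _ associated_pairD(2)[OF assms(1)]])
    show "e (B x y * l) = e (C x y * l)" for l
      using assms(4)[of x "act y l"] by (simp only: act[OF assms(2)] act[OF assms(3)])
  qed
qed

lemma transitive_imp_representation:
  assumes tr: "transitive" and pair: "associated_pair \<iota> \<sigma> e"
  shows "\<exists>B. sesquilinear act \<sigma> B \<and> (\<forall>x y. b x y = e (B x y))"
proof -
  note e = associated_pairD[OF pair]
  interpret conj_ext \<iota> \<sigma> by unfold_locales (rule e(1))
  obtain z where z: "e z \<noteq> 0" using e(3) by blast
  have "\<forall>p. \<exists>c. \<forall>l. b (fst p) (act (snd p) l) = e (c * l)"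
    using form_representation[OF e(2) z b_act_linear] by blast
  then obtain f where f: "\<forall>p. \<forall>l. b (fst p) (act (snd p) l) = e (f p * l)"
    by (rule choice[THEN exE])
  define B where "B x y = f (x, y)" for x y
  have B: "b x (act y l) = e (B x y * l)" for x y l
    using f[rule_format, of "(x, y)" l] by (simp add: B_def)
  have BI: "B x y = c" if "\<And>l. b x (act y l) = e (c * l)" for x y c
    by (rule form_nondegenerate[OF z _ e(2)]) (simp only: B[symmetric] that)
  have left: "b (act x \<alpha>) (act y l) = e (\<sigma> \<alpha> * B x y * l)" for x y \<alpha> l
  proof (cases "x = 0")
    case True
    have "B 0 y = 0" by (rule BI) (simp add: linear_formD[OF e(2)])
    then show ?thesis using True by (simp add: linear_formD[OF e(2)])
  next
    case False
    obtain \<tau> where t: "conjugation \<tau>" "\<And>\<alpha> \<beta>. b (act x \<alpha>) (act x \<beta>) = b x (act x (\<beta> * \<tau> \<alpha>))"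
      using transitive_conjugation[OF tr False] by blast
    \<comment> \<open>A priori the conjugation depends on \<open>x\<close>; uniqueness identifies it
      with the given \<open>\<sigma>\<close>.\<close>
    have "\<tau> = \<sigma>" by (rule conjugation_unique[OF t(1) e(1)])
    let ?c = "coord x y"
    let ?w = "y - act x ?c"
    have w: "?w \<in> perp x" by (rule minus_coord_in_perp[OF False])
    have "act y l = act x (?c * l) + act ?w l" by (simp add: act_diff_left act_act)
    moreover have "act ?w l \<in> perp x" using w right_subspace_perp unfolding right_subspace_def by blast
    ultimately have "b (act x \<alpha>) (act y l) = b (act x \<alpha>) (act x (?c * l))"
      using transitive_perp[OF tr False, of "act ?w l"] by (simp only: b_right) simp
    also have "\<dots> = b x (act x (?c * (l * \<sigma> \<alpha>)))" by (simp only: t(2) \<open>\<tau> = \<sigma>\<close> mult.assoc)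
    also have "\<dots> = b x (act y (l * \<sigma> \<alpha>))" by (rule coord[OF False, symmetric])
    also have "\<dots> = e ((B x y * l) * \<sigma> \<alpha>)" by (simp only: B mult.assoc)
    \<comment> \<open>Symmetry of the trace form moves \<open>\<sigma> \<alpha>\<close> to the left,
      where sesquilinearity requires it.\<close>
    also have "\<dots> = e (\<sigma> \<alpha> * (B x y * l))" by (rule e(4))
    finally show ?thesis by (simp only: mult.assoc)
  qed
  have "sesquilinear act \<sigma> B"
    unfolding sesquilinear_def
  proof (intro conjI allI)
    show "B (act x \<alpha> + y) z = \<sigma> \<alpha> * B x z + B y z" for \<alpha> x y z
      by (rule BI) (simp only: b_left distrib_right linear_formD(1)[OF e(2)] left[symmetric] B[symmetric])
    show "B z (act x \<alpha> + y) = B z x * \<alpha> + B z y" for \<alpha> x y z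
      by (rule BI)
        (simp only: act_add_left act_act b_right distrib_right mult.assoc linear_formD(1)[OF e(2)] B[symmetric])
  qed
  moreover have "b x y = e (B x y)" for x y
    using B[of x y 1] by (simp add: act_one)
  ultimately show ?thesis by blast
qed

lemma transitive_imp_quadratic_type:
  assumes "transitive" "(UNIV :: 'v set) \<noteq> {0}"
  shows "quadratic_type \<iota>"
proof -
  obtain x :: 'v where "x \<noteq> 0" using assms(2) by blast
  then obtain \<sigma> where "conjugation \<sigma>" using transitive_conjugation[OF assms(1)] by blast
  then interpret conj_ext \<iota> \<sigma> by unfold_locales
  show ?thesis by (rule quadratic_type)
qed

end

section \<open>Attaining the bound from a sesquilinear representation\<close>

locale sesquilinear_ext = form_ext \<iota> act b
  for \<iota> :: "'f::field \<Rightarrow> 'd::division_ring"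
    and act :: "'v::ab_group_add \<Rightarrow> 'd \<Rightarrow> 'v"
    and b :: "'v \<Rightarrow> 'v \<Rightarrow> 'f" +
  fixes \<sigma> :: "'d \<Rightarrow> 'd" and e :: "'d \<Rightarrow> 'f" and B :: "'v \<Rightarrow> 'v \<Rightarrow> 'd"
  assumes pair: "associated_pair \<iota> \<sigma> e" and sesq: "sesquilinear act \<sigma> B"
    and b_eq: "b x y = e (B x y)"
begin

sublocale conj_ext \<iota> \<sigma>
  by unfold_locales (rule associated_pairD(1)[OF pair])

lemmas e_form = linear_formD[OF associated_pairD(2)[OF pair]]

lemma B_left: "B (x + y) z = B x z + B y z" "B (act x \<alpha>) z = \<sigma> \<alpha> * B x z" "B 0 z = 0"
proof -
  have s: "B (act x \<alpha> + y) z = \<sigma> \<alpha> * B x z + B y z" for \<alpha> x y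
    using sesq unfolding sesquilinear_def by blast
  show 0: "B 0 z = 0" using s[of 0 1 0] by simp
  show "B (x + y) z = B x z + B y z" using s[of x 1 y] by (simp add: act_one)
  show "B (act x \<alpha>) z = \<sigma> \<alpha> * B x z" using s[of x \<alpha> 0] 0 by simp
qed

lemma B_right: "B z (x + y) = B z x + B z y" "B z (act x \<alpha>) = B z x * \<alpha>" "B z 0 = 0"
    "B z (x - y) = B z x - B z y"
proof -
  have s: "B z (act x \<alpha> + y) = B z x * \<alpha> + B z y" for \<alpha> x y
    using sesq unfolding sesquilinear_def by blast
  show 0: "B z 0 = 0" using s[of 0 1 0] by simp
  show add: "B z (x + y) = B z x + B z y" for x y using s[of x 1 y] by (simp add: act_one)
  show "B z (act x \<alpha>) = B z x * \<alpha>" using s[of x \<alpha> 0] 0 by simp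
  show "B z (x - y) = B z x - B z y" using add[of "x - y" y] by simp
qed

text \<open>\<open>B z v\<close> is \<open>\<sigma>\<close>-semilinear in \<open>z\<close>, so
  \<open>\<sigma> (B z v)\<close> is \<open>D\<close>-linear in \<open>z\<close>. Applying
  \<open>b z\<close> gives the difference of \<open>e\<close> at two elements exchanged by
  \<open>\<sigma>\<close>, and \<open>e\<close> is invariant under \<open>\<sigma>\<close>.\<close>

lemma skew_map_in_\<A>: "(\<lambda>z. act w (\<sigma> (B z v)) - act v (\<sigma> (B z w))) \<in> \<A> act b" (is "?u \<in> _")
proof -
  have "?u \<in> End\<^sub>D act"
    unfolding End\<^sub>D_def
    by (auto simp: B_left sigma_add sigma_mult act_add_right act_diff_left act_act)
  moreover have "b z (?u z) = 0" for z
  proof -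
    have "e (B z v * \<sigma> (B z w)) = e (\<sigma> (B z v * \<sigma> (B z w)))"
      by (rule associated_pairD(5)[OF pair, symmetric])
    then show ?thesis by (simp add: b_eq B_right e_form sigma_mult)
  qed
  ultimately show ?thesis unfolding \<A>_def by blast
qed

text \<open>Here \<open>b z (?u z) = e (q * c * \<sigma> q)\<close> with
  \<open>q = B z x\<close>.\<close>

lemma rank_one_map_in_\<A>:
  assumes "e c = 0"
  shows "(\<lambda>z. act x (c * \<sigma> (B z x))) \<in> \<A> act b" (is "?u \<in> _")
proof -
  have "?u \<in> End\<^sub>D act"
    unfolding End\<^sub>D_def
    by (auto simp: B_left sigma_add sigma_mult distrib_left act_add_right act_act mult.assoc)
  moreover have "b z (?u z) = 0" for z
    using associated_pairD(6)[OF pair assms, of "B z x"] by (simp add: b_eq B_right mult.assoc)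
  ultimately show ?thesis unfolding \<A>_def by blast
qed

text \<open>\<open>killing K\<close> and \<open>orth K\<close> play the roles of \<open>T\<close>
  and \<open>H\<close> in \<open>dim_le_dim_bound_aux\<close>.\<close>

definition killing :: "'v set \<Rightarrow> ('v \<Rightarrow> 'v) set" where
  "killing K = {u\<in>\<A> act b. \<forall>k\<in>K. u k = 0}"

definition orth :: "'v set \<Rightarrow> 'v set" where
  "orth K = {y. \<forall>k\<in>K. B k y = 0}"

lemma killing_transitive:
  assumes x: "x \<in> orth K" "x \<noteq> 0" and y: "y \<in> orth K" "b x y = 0"
  shows "\<exists>u\<in>killing K. u x = y"
proof -
  let ?q = "B x x"
  have q: "?q \<noteq> 0"
  proof
    assume "?q = 0"
    then have "b x x = 0" by (simp add: b_eq e_form)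
    then show False using x(2) by simp
  qed
  \<comment> \<open>These choices give \<open>B x ?w = 0\<close> and \<open>B x ?v = 1\<close>; so
    \<open>?u1\<close> sends \<open>x\<close> to \<open>?w\<close>, the part of \<open>y\<close>
    orthogonal to \<open>x\<close>, and \<open>?u2\<close> supplies the rest
    \<open>act x ?\<beta>\<close>.\<close>
  let ?\<beta> = "inverse ?q * B x y"
  let ?w = "y - act x ?\<beta>" and ?v = "act x (inverse ?q)"
  let ?c = "?\<beta> * inverse (\<sigma> ?q)"
  let ?u1 = "\<lambda>z. act ?w (\<sigma> (B z ?v)) - act ?v (\<sigma> (B z ?w))"
  let ?u2 = "\<lambda>z. act x (?c * \<sigma> (B z x))"
  \<comment> \<open>\<open>?c\<close> equals
    \<open>inverse ?q * B x y * \<sigma> (inverse ?q)\<close>, and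
    \<open>e (B x y) = b x y = 0\<close>.\<close>
  have "e ?c = 0"
    using associated_pairD(6)[OF pair, of "B x y" "inverse ?q"] y(2) unfolding b_eq sigma_inverse by blast
  then have "?u2 \<in> \<A> act b" by (rule rank_one_map_in_\<A>)
  then have A: "(\<lambda>z. ?u1 z + ?u2 z) \<in> \<A> act b"
    using E.subspace_add[OF \<A>_subspace skew_map_in_\<A>[of ?w ?v]] by (simp add: plus_fun_def)
  have "?u1 k + ?u2 k = 0" if "k \<in> K" for k
    using that x(1) y(1) by (simp add: orth_def B_right)
  moreover have "?u1 x = ?w"
    using q by (simp add: B_right mult.assoc[symmetric] act_one)
  moreover have "?u2 x = act x ?\<beta>"
    using q by (simp add: mult.assoc)
  ultimately show ?thesis
    unfolding killing_def using A by (intro bexI[of _ "\<lambda>z. ?u1 z + ?u2 z"]) simp_all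
qed

lemma transitive: transitive
  unfolding transitive_def
proof (intro allI impI)
  fix x y assume "x \<noteq> 0" "b x y = 0"
  then show "\<exists>u\<in>\<A> act b. u x = y"
    using killing_transitive[of x "{}" y] by (auto simp: killing_def orth_def)
qed

lemma orth_subspace: "V.subspace (orth K)"
  unfolding V.subspace_def orth_def scaleV_def by (auto simp: B_right)

lemma killing_subspace: "E.subspace (killing K)"
  using \<A>_subspace unfolding E.subspace_def killing_def by (auto simp: scaleE_def)

text \<open>The peeling of the upper bound, run from below: the orbit of \<open>x\<close> contains
  the hyperplane \<open>b x y = 0\<close> of \<open>orth K\<close>, and \<open>B x\<close> maps
  \<open>orth K\<close> onto \<open>D\<close>, so adjoining \<open>x\<close> to \<open>K\<close>
  lowers the dimension of \<open>orth K\<close> by the degree.\<close>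

lemma dim_bound_le_dim_killing:
  "dim_bound (degree_over \<iota>) (V.dim (orth K)) \<le> E.dim (killing K)"
proof (induction "V.dim (orth K)" arbitrary: K rule: less_induct)
  case less
  show ?case
  proof (cases "V.dim (orth K) = 0")
    case True
    then show ?thesis by (simp add: dim_bound.simps)
  next
    case False
    have "orth K \<noteq> {0}"
    proof
      assume "orth K = {0}"
      then show False using False V.dim_le_card[of "{0}" "{}"] by simp
    qed
    then obtain x where x: "x \<in> orth K" "x \<noteq> 0"
      using V.subspace_0[OF orth_subspace] by blast
    have kill: "killing K \<subseteq> End\<^sub>D act" using \<A>_sub_End unfolding killing_def by blast
    let ?H = "{y\<in>orth K. b x y = 0}"
    have H: "V.dim (orth K) = V.dim ?H + 1"
      by (rule V.dim_kernel_form[OF b_linear_right orth_subspace V_fin_dim x(1)]) (simp add: x(2))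
    have "?H \<subseteq> (\<lambda>u. u x) ` killing K"
    proof
      fix y assume "y \<in> ?H"
      then obtain u where "u \<in> killing K" "u x = y" using killing_transitive[OF x] by blast
      then show "y \<in> (\<lambda>u. u x) ` killing K" by blast
    qed
    moreover have "V.subspace ?H"
      using orth_subspace[of K] by (auto simp: V.subspace_def scaleV_def)
    moreover have "V.subspace ((\<lambda>u. u x) ` killing K)"
      using module_hom.subspace_image[of "scaleE \<iota> act" "scaleV \<iota> act" "\<lambda>u. u x" "killing K"]
        eval_linear[of x] killing_subspace by (simp add: linear_iff_module_hom)
    ultimately have le: "V.dim ?H \<le> V.dim ((\<lambda>u. u x) ` killing K)"
      by (intro V.dim_mono_fin_dim V_fin_dim)
    have lin: "Vector_Spaces.linear (scaleV \<iota> act) (scaleD \<iota>) (B x)"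
      by unfold_locales (auto simp: B_right scaleV_def scaleD_def emb_commute)
    have "B x ` orth K = UNIV"
    proof -
      have "B x x \<noteq> 0"
      proof
        assume "B x x = 0"
        then have "b x x = 0" by (simp add: b_eq e_form)
        then show False using x(2) by simp
      qed
      then have "c = B x (act x (inverse (B x x) * c))" for c
        by (simp add: B_right mult.assoc[symmetric])
      moreover have "act x c \<in> orth K" for c
        using x(1) by (simp add: orth_def B_right)
      ultimately show ?thesis by blast
    qed
    moreover have "{y\<in>orth K. B x y = 0} = orth (insert x K)"
      unfolding orth_def by blast
    ultimately have orth: "V.dim (orth K) = degree_over \<iota> + V.dim (orth (insert x K))"
      using VD.dim_image_plus_kernel[OF lin orth_subspace V_fin_dim, of K] degree_eq by simp
    then have IH: "dim_bound (degree_over \<iota>) (V.dim (orth (insert x K))) \<le> E.dim (killing (insert x K))"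
      using degree_pos by (intro less) simp
    have "{u\<in>killing K. u x = 0} = killing (insert x K)"
      unfolding killing_def by blast
    then have "E.dim (killing K) = V.dim ((\<lambda>u. u x) ` killing K) + E.dim (killing (insert x K))"
      using EV.dim_image_plus_kernel[OF eval_linear[of x] killing_subspace E_fin_dim[OF kill]] by simp
    moreover have "dim_bound (degree_over \<iota>) (V.dim (orth K))
        = (V.dim (orth K) - 1) + dim_bound (degree_over \<iota>) (V.dim (orth (insert x K)))"
      using degree_pos orth by (subst dim_bound.simps) simp
    ultimately show ?thesis using le IH H by linarith
  qed
qed

lemma optimal:
  assumes "infinite (UNIV :: 'f set) \<or> V.dim UNIV \<le> card (UNIV :: 'f set)"
  shows "optimal_trivial_spectrum_subspace \<iota> act (\<A> act b)"
  unfolding optimal_trivial_spectrum_subspace_def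
proof (intro conjI allI impI \<A>_trivial_spectrum)
  fix T assume T: "trivial_spectrum_subspace \<iota> act T"
  have "E.dim T \<le> dim_bound (degree_over \<iota>) (V.dim UNIV)"
    using T assms unfolding trivial_spectrum_subspace_iff by (intro dim_le_dim_bound) blast+
  also have "\<dots> \<le> E.dim (\<A> act b)"
    using dim_bound_le_dim_killing[of "{}"] by (simp add: orth_def killing_def)
  finally show "E.dim T \<le> E.dim (\<A> act b)" .
qed

end

text \<open>Condition (ii) is treated in both readings, for every associated pair and for one given
  pair; the first reading needs a pair to exist.\<close>

theorem theorem1p10:
  fixes \<iota> :: "'f::field \<Rightarrow> 'd::division_ring"
    and act :: "'v::ab_group_add \<Rightarrow> 'd \<Rightarrow> 'v"
    and b :: "'v \<Rightarrow> 'v \<Rightarrow> 'f"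
    and d n :: nat
  assumes "central_subfield \<iota>"
    and "finite_over \<iota>" and "degree_over \<iota> = d"
    and "right_vector_space act"
    and "has_right_dim act n" and "n > 0"
    and "infinite (UNIV :: 'f set) \<or> n * d \<le> card (UNIV :: 'f set)"
    and "bilinear_form \<iota> act b" and "nonisotropic b"
  defines "P \<equiv> irreducible_in_End act (\<A> act b) \<and> optimal_trivial_spectrum_subspace \<iota> act (\<A> act b)"
    and "represents \<equiv> (\<lambda>\<sigma> e B. sesquilinear act \<sigma> B \<and> (\<forall>x y. b x y = e (B x y)))"
  shows "(P \<longleftrightarrow> quadratic_type \<iota> \<and> (\<forall>\<sigma> e. associated_pair \<iota> \<sigma> e \<longrightarrow> (\<exists>B. represents \<sigma> e B))) \<and>
         (\<forall>\<sigma> e. associated_pair \<iota> \<sigma> e \<longrightarrow> (P \<longleftrightarrow> quadratic_type \<iota> \<and> (\<exists>B. represents \<sigma> e B))) \<and>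
         (P \<longrightarrow> (\<forall>\<sigma> e. associated_pair \<iota> \<sigma> e \<longrightarrow> (\<exists>!B. represents \<sigma> e B)))"
proof -
  obtain X where X: "right_basis act X" "card X = n"
    using assms(5) unfolding has_right_dim_def by blast
  interpret right_vector_space act by fact
  interpret form_ext \<iota> act b
    by unfold_locales (use assms X in auto)
  have nonzero: "(UNIV :: 'v set) \<noteq> {0}"
  proof
    assume U: "(UNIV :: 'v set) = {0}"
    obtain x where "x \<in> X" using X(2) \<open>n > 0\<close> by fastforce
    moreover have "(\<Sum>x\<in>X. act x 1) = 0" using U by blast
    ultimately have "(1 :: 'd) = 0"
      using X(1)[unfolded right_basis_def, THEN conjunct2, THEN conjunct1, rule_format, of "\<lambda>_. 1"] by blast
    then show False by simp
  qed
  have big: "infinite (UNIV :: 'f set) \<or> V.dim UNIV \<le> card (UNIV :: 'f set)"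
    using V_dim_le[OF X(1)] assms(3,7) X(2) by auto
  have necessary: "transitive" if P
    using that optimal_imp_transitive unfolding P_def by blast
  have quadratic: "quadratic_type \<iota>" if P
    using transitive_imp_quadratic_type necessary[OF that] nonzero by blast
  have exists: "\<exists>B. represents \<sigma> e B" if P "associated_pair \<iota> \<sigma> e" for \<sigma> e
    unfolding represents_def by (rule transitive_imp_representation[OF necessary[OF that(1)] that(2)])
  have unique: "B = C" if "associated_pair \<iota> \<sigma> e" "represents \<sigma> e B" "represents \<sigma> e C" for \<sigma> e B C
    using that(2,3) unfolding represents_def
    by (intro form_representation_unique[OF that(1)]) metis+
  have sufficient: P if pr: "associated_pair \<iota> \<sigma> e" and B: "represents \<sigma> e B" for \<sigma> e B
  proof -
    interpret sesquilinear_ext \<iota> act b \<sigma> e B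
      by unfold_locales (use pr B in \<open>auto simp: represents_def\<close>)
    show ?thesis unfolding P_def
      using transitive_imp_irreducible[OF transitive nonzero] optimal[OF big] by blast
  qed
  have pair: "\<exists>\<sigma> e. associated_pair \<iota> \<sigma> e" if "quadratic_type \<iota>"
  proof (rule exists_associated_pair[OF that])
    assume "quadratic_type_iii \<iota>"
    then have "d = 4" using assms(3) unfolding quadratic_type_iii_def by simp
    \<comment> \<open>Degree 4 gives |F| >= 4 n, which rules out the field with two
      elements.\<close>
    show "\<exists>a :: 'f. a \<noteq> 0 \<and> a \<noteq> 1"
    proof (rule ccontr)
      assume "\<not> ?thesis"
      then have sub: "(UNIV :: 'f set) \<subseteq> {0, 1}" by blast
      then have "finite (UNIV :: 'f set)" by (rule finite_subset) simp
      moreover have "card (UNIV :: 'f set) \<le> card {0, 1 :: 'f}" by (rule card_mono[OF _ sub]) simp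
      ultimately have "n * 4 \<le> 2" using assms(7) \<open>d = 4\<close> by auto
      then show False using \<open>n > 0\<close> by simp
    qed
  qed
  have "P \<longleftrightarrow> quadratic_type \<iota> \<and> (\<forall>\<sigma> e. associated_pair \<iota> \<sigma> e \<longrightarrow> (\<exists>B. represents \<sigma> e B))"
    using quadratic exists sufficient pair by blast
  moreover have "P \<longleftrightarrow> quadratic_type \<iota> \<and> (\<exists>B. represents \<sigma> e B)" if "associated_pair \<iota> \<sigma> e" for \<sigma> e
    using quadratic exists[OF _ that] sufficient[OF that] by blast
  moreover have "\<exists>!B. represents \<sigma> e B" if P "associated_pair \<iota> \<sigma> e" for \<sigma> e
    using exists[OF that] unique[OF that(2)] by blast
  ultimately show ?thesis by blast
qed

end
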